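(* Let $\Bbbk$ be a field of characteristic $\neq 2,3$, let $V=V(2)=\mathrm{span}(\mu,\mu')$ be the two-dimensional $S_2$-module with $\mu'=(12)\mu$, let $\mathcal F$ be the free symmetric operad generated by $V$, let $U\subset\mathcal F(3)$ be an $S_3$-submodule, and let $\mathcal P=\mathcal P(V,U)$. Assume that, as an $S_3$-module, $U\simeq 2M_+\oplus 2M_2$ or $U\simeq 2M_-\oplus 2M_2$, and let $p(U)=(p_{ij})_{1\le i<j\le 4}\in G=G(2,4)$ be the point of the Grassmannian attached to $U$. Then $\mathcal P$ is isomorphic to its Koszul dual operad $\mathcal P^!$ if and only if $p(U)\in Y_1\cup Y_2$, where $$Y_1=\{(p_{ij})\in G\mid p_{13}=p_{24}\},\qquad Y_2=\{(p_{ij})\in G\mid p_{14}=p_{12}+p_{23}\}.$$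
   Context: Operads. $\mathcal F$ is the free symmetric $\Bbbk$-linear operad generated by $V$ placed in arity 2 only; $\mathcal F(3)=\Bbbk S_3\otimes_{\Bbbk S_2}(V\otimes V)$, where $S_2=\langle(12)\rangle\subset S_3$ and $(12)$ acts on $V\otimes V$ as $\mathrm{id}\otimes(12)$. For an $S_3$-submodule $U\subset\mathcal F(3)$, $\mathcal P(V,U)=\mathcal F/I(U)$, where $I(U)$ is the operad ideal generated by $U$. Basis of $\mathcal F(3)$: $e_1=1\otimes(\mu\otimes\mu)$, $e_2=(12)e_1$, $e_3=1\otimes(\mu'\otimes\mu)$, $e_4=(12)e_3$, and $e_{4+i}=(13)e_i$, $e_{8+i}=(23)e_i$ for $i=1,2,3,4$. Vectors of $\Bbbk^{12}$ are identified with elements of $\mathcal F(3)$ via coordinates in this basis. Koszul dual. $V^\vee$ is the dual space of $V$ with the dual $S_2$-action twisted by the sign character; it has basis $\nu,\nu'=(12)\nu$ with $\langle\nu,\mu\rangle=1$, $\langle\nu,\mu'\rangle=0$ (so $\langle\nu',\mu'\rangle=-1$, $\langle\nu',\mu\rangle=0$). Put $\mathcal F(3)^\vee=\Bbbk S_3\otimes_{\Bbbk S_2}(V^\vee\otimes V^\vee)$ with basis $f_1,\dots,f_{12}$ built from $\nu$ exactly as $e_1,\dots,e_{12}$ is built from $\mu$. The pairing between $\mathcal F(3)^\vee$ and $\mathcal F(3)$ is given by the matrix $(\langle f_i,e_j\rangle)=\mathrm{diag}(1,-1,-1,1,-1,1,1,-1,-1,1,1,-1)$. With $U^\perp=\{f\in\mathcal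 F(3)^\vee\mid\langle f,u\rangle=0\ \forall u\in U\}$, the Koszul dual operad is $\mathcal P(V,U)^!=\mathcal P(V^\vee,U^\perp)$. $S_3$-modules. $M_+$ is the trivial module, $M_-$ the sign module, $M_2$ the 2-dimensional irreducible $S_3$-module; $kM$ denotes a direct sum of $k$ copies of $M$. For $(x_1,x_2)\in\Bbbk^2$ let $$u_\pm(x_1,x_2)=(x_1,\pm x_1,x_2,\pm x_2,\pm x_1,x_1,\pm x_2,x_2,\pm x_1,x_1,\pm x_2,x_2),$$ and for $\bar x=(x_1,x_2,x_3,x_4)\in\Bbbk^4$ let $$u_2^1(\bar x)=(x_1,-x_1,x_2,-x_2,x_3,x_3-x_1,x_4,x_4-x_2,x_1-x_3,-x_3,x_2-x_4,-x_4),$$ $$u_2^2(\bar x)=(x_1-x_3,-x_3,x_2-x_4,-x_4,x_3-x_1,x_3,x_4-x_2,x_4,x_1,-x_1,x_2,-x_2).$$ Submodules of $\mathcal F(3)$ isomorphic to $M_\pm$ are those spanned by a nonzero $u_\pm(x_1,x_2)$; submodules isomorphic to $M_2$ are those spanned by $u_2^1(\bar x),u_2^2(\bar x)$ with $\bar x\neq0$. The point $p(U)$. If $U\simeq 2M_\pm\oplus 2M_2$ (a fixed choice of sign), then $U$ is spanned by $u_\pm(1,0)$, $u_\pm(0,1)$ and $u_2^i(\bar x),u_2^i(\bar y)$, $i=1,2$, where $\bar x,\bar y\in\Bbbk^4$ span a 2-dimensional subspace of $\Bbbk^4$ determined by $U$. $p(U)\in G(2,4)\subset\mathbb P^5$ is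 the point representing this subspace, with Plücker coordinates $p_{ij}=x_iy_j-x_jy_i$, $1\le i<j\le4$. *)

theory Defs
  imports "HOL-Analysis.Analysis" "HOL-Library.Function_Algebras"
begin

section \<open>Linear algebra in function spaces\<close>

definition fscale :: "'k::field \<Rightarrow> ('b \<Rightarrow> 'k) \<Rightarrow> 'b \<Rightarrow> 'k" where
  "fscale c f = (\<lambda>x. c * f x)"

interpretation fs: vector_space "fscale :: 'k::field \<Rightarrow> ('b \<Rightarrow> 'k) \<Rightarrow> 'b \<Rightarrow> 'k"
  by unfold_locales (auto simp: fscale_def fun_eq_iff algebra_simps)

definition single :: "'b \<Rightarrow> 'b \<Rightarrow> 'k::field" where
  "single b = (\<lambda>x. if x = b then 1 else 0)"

section \<open>Symmetric operads\<close>

text \<open>The component of arity \<open>n\<close> has carrier \<open>oper P n\<close>; \<open>ocomp P m n i x y\<close> is the partial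
  composition \<open>x \<circ>\<^sub>i y\<close> of \<open>x\<close> of arity \<open>m\<close> with \<open>y\<close> of arity \<open>n\<close> at the input \<open>i\<close>, and
  \<open>oact P n \<sigma> x\<close> is the left action of a permutation \<open>\<sigma>\<close> of \<open>{1..n}\<close>.  In terms of operations,
  \<open>(\<sigma> x)(a\<^sub>1,\<dots>,a\<^sub>n) = x(a\<^bsub>\<sigma> 1\<^esub>,\<dots>,a\<^bsub>\<sigma> n\<^esub>)\<close>.\<close>

record ('k, 'a) operad =
  oper :: "nat \<Rightarrow> 'a set"
  ozero :: "nat \<Rightarrow> 'a"
  oadd :: "nat \<Rightarrow> 'a \<Rightarrow> 'a \<Rightarrow> 'a"
  oscale :: "nat \<Rightarrow> 'k \<Rightarrow> 'a \<Rightarrow> 'a"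
  ounit :: "'a"
  ocomp :: "nat \<Rightarrow> nat \<Rightarrow> nat \<Rightarrow> 'a \<Rightarrow> 'a \<Rightarrow> 'a"
  oact :: "nat \<Rightarrow> (nat \<Rightarrow> nat) \<Rightarrow> 'a \<Rightarrow> 'a"

text \<open>\<open>shift_input n i j\<close> is the input of \<open>x \<circ>\<^sub>i y\<close> that comes from the input \<open>j \<noteq> i\<close> of \<open>x\<close>, where
  \<open>n\<close> is the arity of \<open>y\<close>; \<open>block_perm n i \<sigma> \<tau>\<close> is the permutation \<open>\<sigma> \<circ>\<^sub>i \<tau>\<close> of the inputs.\<close>

definition shift_input :: "nat \<Rightarrow> nat \<Rightarrow> nat \<Rightarrow> nat" where
  "shift_input n i j = (if j < i then j else j + n - 1)"

definition block_perm :: "nat \<Rightarrow> nat \<Rightarrow> (nat \<Rightarrow> nat) \<Rightarrow> (nat \<Rightarrow> nat) \<Rightarrow> nat \<Rightarrow> nat" where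
  "block_perm n i \<sigma> \<tau> p =
     (if p < i then shift_input n (\<sigma> i) (\<sigma> p)
      else if p < i + n then \<sigma> i - 1 + \<tau> (p + 1 - i)
      else shift_input n (\<sigma> i) (\<sigma> (p + 1 - n)))"

locale operad =
  fixes P :: "('k::field, 'a) operad" (structure)
  assumes zero_closed: "ozero P n \<in> oper P n"
    and add_closed: "\<lbrakk>x \<in> oper P n; y \<in> oper P n\<rbrakk> \<Longrightarrow> oadd P n x y \<in> oper P n"
    and scale_closed: "x \<in> oper P n \<Longrightarrow> oscale P n c x \<in> oper P n"
    and add_assoc: "\<lbrakk>x \<in> oper P n; y \<in> oper P n; z \<in> oper P n\<rbrakk>
      \<Longrightarrow> oadd P n (oadd P n x y) z = oadd P n x (oadd P n y z)"
    and add_commute: "\<lbrakk>x \<in> oper P n; y \<in> oper P n\<rbrakk> \<Longrightarrow> oadd P n x y = oadd P n y x"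
    and add_zero: "x \<in> oper P n \<Longrightarrow> oadd P n (ozero P n) x = x"
    and add_inverse: "x \<in> oper P n \<Longrightarrow> oadd P n (oscale P n (-1) x) x = ozero P n"
    and scale_add_right: "\<lbrakk>x \<in> oper P n; y \<in> oper P n\<rbrakk>
      \<Longrightarrow> oscale P n c (oadd P n x y) = oadd P n (oscale P n c x) (oscale P n c y)"
    and scale_add_left: "x \<in> oper P n
      \<Longrightarrow> oscale P n (c + d) x = oadd P n (oscale P n c x) (oscale P n d x)"
    and scale_scale: "x \<in> oper P n \<Longrightarrow> oscale P n c (oscale P n d x) = oscale P n (c * d) x"
    and scale_one: "x \<in> oper P n \<Longrightarrow> oscale P n 1 x = x"
    and unit_closed: "ounit P \<in> oper P 1"
    and comp_closed: "\<lbrakk>x \<in> oper P m; y \<in> oper P n; 1 \<le> i; i \<le> m\<rbrakk>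
      \<Longrightarrow> ocomp P m n i x y \<in> oper P (m + n - 1)"
    and comp_add_left: "\<lbrakk>x \<in> oper P m; x' \<in> oper P m; y \<in> oper P n; 1 \<le> i; i \<le> m\<rbrakk>
      \<Longrightarrow> ocomp P m n i (oadd P m x x') y
          = oadd P (m + n - 1) (ocomp P m n i x y) (ocomp P m n i x' y)"
    and comp_add_right: "\<lbrakk>x \<in> oper P m; y \<in> oper P n; y' \<in> oper P n; 1 \<le> i; i \<le> m\<rbrakk>
      \<Longrightarrow> ocomp P m n i x (oadd P n y y')
          = oadd P (m + n - 1) (ocomp P m n i x y) (ocomp P m n i x y')"
    and comp_scale_left: "\<lbrakk>x \<in> oper P m; y \<in> oper P n; 1 \<le> i; i \<le> m\<rbrakk>
      \<Longrightarrow> ocomp P m n i (oscale P m c x) y = oscale P (m + n - 1) c (ocomp P m n i x y)"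
    and comp_scale_right: "\<lbrakk>x \<in> oper P m; y \<in> oper P n; 1 \<le> i; i \<le> m\<rbrakk>
      \<Longrightarrow> ocomp P m n i x (oscale P n c y) = oscale P (m + n - 1) c (ocomp P m n i x y)"
    and unit_left: "y \<in> oper P n \<Longrightarrow> ocomp P 1 n 1 (ounit P) y = y"
    and unit_right: "\<lbrakk>x \<in> oper P m; 1 \<le> i; i \<le> m\<rbrakk> \<Longrightarrow> ocomp P m 1 i x (ounit P) = x"
    and comp_sequential: "\<lbrakk>x \<in> oper P m; y \<in> oper P n; z \<in> oper P k; 1 \<le> i; i \<le> m; 1 \<le> j; j \<le> n\<rbrakk>
      \<Longrightarrow> ocomp P (m + n - 1) k (i + j - 1) (ocomp P m n i x y) z
          = ocomp P m (n + k - 1) i x (ocomp P n k j y z)"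
    and comp_parallel: "\<lbrakk>x \<in> oper P m; y \<in> oper P n; z \<in> oper P k; 1 \<le> i; i < l; l \<le> m\<rbrakk>
      \<Longrightarrow> ocomp P (m + n - 1) k (l + n - 1) (ocomp P m n i x y) z
          = ocomp P (m + k - 1) n i (ocomp P m k l x z) y"
    and act_closed: "\<lbrakk>\<sigma> permutes {1..n}; x \<in> oper P n\<rbrakk> \<Longrightarrow> oact P n \<sigma> x \<in> oper P n"
    and act_add: "\<lbrakk>\<sigma> permutes {1..n}; x \<in> oper P n; y \<in> oper P n\<rbrakk>
      \<Longrightarrow> oact P n \<sigma> (oadd P n x y) = oadd P n (oact P n \<sigma> x) (oact P n \<sigma> y)"
    and act_scale: "\<lbrakk>\<sigma> permutes {1..n}; x \<in> oper P n\<rbrakk>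
      \<Longrightarrow> oact P n \<sigma> (oscale P n c x) = oscale P n c (oact P n \<sigma> x)"
    and act_id: "x \<in> oper P n \<Longrightarrow> oact P n id x = x"
    and act_comp: "\<lbrakk>\<sigma> permutes {1..n}; \<tau> permutes {1..n}; x \<in> oper P n\<rbrakk>
      \<Longrightarrow> oact P n (\<sigma> \<circ> \<tau>) x = oact P n \<sigma> (oact P n \<tau> x)"
    and comp_equivariant: "\<lbrakk>x \<in> oper P m; y \<in> oper P n; 1 \<le> i; i \<le> m;
        \<sigma> permutes {1..m}; \<tau> permutes {1..n}\<rbrakk>
      \<Longrightarrow> ocomp P m n (\<sigma> i) (oact P m \<sigma> x) (oact P n \<tau> y)
          = oact P (m + n - 1) (block_perm n i \<sigma> \<tau>) (ocomp P m n i x y)"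

definition operad_isomorphic :: "('k::field, 'a) operad \<Rightarrow> ('k, 'b) operad \<Rightarrow> bool" where
  "operad_isomorphic P Q \<longleftrightarrow>
     (\<exists>\<phi>. (\<forall>n. bij_betw (\<phi> n) (oper P n) (oper Q n))
        \<and> (\<forall>n. \<forall>x\<in>oper P n. \<forall>y\<in>oper P n. \<phi> n (oadd P n x y) = oadd Q n (\<phi> n x) (\<phi> n y))
        \<and> (\<forall>n c. \<forall>x\<in>oper P n. \<phi> n (oscale P n c x) = oscale Q n c (\<phi> n x))
        \<and> \<phi> 1 (ounit P) = ounit Q
        \<and> (\<forall>m n i. \<forall>x\<in>oper P m. \<forall>y\<in>oper P n. 1 \<le> i \<and> i \<le> m \<longrightarrow>
             \<phi> (m + n - 1) (ocomp P m n i x y) = ocomp Q m n i (\<phi> m x) (\<phi> n y))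
        \<and> (\<forall>n \<sigma>. \<forall>x\<in>oper P n. \<sigma> permutes {1..n} \<longrightarrow>
             \<phi> n (oact P n \<sigma> x) = oact Q n \<sigma> (\<phi> n x)))"

definition operad_ideal :: "('k::field, 'a) operad \<Rightarrow> (nat \<Rightarrow> 'a set) \<Rightarrow> bool" where
  "operad_ideal P I \<longleftrightarrow>
     (\<forall>n. I n \<subseteq> oper P n \<and> ozero P n \<in> I n)
   \<and> (\<forall>n. \<forall>x\<in>I n. \<forall>y\<in>I n. oadd P n x y \<in> I n)
   \<and> (\<forall>n c. \<forall>x\<in>I n. oscale P n c x \<in> I n)
   \<and> (\<forall>n \<sigma>. \<forall>x\<in>I n. \<sigma> permutes {1..n} \<longrightarrow> oact P n \<sigma> x \<in> I n)
   \<and> (\<forall>m n i. \<forall>x\<in>oper P m. \<forall>y\<in>oper P n. 1 \<le> i \<and> i \<le> m \<and> (x \<in> I m \<or> y \<in> I n) \<longrightarrow>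
        ocomp P m n i x y \<in> I (m + n - 1))"

definition generated_ideal :: "('k::field, 'a) operad \<Rightarrow> nat \<Rightarrow> 'a set \<Rightarrow> nat \<Rightarrow> 'a set" where
  "generated_ideal P k U n = \<Inter>{I n | I. operad_ideal P I \<and> U \<subseteq> I k}"

text \<open>The quotient operad consists of cosets; each operation on cosets collects the cosets of the
  results on all representatives (there is only one such coset).\<close>

definition coset :: "('k::field, 'a) operad \<Rightarrow> (nat \<Rightarrow> 'a set) \<Rightarrow> nat \<Rightarrow> 'a \<Rightarrow> 'a set" where
  "coset P I n x = oadd P n x ` I n"

definition quotient_operad ::
    "('k::field, 'a) operad \<Rightarrow> (nat \<Rightarrow> 'a set) \<Rightarrow> ('k, 'a set) operad" where
  "quotient_operad P I =
    \<lparr> oper = (\<lambda>n. coset P I n ` oper P n),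
      ozero = (\<lambda>n. coset P I n (ozero P n)),
      oadd = (\<lambda>n X Y. \<Union>x\<in>X. \<Union>y\<in>Y. coset P I n (oadd P n x y)),
      oscale = (\<lambda>n c X. \<Union>x\<in>X. coset P I n (oscale P n c x)),
      ounit = coset P I 1 (ounit P),
      ocomp = (\<lambda>m n i X Y. \<Union>x\<in>X. \<Union>y\<in>Y. coset P I (m + n - 1) (ocomp P m n i x y)),
      oact = (\<lambda>n \<sigma> X. \<Union>x\<in>X. coset P I n (oact P n \<sigma> x)) \<rparr>"

section \<open>The free operad\<close>

text \<open>For an \<open>S\<^sub>2\<close>-module \<open>E\<close> placed in arity 2, the arity \<open>n\<close> part of the free operad is the direct
  sum, over all binary trees with leaves labelled by \<open>{1..n}\<close>, of the tensor products over the
  vertices \<open>v\<close> of the spaces \<open>E(In v)\<close>, where \<open>In v\<close> is the two-element set of inputs of \<open>v\<close>.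
  If \<open>E\<close> is the free \<open>k[S\<^sub>2]\<close>-module with basis \<open>'g\<close>, then \<open>E(In v)\<close> has as a basis the elements of \<open>'g\<close>
  together with a linear order on \<open>In v\<close>.  So the free operad has as a basis the planar binary
  trees whose vertices are decorated with elements of \<open>'g\<close>, with leaves labelled bijectively.
  Both \<open>V\<close> and its twisted dual are free \<open>k[S\<^sub>2]\<close>-modules of rank one, with bases \<open>{\<mu>}\<close> and \<open>{\<nu>}\<close>.\<close>

datatype 'g btree = Leaf nat | Node 'g "'g btree" "'g btree"

primrec leaves :: "'g btree \<Rightarrow> nat list" where
  "leaves (Leaf j) = [j]"
| "leaves (Node g l r) = leaves l @ leaves r"

primrec plug :: "(nat \<Rightarrow> 'g btree) \<Rightarrow> 'g btree \<Rightarrow> 'g btree" where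
  "plug h (Leaf j) = h j"
| "plug h (Node g l r) = Node g (plug h l) (plug h r)"

definition trees :: "nat \<Rightarrow> 'g btree set" where
  "trees n = {t. distinct (leaves t) \<and> set (leaves t) = {1..n}}"

definition relabel :: "(nat \<Rightarrow> nat) \<Rightarrow> 'g btree \<Rightarrow> 'g btree" where
  "relabel \<sigma> = plug (\<lambda>j. Leaf (\<sigma> j))"

definition graft :: "nat \<Rightarrow> nat \<Rightarrow> 'g btree \<Rightarrow> 'g btree \<Rightarrow> 'g btree" where
  "graft n i s t = plug (\<lambda>j. if j = i then relabel (\<lambda>l. i - 1 + l) t else Leaf (shift_input n i j)) s"

definition free_operad :: "('k::field, 'g::finite btree \<Rightarrow> 'k) operad" where
  "free_operad =
    \<lparr> oper = (\<lambda>n. {f. \<forall>t. f t \<noteq> 0 \<longrightarrow> t \<in> trees n}),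
      ozero = (\<lambda>n. 0),
      oadd = (\<lambda>n f g. f + g),
      oscale = (\<lambda>n c f. fscale c f),
      ounit = single (Leaf 1),
      ocomp = (\<lambda>m n i f g. \<Sum>s\<in>trees m. \<Sum>t\<in>trees n. fscale (f s * g t) (single (graft n i s t))),
      oact = (\<lambda>n \<sigma> f. \<Sum>t\<in>trees n. fscale (f t) (single (relabel \<sigma> t))) \<rparr>"

text \<open>\<open>\<P>(V,U)\<close>\<close>

definition quadratic_operad :: "('g::finite btree \<Rightarrow> 'k) set \<Rightarrow> ('k::field, ('g btree \<Rightarrow> 'k) set) operad" where
  "quadratic_operad U = quotient_operad free_operad (generated_ideal free_operad 3 U)"

section \<open>The operad axioms for the free operad and its quotients\<close>

lemma leaves_plug: "leaves (plug h t) = concat (map (\<lambda>j. leaves (h j)) (leaves t))"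
  by (induction t) auto

lemma plug_plug: "plug h (plug h' t) = plug (\<lambda>j. plug h (h' j)) t"
  by (induction t) auto

lemma plug_cong: "(\<And>j. j \<in> set (leaves t) \<Longrightarrow> h j = h' j) \<Longrightarrow> plug h t = plug h' t"
  by (induction t) auto

lemma plug_Leaf: "plug Leaf t = t"
  by (induction t) auto

lemma leaves_relabel: "leaves (relabel \<sigma> t) = map \<sigma> (leaves t)"
  by (induction t) (auto simp: relabel_def)

lemma finite_trees_aux: "finite {t :: 'g::finite btree. length (leaves t) = n \<and> set (leaves t) \<subseteq> A}"
  if "finite A"
proof (induction n rule: less_induct)
  case (less n)
  let ?T = "\<lambda>n. {t :: 'g btree. length (leaves t) = n \<and> set (leaves t) \<subseteq> A}"
  have ne: "length (leaves t) > 0" for t :: "'g btree" by (induction t) auto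
  have "?T n \<subseteq> Leaf ` A \<union> (\<Union>g. \<Union>i\<in>{..<n}. \<Union>j\<in>{..<n}. (\<lambda>(l, r). Node g l r) ` (?T i \<times> ?T j))"
  proof
    fix t assume t: "t \<in> ?T n"
    show "t \<in> Leaf ` A \<union> (\<Union>g. \<Union>i\<in>{..<n}. \<Union>j\<in>{..<n}. (\<lambda>(l, r). Node g l r) ` (?T i \<times> ?T j))"
    proof (cases t)
      case (Node g l r)
      have "length (leaves l) < n" "length (leaves r) < n"
        using t Node ne[of l] ne[of r] by auto
      moreover have "l \<in> ?T (length (leaves l))" "r \<in> ?T (length (leaves r))" using t Node by auto
      ultimately show ?thesis unfolding Node by blast
    qed (use t in auto)
  qed
  moreover have "finite \<dots>" using that less by auto
  ultimately show ?case by (rule finite_subset)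
qed

lemma finite_trees: "finite (trees n :: 'g::finite btree set)"
proof (rule finite_subset)
  show "(trees n :: 'g btree set) \<subseteq> {t. length (leaves t) = n \<and> set (leaves t) \<subseteq> {1..n}}"
    using distinct_card by (force simp: trees_def)
qed (rule finite_trees_aux, simp)

lemma relabel_trees: "\<sigma> permutes {1..n} \<Longrightarrow> t \<in> trees n \<Longrightarrow> relabel \<sigma> t \<in> trees n"
  unfolding trees_def
  by (auto simp: leaves_relabel distinct_map permutes_image permutes_inj_on permutes_in_image inj_on_def
     dest: permutes_inj[THEN injD])

lemma leaves_graft: "leaves (graft n i s t) = concat (map (\<lambda>j. if j = i then map (\<lambda>l. i - 1 + l) (leaves t) else [shift_input n i j]) (leaves s))"
  unfolding graft_def leaves_plug by (rule arg_cong[of _ _ concat]) (auto simp: leaves_relabel)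

lemma distinct_concat_map:
  "distinct xs \<Longrightarrow> (\<And>x. x \<in> set xs \<Longrightarrow> distinct (f x)) \<Longrightarrow>
   (\<And>x y. x \<in> set xs \<Longrightarrow> y \<in> set xs \<Longrightarrow> x \<noteq> y \<Longrightarrow> set (f x) \<inter> set (f y) = {}) \<Longrightarrow> distinct (concat (map f xs))"
proof (induction xs)
  case (Cons a xs)
  have "set (f a) \<inter> set (f y) = {}" if "y \<in> set xs" for y
    using Cons.prems(1) Cons.prems(3)[of a y] that by auto
  then show ?case using Cons by auto
qed simp

lemma shift_image: assumes "1 \<le> i" "i \<le> m"
  shows "(shift_input n i ` ({1..m} - {i})) \<union> (\<lambda>l. i - 1 + l) ` {1..n} = {1..m + n - 1}"
proof (intro equalityI subsetI)
  fix p assume p: "p \<in> {1..m+n-1}"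
  consider "p < i" | "i \<le> p" "p < i + n" | "i + n \<le> p" by linarith
  then show "p \<in> (shift_input n i ` ({1..m} - {i})) \<union> (\<lambda>l. i - 1 + l) ` {1..n}"
  proof cases
    case 1 then have "p = shift_input n i p" "p \<in> {1..m} - {i}" using p assms by (auto simp: shift_input_def)
    then show ?thesis by blast
  next
    case 2 then have "p = i - 1 + (p + 1 - i)" "p + 1 - i \<in> {1..n}" using p assms by auto
    then show ?thesis by blast
  next
    case 3 then have "p = shift_input n i (p + 1 - n)" "p + 1 - n \<in> {1..m} - {i}" using p assms by (auto simp: shift_input_def)
    then show ?thesis by blast
  qed
qed (use assms in \<open>auto simp: shift_input_def\<close>)

lemma graft_trees:
  assumes "s \<in> trees m" "t \<in> trees n" "1 \<le> i" "i \<le> m"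
  shows "graft n i s t \<in> trees (m + n - 1)"
proof -
  have ds: "distinct (leaves s)" "set (leaves s) = {1..m}" and dt: "distinct (leaves t)" "set (leaves t) = {1..n}"
    using assms by (auto simp: trees_def)
  have "distinct (leaves (graft n i s t))"
    unfolding leaves_graft
    by (rule distinct_concat_map)
      (use assms ds dt in \<open>auto simp: distinct_map inj_on_def shift_input_def split: if_splits\<close>)
  moreover have "set (leaves (graft n i s t)) = (shift_input n i ` ({1..m} - {i})) \<union> (\<lambda>l. i - 1 + l) ` {1..n}"
    unfolding leaves_graft using assms ds dt by auto
  ultimately show ?thesis using shift_image[OF assms(3,4)] by (simp add: trees_def)
qed

abbreviation "free_part n \<equiv> {f. \<forall>t. f t \<noteq> 0 \<longrightarrow> t \<in> trees n}"

lemma F_expand: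
  fixes f :: "'g::finite btree \<Rightarrow> 'k::field"
  assumes "f \<in> free_part n" shows "f = (\<Sum>t\<in>trees n. fscale (f t) (single t))"
proof
  fix s
  have "(\<Sum>t\<in>trees n. fscale (f t) (single t)) s = (\<Sum>t\<in>trees n. if s = t then f t else 0)"
  proof -
    have "(sum h A) s = (\<Sum>a\<in>A. h a s)" for h :: "'g btree \<Rightarrow> 'g btree \<Rightarrow> 'k" and A
      by (induction A rule: infinite_finite_induct) auto
    then show ?thesis by (auto simp: fscale_def single_def intro!: sum.cong)
  qed
  then show "f s = (\<Sum>t\<in>trees n. fscale (f t) (single t)) s"
    using assms by (auto simp: finite_trees sum.delta)
qed

lemma F_span: "free_part n = fs.span (single ` (trees n :: 'g::finite btree set) :: ('g btree \<Rightarrow> 'k::field) set)"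
proof (intro equalityI subsetI)
  fix f :: "'g btree \<Rightarrow> 'k" assume "f \<in> free_part n"
  then have "f = (\<Sum>t\<in>trees n. fscale (f t) (single t))" by (rule F_expand)
  also have "\<dots> \<in> fs.span (single ` trees n)"
    by (intro fs.span_sum fs.span_scale fs.span_base) auto
  finally show "f \<in> fs.span (single ` trees n)" .
next
  have sub: "fs.subspace (free_part n :: ('g btree \<Rightarrow> 'k) set)"
    by (auto simp: fs.subspace_def fscale_def) (metis add.right_neutral)
  fix f :: "'g btree \<Rightarrow> 'k" assume "f \<in> fs.span (single ` trees n)"
  then show "f \<in> free_part n"
    using fs.span_minimal[OF _ sub, of "single ` trees n"] by (fastforce simp: single_def split: if_splits)
qed

interpretation fsp: vector_space_pair
  "fscale :: 'k::field \<Rightarrow> ('b \<Rightarrow> 'k) \<Rightarrow> 'b \<Rightarrow> 'k" "fscale :: 'k::field \<Rightarrow> ('c \<Rightarrow> 'k) \<Rightarrow> 'c \<Rightarrow> 'k"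
  by unfold_locales

abbreviation "flinear \<equiv> Vector_Spaces.linear fscale fscale"

abbreviation "free_comp \<equiv> ocomp free_operad"
abbreviation "free_act \<equiv> oact free_operad"

lemma C_eq: "free_comp m n i f g = (\<Sum>s\<in>trees m. \<Sum>t\<in>trees n. fscale (f s * g t) (single (graft n i s t)))"
  by (simp add: free_operad_def)
lemma A_eq: "free_act n \<sigma> f = (\<Sum>t\<in>trees n. fscale (f t) (single (relabel \<sigma> t)))"
  by (simp add: free_operad_def)

lemma linI:
  fixes f :: "('b \<Rightarrow> 'k::field) \<Rightarrow> ('c \<Rightarrow> 'k)"
  shows "(\<And>x y. f (x + y) = f x + f y) \<Longrightarrow> (\<And>c x. f (fscale c x) = fscale c (f x)) \<Longrightarrow> flinear f"
  by unfold_locales auto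

lemma linD: "flinear f \<Longrightarrow> f (x + y) = f x + f y" "flinear f \<Longrightarrow> f (fscale c x) = fscale c (f x)"
  by (simp_all add: Vector_Spaces.linear_iff)

lemma fscale_mult: "fscale (fscale c f s * a) h = fscale c (fscale (f s * a) h)"
  "fscale (a * fscale c f s) h = fscale c (fscale (a * f s) h)"
  "fscale (fscale c f s) h = fscale c (fscale (f s) h)"
  by (simp_all add: fscale_def ac_simps)

lemma lin_C1: "flinear (\<lambda>f. free_comp m n i f g)"
  by (rule linI) (simp_all add: C_eq fs.scale_left_distrib distrib_right sum.distrib fs.scale_sum_right fscale_mult del: fs.scale_scale)

lemma lin_C2: "flinear (\<lambda>g. free_comp m n i f g)"
  by (rule linI) (simp_all add: C_eq fs.scale_left_distrib distrib_left sum.distrib fs.scale_sum_right fscale_mult del: fs.scale_scale)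

lemma lin_A: "flinear (free_act n \<sigma>)"
  by (rule linI) (simp_all add: A_eq fs.scale_left_distrib sum.distrib fs.scale_sum_right fscale_mult del: fs.scale_scale)

lemma C_single: "s \<in> trees m \<Longrightarrow> t \<in> trees n \<Longrightarrow> free_comp m n i (single s) (single t) = single (graft n i s t)"
proof -
  assume s: "s \<in> trees m" and t: "t \<in> trees n"
  have "free_comp m n i (single s) (single t) = (\<Sum>s'\<in>trees m. \<Sum>t'\<in>trees n. if t' = t then (if s' = s then single (graft n i s t) else 0) else 0)"
    unfolding C_eq by (intro sum.cong) (auto simp: single_def fscale_def)
  then show ?thesis using s t by (simp add: sum.delta' finite_trees)
qed

lemma A_single: "t \<in> trees n \<Longrightarrow> free_act n \<sigma> (single t) = single (relabel \<sigma> t)"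
proof -
  assume t: "t \<in> trees n"
  have "free_act n \<sigma> (single t) = (\<Sum>t'\<in>trees n. if t' = t then single (relabel \<sigma> t) else 0)"
    unfolding A_eq by (intro sum.cong) (auto simp: single_def fscale_def)
  then show ?thesis using t by (simp add: finite_trees)
qed

lemma lin_compose: "flinear f \<Longrightarrow> flinear g \<Longrightarrow> flinear (\<lambda>x. f (g x))"
  by (simp add: Vector_Spaces.linear_iff)

lemma F_eqI:
  fixes f g :: "('g::finite btree \<Rightarrow> 'k::field) \<Rightarrow> ('c \<Rightarrow> 'k)"
  assumes "flinear f" "flinear g" "x \<in> free_part n" "\<And>t. t \<in> trees n \<Longrightarrow> f (single t) = g (single t)"
  shows "f x = g x"
proof (rule fsp.linear_eq_on[OF assms(1,2)])
  show "x \<in> fs.span (single ` trees n)" using assms(3) unfolding F_span .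
qed (use assms(4) in blast)

lemma subF: "fs.subspace (free_part n :: ('g::finite btree \<Rightarrow> 'k::field) set)"
  unfolding F_span by simp

lemma C_closed: assumes "1 \<le> i" "i \<le> m" shows "free_comp m n i f g \<in> free_part (m + n - 1)"
proof -
  have "free_comp m n i f g \<in> fs.span (single ` trees (m + n - 1))"
    unfolding C_eq by (intro fs.span_sum fs.span_scale fs.span_base) (use assms in \<open>auto intro!: imageI graft_trees simp del: One_nat_def\<close>)
  then show ?thesis unfolding F_span .
qed

lemma A_closed: assumes "\<sigma> permutes {1..n}" shows "free_act n \<sigma> f \<in> free_part n"
proof -
  have "free_act n \<sigma> f \<in> fs.span (single ` trees n)"
    unfolding A_eq by (intro fs.span_sum fs.span_scale fs.span_base) (use assms in \<open>auto intro!: imageI relabel_trees simp del: One_nat_def\<close>)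
  then show ?thesis unfolding F_span .
qed

lemma graft_seq:
  assumes "s \<in> trees m" "t \<in> trees n" "u \<in> trees k" "1 \<le> i" "i \<le> m" "1 \<le> j" "j \<le> n"
  shows "graft k (i + j - 1) (graft n i s t) u = graft (n + k - 1) i s (graft k j t u)"
proof -
  have T: "set (leaves t) = {1..n}" using assms by (auto simp: trees_def)
  define a where "a = i - 1"
  have i: "i = Suc a" using assms by (simp add: a_def)
  define b where "b = j - 1"
  have j: "j = Suc b" using assms by (simp add: b_def)
  have bn: "b < n" using assms j by simp
  show ?thesis
    unfolding graft_def plug_plug relabel_def
  proof (rule plug_cong)
    fix p assume "p \<in> set (leaves s)"
    show "plug (\<lambda>q. if q = i + j - 1 then plug (\<lambda>l. Leaf (i + j - 1 - 1 + l)) u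
            else Leaf (shift_input k (i + j - 1) q))
          (if p = i then plug (\<lambda>l. Leaf (i - 1 + l)) t else Leaf (shift_input n i p)) =
        (if p = i then plug (\<lambda>q. plug (\<lambda>l. Leaf (i - 1 + l))
            (if q = j then plug (\<lambda>l. Leaf (j - 1 + l)) u else Leaf (shift_input k j q))) t
          else Leaf (shift_input (n + k - 1) i p))"
    proof (cases "p = i")
      case True
      then show ?thesis
        by (auto simp: plug_plug i j shift_input_def T add.assoc intro!: plug_cong)
    next
      case False
      then show ?thesis using bn by (auto simp: i j shift_input_def)
    qed
  qed
qed

lemma graft_par:
  assumes "s \<in> trees m" "t \<in> trees n" "u \<in> trees k" "1 \<le> i" "i < l" "l \<le> m"
  shows "graft k (l + n - 1) (graft n i s t) u = graft n i (graft k l s u) t"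
proof -
  have S: "set (leaves s) = {1..m}" and T: "set (leaves t) = {1..n}" and U: "set (leaves u) = {1..k}" using assms by (auto simp: trees_def)
  show ?thesis
    unfolding graft_def plug_plug relabel_def
    by (intro plug_cong) 
     (use assms S T U in \<open>auto simp: plug_plug shift_input_def intro!: plug_cong split: if_splits\<close>)
qed

lemma relabel_relabel: "relabel \<sigma> (relabel \<tau> t) = relabel (\<sigma> \<circ> \<tau>) t"
  by (simp add: relabel_def plug_plug)

lemma graft_equivariant:
  assumes "s \<in> trees m" "t \<in> trees n" "1 \<le> i" "i \<le> m" "\<sigma> permutes {1..m}" "\<tau> permutes {1..n}"
  shows "graft n (\<sigma> i) (relabel \<sigma> s) (relabel \<tau> t) = relabel (block_perm n i \<sigma> \<tau>) (graft n i s t)"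
proof -
  have S: "set (leaves s) = {1..m}" and T: "set (leaves t) = {1..n}" using assms by (auto simp: trees_def)
  have inj: "\<sigma> a = \<sigma> b \<longleftrightarrow> a = b" for a b using permutes_inj[OF assms(5)] by (auto dest: injD)
  have "\<sigma> i \<in> {1..m}" using assms permutes_in_image[OF assms(5)] by auto
  then show ?thesis
    unfolding graft_def plug_plug relabel_def
    apply (intro plug_cong)
     using assms S T 
     apply (auto simp: plug_plug shift_input_def block_perm_def inj intro!: plug_cong split: if_splits)
     done
qed


lemma fF: "oper free_operad n = free_part n" "oadd free_operad n f g = f + g" "oscale free_operad n c f = fscale c f"
  "ozero free_operad n = 0" "ounit free_operad = single (Leaf 1)"
  by (simp_all add: free_operad_def)

lemma unit_trees: "Leaf 1 \<in> trees 1" by (auto simp: trees_def)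

lemma graft_unit_left: "t \<in> trees n \<Longrightarrow> graft n 1 (Leaf 1) t = t"
  using plug_Leaf[of t] by (simp add: graft_def relabel_def)

lemma graft_unit_right: "graft 1 i s (Leaf 1) = s" if "1 \<le> i"
proof -
  have "graft 1 i s (Leaf 1) = plug Leaf s"
    unfolding graft_def using that by (intro plug_cong) (auto simp: relabel_def shift_input_def)
  then show ?thesis by (simp add: plug_Leaf)
qed

lemma lin_id: "flinear (\<lambda>x. x)" by (rule linI) auto

lemma free_operad: "operad (free_operad :: ('k::field, 'g::finite btree \<Rightarrow> 'k) operad)"
proof
  fix m n k i j l :: nat and x x' y y' z :: "'g btree \<Rightarrow> 'k" and c d :: 'k and \<sigma> \<tau> :: "nat \<Rightarrow> nat"
  let ?P = "free_operad :: ('k, 'g btree \<Rightarrow> 'k) operad"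
  note [simp del] = mem_Collect_eq
  show "ozero ?P n \<in> oper ?P n"
    unfolding fF by (rule fs.subspace_0[OF subF])
  show "oadd ?P n x y \<in> oper ?P n" if "x \<in> oper ?P n" "y \<in> oper ?P n"
    using that unfolding fF by (rule fs.subspace_add[OF subF])
  show "oscale ?P n c x \<in> oper ?P n" if "x \<in> oper ?P n"
    using that unfolding fF by (rule fs.subspace_scale[OF subF])
  show "ounit ?P \<in> oper ?P 1"
    unfolding fF using unit_trees by (auto simp: single_def mem_Collect_eq split: if_splits)
  show "ocomp ?P m n i x y \<in> oper ?P (m + n - 1)" if "1 \<le> i" "i \<le> m"
    unfolding fF(1) using that by (rule C_closed)
  show "ocomp ?P 1 n 1 (ounit ?P) y = y" if "y \<in> oper ?P n"
    unfolding fF by (rule F_eqI[OF lin_C2 lin_id that[unfolded fF]])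
      (simp add: C_single[OF unit_trees] graft_unit_left del: One_nat_def)
  show "ocomp ?P m 1 i x (ounit ?P) = x" if "x \<in> oper ?P m" "1 \<le> i" "i \<le> m"
    unfolding fF by (rule F_eqI[OF lin_C1 lin_id that(1)[unfolded fF]])
      (use that in \<open>simp add: C_single[OF _ unit_trees] graft_unit_right del: One_nat_def\<close>)
  show "ocomp ?P (m + n - 1) k (i + j - 1) (ocomp ?P m n i x y) z
          = ocomp ?P m (n + k - 1) i x (ocomp ?P n k j y z)"
    if "x \<in> oper ?P m" "y \<in> oper ?P n" "z \<in> oper ?P k" and ij: "1 \<le> i" "i \<le> m" "1 \<le> j" "j \<le> n"
  proof (rule F_eqI[OF lin_compose[OF lin_C1 lin_C1] lin_C1 that(1)[unfolded fF]])
    fix s :: "'g btree" assume s: "s \<in> trees m"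
    show "free_comp (m + n - 1) k (i + j - 1) (free_comp m n i (single s) y) z = free_comp m (n + k - 1) i (single s) (free_comp n k j y z)"
    proof (rule F_eqI[OF lin_compose[OF lin_C1 lin_C2] lin_compose[OF lin_C2 lin_C1] that(2)[unfolded fF]])
      fix t :: "'g btree" assume t: "t \<in> trees n"
      show "free_comp (m + n - 1) k (i + j - 1) (free_comp m n i (single s) (single t)) z
          = free_comp m (n + k - 1) i (single s) (free_comp n k j (single t) z)"
      proof (rule F_eqI[OF lin_C2 lin_compose[OF lin_C2 lin_C2] that(3)[unfolded fF]])
        fix u :: "'g btree" assume u: "u \<in> trees k"
        show "free_comp (m + n - 1) k (i + j - 1) (free_comp m n i (single s) (single t)) (single u)
          = free_comp m (n + k - 1) i (single s) (free_comp n k j (single t) (single u))"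
          using graft_trees[OF s t ij(1,2)] graft_trees[OF t u ij(3,4)]
          by (simp only: C_single s t u graft_seq[OF s t u ij])
      qed
    qed
  qed
  show "ocomp ?P (m + n - 1) k (l + n - 1) (ocomp ?P m n i x y) z
          = ocomp ?P (m + k - 1) n i (ocomp ?P m k l x z) y"
    if "x \<in> oper ?P m" "y \<in> oper ?P n" "z \<in> oper ?P k" and il: "1 \<le> i" "i < l" "l \<le> m"
  proof (rule F_eqI[OF lin_compose[OF lin_C1 lin_C1] lin_compose[OF lin_C1 lin_C1] that(1)[unfolded fF]])
    fix s :: "'g btree" assume s: "s \<in> trees m"
    show "free_comp (m + n - 1) k (l + n - 1) (free_comp m n i (single s) y) z = free_comp (m + k - 1) n i (free_comp m k l (single s) z) y"
    proof (rule F_eqI[OF lin_compose[OF lin_C1 lin_C2] lin_C2 that(2)[unfolded fF]])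
      fix t :: "'g btree" assume t: "t \<in> trees n"
      show "free_comp (m + n - 1) k (l + n - 1) (free_comp m n i (single s) (single t)) z
          = free_comp (m + k - 1) n i (free_comp m k l (single s) z) (single t)"
      proof (rule F_eqI[OF lin_C2 lin_compose[OF lin_C1 lin_C2] that(3)[unfolded fF]])
        fix u :: "'g btree" assume u: "u \<in> trees k"
        have "graft n i s t \<in> trees (m + n - 1)" "graft k l s u \<in> trees (m + k - 1)"
          using il by (auto intro!: graft_trees s t u simp del: One_nat_def)
        then show "free_comp (m + n - 1) k (l + n - 1) (free_comp m n i (single s) (single t)) (single u)
          = free_comp (m + k - 1) n i (free_comp m k l (single s) (single u)) (single t)"
          by (simp only: C_single s t u graft_par[OF s t u il])
      qed
    qed
  qed
  show "oact ?P n \<sigma> x \<in> oper ?P n" if "\<sigma> permutes {1..n}"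
    unfolding fF using that by (rule A_closed)
  show "oact ?P n id x = x" if "x \<in> oper ?P n"
    by (rule F_eqI[OF lin_A lin_id that[unfolded fF]]) (simp add: A_single relabel_def plug_Leaf)
  show "oact ?P n (\<sigma> \<circ> \<tau>) x = oact ?P n \<sigma> (oact ?P n \<tau> x)"
    if "\<sigma> permutes {1..n}" "\<tau> permutes {1..n}" "x \<in> oper ?P n"
    by (rule F_eqI[OF lin_A lin_compose[OF lin_A lin_A] that(3)[unfolded fF]])
      (simp only: A_single relabel_trees[OF that(2)] relabel_relabel)
  show "ocomp ?P m n (\<sigma> i) (oact ?P m \<sigma> x) (oact ?P n \<tau> y)
          = oact ?P (m + n - 1) (block_perm n i \<sigma> \<tau>) (ocomp ?P m n i x y)"
    if "x \<in> oper ?P m" "y \<in> oper ?P n" and i: "1 \<le> i" "i \<le> m"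
      and p: "\<sigma> permutes {1..m}" "\<tau> permutes {1..n}"
  proof (rule F_eqI[OF lin_compose[OF lin_C1 lin_A] lin_compose[OF lin_A lin_C1] that(1)[unfolded fF]])
    fix s :: "'g btree" assume s: "s \<in> trees m"
    show "free_comp m n (\<sigma> i) (free_act m \<sigma> (single s)) (free_act n \<tau> y)
        = free_act (m + n - 1) (block_perm n i \<sigma> \<tau>) (free_comp m n i (single s) y)"
    proof (rule F_eqI[OF lin_compose[OF lin_C2 lin_A] lin_compose[OF lin_A lin_C2] that(2)[unfolded fF]])
      fix t :: "'g btree" assume t: "t \<in> trees n"
      show "free_comp m n (\<sigma> i) (free_act m \<sigma> (single s)) (free_act n \<tau> (single t))
        = free_act (m + n - 1) (block_perm n i \<sigma> \<tau>) (free_comp m n i (single s) (single t))"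
        by (simp only: A_single C_single s t relabel_trees[OF p(1) s] relabel_trees[OF p(2) t]
          graft_trees[OF s t i] graft_equivariant[OF s t i p])
    qed
  qed
  show "oadd ?P n (oscale ?P n (-1) x) x = ozero ?P n"
    by (simp add: fF fscale_def fun_eq_iff)
  show "oadd ?P n x y = oadd ?P n y x" unfolding fF by (rule add.commute)
  show "oadd ?P n (oadd ?P n x y) z = oadd ?P n x (oadd ?P n y z)" unfolding fF by (rule add.assoc)
  show "oadd ?P n (ozero ?P n) x = x" unfolding fF by (rule add_0_left)
  show "oscale ?P n c (oadd ?P n x y) = oadd ?P n (oscale ?P n c x) (oscale ?P n c y)"
    unfolding fF by (rule fs.scale_right_distrib)
  show "oscale ?P n (c + d) x = oadd ?P n (oscale ?P n c x) (oscale ?P n d x)"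
    unfolding fF by (rule fs.scale_left_distrib)
  show "oscale ?P n c (oscale ?P n d x) = oscale ?P n (c * d) x"
    unfolding fF by (rule fs.scale_scale)
  show "oscale ?P n 1 x = x" unfolding fF by (rule fs.scale_one)
  show "ocomp ?P m n i (oadd ?P m x x') y = oadd ?P (m + n - 1) (ocomp ?P m n i x y) (ocomp ?P m n i x' y)"
    unfolding fF by (rule linD(1)[OF lin_C1])
  show "ocomp ?P m n i x (oadd ?P n y y') = oadd ?P (m + n - 1) (ocomp ?P m n i x y) (ocomp ?P m n i x y')"
    unfolding fF by (rule linD(1)[OF lin_C2])
  show "ocomp ?P m n i (oscale ?P m c x) y = oscale ?P (m + n - 1) c (ocomp ?P m n i x y)"
    unfolding fF by (rule linD(2)[OF lin_C1])
  show "ocomp ?P m n i x (oscale ?P n c y) = oscale ?P (m + n - 1) c (ocomp ?P m n i x y)"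
    unfolding fF by (rule linD(2)[OF lin_C2])
  show "oact ?P n \<sigma> (oadd ?P n x y) = oadd ?P n (oact ?P n \<sigma> x) (oact ?P n \<sigma> y)"
    unfolding fF by (rule linD(1)[OF lin_A])
  show "oact ?P n \<sigma> (oscale ?P n c x) = oscale ?P n c (oact ?P n \<sigma> x)"
    unfolding fF by (rule linD(2)[OF lin_A])
qed

lemma block_perm_permutes:
  assumes p: "\<sigma> permutes {1..m}" "\<tau> permutes {1..n}" and i: "1 \<le> i" "i \<le> m"
  shows "block_perm n i \<sigma> \<tau> permutes {1..m + n - 1}"
proof -
  have s0: "\<sigma> 0 = 0" and t0: "\<tau> 0 = 0" using p by (auto simp: permutes_def)
  have s1: "\<sigma> j = j" if "j > m" for j using p that by (auto simp: permutes_def)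
  have sr: "1 \<le> \<sigma> j" "\<sigma> j \<le> m" if "1 \<le> j" "j \<le> m" for j
    using permutes_in_image[OF p(1), of j] that by auto
  have tr: "1 \<le> \<tau> j" "\<tau> j \<le> n" if "1 \<le> j" "j \<le> n" for j
    using permutes_in_image[OF p(2), of j] that by auto
  have si: "\<sigma> a = \<sigma> b \<longleftrightarrow> a = b" for a b using permutes_inj[OF p(1)] by (auto dest: injD)
  have ti: "\<tau> a = \<tau> b \<longleftrightarrow> a = b" for a b using permutes_inj[OF p(2)] by (auto dest: injD)
  let ?b = "block_perm n i \<sigma> \<tau>"
  have out: "?b x = x" if "x \<notin> {1..m + n - 1}" for x
  proof (cases "x = 0")
    case True
    then show ?thesis using i sr[OF i] s0 by (simp add: block_perm_def shift_input_def)
  next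
    case False
    then have "x \<ge> i + n" "x + 1 - n > m" using that i by auto
    then show ?thesis using s1[of "x + 1 - n"] sr[OF i] False i by (simp add: block_perm_def shift_input_def)
  qed
  have into: "?b x \<in> {1..m + n - 1}" if x: "x \<in> {1..m + n - 1}" for x
  proof -
    consider "x < i" | "i \<le> x" "x < i + n" | "i + n \<le> x" by linarith
    then show ?thesis
    proof cases
      case 1
      then have "\<sigma> x \<noteq> \<sigma> i" by (simp add: si)
      then show ?thesis using 1 sr[of x] x i sr[OF i] by (auto simp: block_perm_def shift_input_def)
    next
      case 2
      then have "1 \<le> x + 1 - i" "x + 1 - i \<le> n" by auto
      with 2 show ?thesis using tr[of "x + 1 - i"] sr[OF i] by (auto simp: block_perm_def Suc_le_eq)
    next
      case 3
      then have "\<sigma> (x + 1 - n) \<noteq> \<sigma> i" using i by (simp add: si)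
      moreover have "1 \<le> x + 1 - n" "x + 1 - n \<le> m" using 3 x i by auto
      ultimately show ?thesis using 3 sr[of "x + 1 - n"] x i sr[OF i] by (auto simp: block_perm_def shift_input_def)
    qed
  qed
  have inj: "inj_on ?b {1..m + n - 1}"
  proof (rule inj_onI)
    fix x y assume x: "x \<in> {1..m + n - 1}" and y: "y \<in> {1..m + n - 1}" and e: "?b x = ?b y"
    define f where "f j = shift_input n (\<sigma> i) (\<sigma> j)" for j
    have f_inj: "j = l" if "f j = f l" "j \<noteq> i" "l \<noteq> i" "1 \<le> j" "j \<le> m" "1 \<le> l" "l \<le> m" for j l
    proof -
      have "\<sigma> j \<noteq> \<sigma> i" "\<sigma> l \<noteq> \<sigma> i" using that by (simp_all add: si)
      then have "\<sigma> j = \<sigma> l" using that sr[of j] sr[of l] sr[OF i]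
        by (auto simp: f_def shift_input_def split: if_splits)
      then show ?thesis by (simp add: si)
    qed
    have f_out: "f j < \<sigma> i \<or> f j \<ge> \<sigma> i + n" if "j \<noteq> i" for j
    proof -
      have "\<sigma> j \<noteq> \<sigma> i" using that by (simp add: si)
      then show ?thesis by (auto simp: f_def shift_input_def)
    qed
    define old where "old x = (if x < i then x else x + 1 - n)" for x
    have A: "?b x = f (old x) \<and> old x \<noteq> i \<and> 1 \<le> old x \<and> old x \<le> m"
      if "x \<in> {1..m + n - 1}" "x < i \<or> i + n \<le> x" for x
      using that i by (auto simp: f_def old_def block_perm_def)
    have B: "?b x = \<sigma> i - 1 + \<tau> (x + 1 - i) \<and> \<sigma> i \<le> ?b x \<and> ?b x < \<sigma> i + n"
      if "x \<in> {1..m + n - 1}" "\<not> (x < i \<or> i + n \<le> x)" for x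
    proof -
      have "1 \<le> x + 1 - i" "x + 1 - i \<le> n" using that by auto
      then show ?thesis using tr[of "x + 1 - i"] sr[OF i] that by (auto simp: block_perm_def)
    qed
    consider "x < i \<or> i + n \<le> x" "y < i \<or> i + n \<le> y"
      | "x < i \<or> i + n \<le> x" "\<not> (y < i \<or> i + n \<le> y)"
      | "\<not> (x < i \<or> i + n \<le> x)" "y < i \<or> i + n \<le> y"
      | "\<not> (x < i \<or> i + n \<le> x)" "\<not> (y < i \<or> i + n \<le> y)" by blast
    then show "x = y"
    proof cases
      case 1
      then have "old x = old y" using A[OF x] A[OF y] e f_inj by metis
      then show ?thesis using 1 by (auto simp: old_def split: if_splits)
    next
      case 2
      then show ?thesis using A[OF x] B[OF y] e f_out[of "old x"] by linarith
    next
      case 3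
      then show ?thesis using A[OF y] B[OF x] e f_out[of "old y"] by linarith
    next
      case 4
      then have "\<tau> (x + 1 - i) = \<tau> (y + 1 - i)" using B[OF x] B[OF y] e by linarith
      then have "x + 1 - i = y + 1 - i" by (simp only: ti)
      then show ?thesis using 4 by auto
    qed
  qed
  have "?b ` {1..m + n - 1} \<subseteq> {1..m + n - 1}" using into by blast
  then have "bij_betw ?b {1..m + n - 1} {1..m + n - 1}"
    using inj endo_inj_surj[of "{1..m + n - 1}" ?b] by (simp add: bij_betw_def)
  then show ?thesis by (intro bij_imp_permutes out)
qed

locale operad_with_ideal = operad +
  fixes I
  assumes ideal: "operad_ideal P I"
begin

lemma I_oper: "z \<in> I n \<Longrightarrow> z \<in> oper P n"
  and I_zero: "ozero P n \<in> I n"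
  and I_add: "z \<in> I n \<Longrightarrow> w \<in> I n \<Longrightarrow> oadd P n z w \<in> I n"
  and I_scale: "z \<in> I n \<Longrightarrow> oscale P n c z \<in> I n"
  and I_act: "z \<in> I n \<Longrightarrow> \<sigma> permutes {1..n} \<Longrightarrow> oact P n \<sigma> z \<in> I n"
  and I_comp1: "z \<in> I m \<Longrightarrow> y \<in> oper P n \<Longrightarrow> 1 \<le> i \<Longrightarrow> i \<le> m \<Longrightarrow> ocomp P m n i z y \<in> I (m + n - 1)"
  and I_comp2: "x \<in> oper P m \<Longrightarrow> z \<in> I n \<Longrightarrow> 1 \<le> i \<Longrightarrow> i \<le> m \<Longrightarrow> ocomp P m n i x z \<in> I (m + n - 1)"
  using ideal unfolding operad_ideal_def by blast+

lemma coset_shift: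
  assumes x: "x \<in> oper P n" and z: "z \<in> I n"
  shows "coset P I n (oadd P n x z) = coset P I n x"
proof -
  note zo = I_oper[OF z]
  let ?z = "oscale P n (-1) z"
  have z': "?z \<in> I n" using z by (rule I_scale)
  have *: "oadd P n z ?z = ozero P n" using add_inverse[OF zo] add_commute[OF zo I_oper[OF z']] by simp
  show ?thesis unfolding coset_def
  proof (intro equalityI subsetI; elim imageE)
    fix a w assume w: "w \<in> I n" "a = oadd P n (oadd P n x z) w"
    then have "a = oadd P n x (oadd P n z w)" using add_assoc[OF x zo I_oper] by simp
    then show "a \<in> oadd P n x ` I n" using I_add[OF z w(1)] by blast
  next
    fix a w assume w: "w \<in> I n" "a = oadd P n x w"
    have "oadd P n z (oadd P n ?z w) = w"
      using add_assoc[OF zo I_oper[OF z'] I_oper[OF w(1)]] * add_zero[OF I_oper[OF w(1)]] by simp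
    then have "a = oadd P n (oadd P n x z) (oadd P n ?z w)"
      using w add_assoc[OF x zo I_oper[OF I_add[OF z' w(1)]]] by simp
    then show "a \<in> oadd P n (oadd P n x z) ` I n" using I_add[OF z' w(1)] by blast
  qed
qed

lemma coset_self: "x \<in> oper P n \<Longrightarrow> x \<in> coset P I n x"
  unfolding coset_def using I_zero add_zero add_commute[OF _ zero_closed] by (metis image_eqI)

lemma UN1:
  assumes "x \<in> oper P n" "\<And>z. z \<in> I n \<Longrightarrow> coset P I k (f (oadd P n x z)) = coset P I k (f x)"
  shows "(\<Union>a\<in>coset P I n x. coset P I k (f a)) = coset P I k (f x)"
  using assms(2) I_zero[of n] unfolding coset_def[of P I n] by blast

lemma qcoset: "x \<in> oper P n \<Longrightarrow> coset P I n x \<in> oper (quotient_operad P I) n"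
  by (simp add: quotient_operad_def)

lemma qadd: "x \<in> oper P n \<Longrightarrow> y \<in> oper P n \<Longrightarrow>
  oadd (quotient_operad P I) n (coset P I n x) (coset P I n y) = coset P I n (oadd P n x y)"
proof -
  assume x: "x \<in> oper P n" and y: "y \<in> oper P n"
  have 1: "coset P I n (oadd P n a (oadd P n y z)) = coset P I n (oadd P n a y)" if "a \<in> oper P n" "z \<in> I n" for a z
    using add_assoc[OF that(1) y I_oper[OF that(2)]] coset_shift[OF add_closed[OF that(1) y] that(2)] by simp
  have 2: "coset P I n (oadd P n (oadd P n x z) y) = coset P I n (oadd P n x y)" if "z \<in> I n" for z
  proof -
    have "oadd P n (oadd P n x z) y = oadd P n (oadd P n x y) z"
      using add_assoc x y I_oper[OF that] add_commute by metis
    then show ?thesis using coset_shift[OF add_closed[OF x y] that] by simp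
  qed
  have "(\<Union>b\<in>coset P I n y. coset P I n (oadd P n a b)) = coset P I n (oadd P n a y)" if "a \<in> coset P I n x" for a
  proof (rule UN1[OF y 1])
    show "a \<in> oper P n" using that x I_oper add_closed unfolding coset_def by blast
  qed
  then show ?thesis by (simp add: quotient_operad_def UN1[OF x 2])
qed

lemma qscale: "x \<in> oper P n \<Longrightarrow>
  oscale (quotient_operad P I) n c (coset P I n x) = coset P I n (oscale P n c x)"
  by (simp add: quotient_operad_def)
    (rule UN1, assumption, simp add: scale_add_right I_oper coset_shift scale_closed I_scale)

lemma qact: "x \<in> oper P n \<Longrightarrow> \<sigma> permutes {1..n} \<Longrightarrow>
  oact (quotient_operad P I) n \<sigma> (coset P I n x) = coset P I n (oact P n \<sigma> x)"
  by (simp add: quotient_operad_def del: One_nat_def)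
    (rule UN1, assumption, simp add: act_add I_oper coset_shift act_closed I_act del: One_nat_def)

lemma qcomp: 
  assumes x: "x \<in> oper P m" and y: "y \<in> oper P n" and i: "1 \<le> i" "i \<le> m"
  shows "ocomp (quotient_operad P I) m n i (coset P I m x) (coset P I n y) = coset P I (m + n - 1) (ocomp P m n i x y)"
proof -
  have 1: "coset P I (m + n - 1) (ocomp P m n i a (oadd P n y z)) = coset P I (m + n - 1) (ocomp P m n i a y)" if "a \<in> oper P m" "z \<in> I n" for a z
    using comp_add_right[OF that(1) y I_oper[OF that(2)] i] coset_shift[OF comp_closed[OF that(1) y i] I_comp2[OF that i]] by simp
  have 2: "coset P I (m + n - 1) (ocomp P m n i (oadd P m x z) y) = coset P I (m + n - 1) (ocomp P m n i x y)" if "z \<in> I m" for z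
    using comp_add_left[OF x I_oper[OF that] y i] coset_shift[OF comp_closed[OF x y i] I_comp1[OF that y i]] by simp
  have "(\<Union>b\<in>coset P I n y. coset P I (m + n - 1) (ocomp P m n i a b)) = coset P I (m + n - 1) (ocomp P m n i a y)" if "a \<in> coset P I m x" for a
  proof (rule UN1[OF y 1])
    show "a \<in> oper P m" using that x I_oper add_closed unfolding coset_def by blast
  qed
  then show ?thesis using UN1[OF x 2] by (simp add: quotient_operad_def)
qed

lemma qrest: "oper (quotient_operad P I) n = coset P I n ` oper P n"
  "ozero (quotient_operad P I) n = coset P I n (ozero P n)"
  "ounit (quotient_operad P I) = coset P I 1 (ounit P)"
  by (simp_all add: quotient_operad_def)

lemma quotient_operad: "operad (quotient_operad P I)"
proof
  let ?Q = "quotient_operad P I"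
  note ops = zero_closed add_closed scale_closed unit_closed comp_closed act_closed
  note q = qadd qscale qact qcomp
  fix m n k i j l :: nat and X X' Y Y' Z and c d and \<sigma> \<tau> :: "nat \<Rightarrow> nat"
  have E: "X \<in> oper ?Q n \<Longrightarrow> \<exists>x\<in>oper P n. X = coset P I n x" for X n
    by (auto simp: qrest)
  show "ozero ?Q n \<in> oper ?Q n" by (simp add: qrest ops)
  show "oadd ?Q n X Y \<in> oper ?Q n" if "X \<in> oper ?Q n" "Y \<in> oper ?Q n"
    using that unfolding qrest by (auto simp: qadd ops)
  show "oscale ?Q n c X \<in> oper ?Q n" if "X \<in> oper ?Q n"
    using that unfolding qrest by (auto simp: qscale ops)
  show "oadd ?Q n (oadd ?Q n X Y) Z = oadd ?Q n X (oadd ?Q n Y Z)"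
    if "X \<in> oper ?Q n" "Y \<in> oper ?Q n" "Z \<in> oper ?Q n"
    using that unfolding qrest by (auto simp: qadd ops add_assoc)
  show "oadd ?Q n X Y = oadd ?Q n Y X" if "X \<in> oper ?Q n" "Y \<in> oper ?Q n"
    using that unfolding qrest by (elim imageE) (simp add: qadd ops add_commute)
  show "oadd ?Q n (ozero ?Q n) X = X" if "X \<in> oper ?Q n"
    using that unfolding qrest by (auto simp: qadd ops add_zero)
  show "oadd ?Q n (oscale ?Q n (-1) X) X = ozero ?Q n" if "X \<in> oper ?Q n"
    using that unfolding qrest by (auto simp: qadd qscale ops add_inverse)
  show "oscale ?Q n c (oadd ?Q n X Y) = oadd ?Q n (oscale ?Q n c X) (oscale ?Q n c Y)"
    if "X \<in> oper ?Q n" "Y \<in> oper ?Q n"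
    using that unfolding qrest by (auto simp: qadd qscale ops scale_add_right)
  show "oscale ?Q n (c + d) X = oadd ?Q n (oscale ?Q n c X) (oscale ?Q n d X)" if "X \<in> oper ?Q n"
    using that unfolding qrest by (auto simp: qadd qscale ops scale_add_left)
  show "oscale ?Q n c (oscale ?Q n d X) = oscale ?Q n (c * d) X" if "X \<in> oper ?Q n"
    using that unfolding qrest by (auto simp: qscale ops scale_scale)
  show "oscale ?Q n 1 X = X" if "X \<in> oper ?Q n"
    using that unfolding qrest by (auto simp: qscale ops scale_one)
  show "ounit ?Q \<in> oper ?Q 1" unfolding qrest using unit_closed by blast
  show "ocomp ?Q m n i X Y \<in> oper ?Q (m + n - 1)"
    if "X \<in> oper ?Q m" "Y \<in> oper ?Q n" "1 \<le> i" "i \<le> m"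
    using E[OF that(1)] E[OF that(2)] that(3,4) unfolding qrest
    by (elim bexE) (simp only: q ops, blast intro: ops)
  show "ocomp ?Q m n i (oadd ?Q m X X') Y = oadd ?Q (m + n - 1) (ocomp ?Q m n i X Y) (ocomp ?Q m n i X' Y)"
    if "X \<in> oper ?Q m" "X' \<in> oper ?Q m" "Y \<in> oper ?Q n" "1 \<le> i" "i \<le> m"
    using E[OF that(1)] E[OF that(2)] E[OF that(3)] that(4,5)
    by (elim bexE) (simp only: q ops comp_add_left)
  show "ocomp ?Q m n i X (oadd ?Q n Y Y') = oadd ?Q (m + n - 1) (ocomp ?Q m n i X Y) (ocomp ?Q m n i X Y')"
    if "X \<in> oper ?Q m" "Y \<in> oper ?Q n" "Y' \<in> oper ?Q n" "1 \<le> i" "i \<le> m"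
    using E[OF that(1)] E[OF that(2)] E[OF that(3)] that(4,5)
    by (elim bexE) (simp only: q ops comp_add_right)
  show "ocomp ?Q m n i (oscale ?Q m c X) Y = oscale ?Q (m + n - 1) c (ocomp ?Q m n i X Y)"
    if "X \<in> oper ?Q m" "Y \<in> oper ?Q n" "1 \<le> i" "i \<le> m"
    using E[OF that(1)] E[OF that(2)] that(3,4)
    by (elim bexE) (simp only: q ops comp_scale_left)
  show "ocomp ?Q m n i X (oscale ?Q n c Y) = oscale ?Q (m + n - 1) c (ocomp ?Q m n i X Y)"
    if "X \<in> oper ?Q m" "Y \<in> oper ?Q n" "1 \<le> i" "i \<le> m"
    using E[OF that(1)] E[OF that(2)] that(3,4)
    by (elim bexE) (simp only: q ops comp_scale_right)
  show "ocomp ?Q 1 n 1 (ounit ?Q) Y = Y" if "Y \<in> oper ?Q n"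
    using E[OF that] by (elim bexE) (simp only: qrest q ops order_refl unit_left add_diff_cancel_left')
  show "ocomp ?Q m 1 i X (ounit ?Q) = X" if "X \<in> oper ?Q m" "1 \<le> i" "i \<le> m"
    using E[OF that(1)] that(2,3) qcomp[OF _ unit_closed]
    by (auto simp: qrest unit_right simp del: One_nat_def)
  show "ocomp ?Q (m + n - 1) k (i + j - 1) (ocomp ?Q m n i X Y) Z
      = ocomp ?Q m (n + k - 1) i X (ocomp ?Q n k j Y Z)"
    if "X \<in> oper ?Q m" "Y \<in> oper ?Q n" "Z \<in> oper ?Q k" and ij: "1 \<le> i" "i \<le> m" "1 \<le> j" "j \<le> n"
  proof -
    have 1: "1 \<le> i + j - 1" "i + j - 1 \<le> m + n - 1" and 2: "m + n - 1 + k - 1 = m + (n + k - 1) - 1"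
      using ij by auto
    show ?thesis
      using E[OF that(1)] E[OF that(2)] E[OF that(3)]
      by (elim bexE) (simp only: q ops ij 1 comp_sequential, simp only: 2)
  qed
  show "ocomp ?Q (m + n - 1) k (l + n - 1) (ocomp ?Q m n i X Y) Z
      = ocomp ?Q (m + k - 1) n i (ocomp ?Q m k l X Z) Y"
    if "X \<in> oper ?Q m" "Y \<in> oper ?Q n" "Z \<in> oper ?Q k" and il: "1 \<le> i" "i < l" "l \<le> m"
  proof -
    have 1: "1 \<le> l + n - 1" "l + n - 1 \<le> m + n - 1" "i \<le> m + k - 1" "1 \<le> l" "i \<le> m"
      and 2: "m + n - 1 + k - 1 = m + k - 1 + n - 1"
      using il by auto
    show ?thesis
      using E[OF that(1)] E[OF that(2)] E[OF that(3)]
      by (elim bexE) (simp only: q ops il 1 comp_parallel, simp only: 2)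
  qed
  show "oact ?Q n \<sigma> X \<in> oper ?Q n" if "\<sigma> permutes {1..n}" "X \<in> oper ?Q n"
    using E[OF that(2)] that(1) unfolding qrest
    by (elim bexE) (simp only: q ops, blast intro: ops)
  show "oact ?Q n \<sigma> (oadd ?Q n X Y) = oadd ?Q n (oact ?Q n \<sigma> X) (oact ?Q n \<sigma> Y)"
    if "\<sigma> permutes {1..n}" "X \<in> oper ?Q n" "Y \<in> oper ?Q n"
    using E[OF that(2)] E[OF that(3)] that(1) by (elim bexE) (simp only: q ops act_add)
  show "oact ?Q n \<sigma> (oscale ?Q n c X) = oscale ?Q n c (oact ?Q n \<sigma> X)"
    if "\<sigma> permutes {1..n}" "X \<in> oper ?Q n"
    using E[OF that(2)] that(1) by (elim bexE) (simp only: q ops act_scale)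
  show "oact ?Q n id X = X" if "X \<in> oper ?Q n"
    using E[OF that] by (elim bexE) (simp only: q permutes_id act_id)
  show "oact ?Q n (\<sigma> \<circ> \<tau>) X = oact ?Q n \<sigma> (oact ?Q n \<tau> X)"
    if "\<sigma> permutes {1..n}" "\<tau> permutes {1..n}" "X \<in> oper ?Q n"
    using E[OF that(3)] that(1,2) permutes_compose[OF that(2,1)]
    by (elim bexE) (simp only: q ops act_comp)
  show "ocomp ?Q m n (\<sigma> i) (oact ?Q m \<sigma> X) (oact ?Q n \<tau> Y)
      = oact ?Q (m + n - 1) (block_perm n i \<sigma> \<tau>) (ocomp ?Q m n i X Y)"
    if "X \<in> oper ?Q m" "Y \<in> oper ?Q n" and i: "1 \<le> i" "i \<le> m"
      and p: "\<sigma> permutes {1..m}" "\<tau> permutes {1..n}"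
  proof -
    have 1: "1 \<le> \<sigma> i" "\<sigma> i \<le> m" using permutes_in_image[OF p(1), of i] i by auto
    show ?thesis
      using E[OF that(1)] E[OF that(2)] block_perm_permutes[OF p i]
      by (elim bexE) (simp only: q ops i 1 p comp_equivariant)
  qed
qed

end


lemma (in operad) operad_ideal_generated:
  assumes "U \<subseteq> oper P k"
  shows "operad_ideal P (generated_ideal P k U)"
proof -
  have 1: "operad_ideal P (oper P)"
    unfolding operad_ideal_def
    using zero_closed add_closed scale_closed act_closed comp_closed by blast
  then have 2: "generated_ideal P k U n \<subseteq> oper P n" for n
    using assms unfolding generated_ideal_def by blast
  have 3: "z \<in> generated_ideal P k U n \<longleftrightarrow> (\<forall>I. operad_ideal P I \<and> U \<subseteq> I k \<longrightarrow> z \<in> I n)" for z n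
    unfolding generated_ideal_def by blast
  have D: "ozero P n \<in> I n" "x \<in> I n \<Longrightarrow> y \<in> I n \<Longrightarrow> oadd P n x y \<in> I n"
      "x \<in> I n \<Longrightarrow> oscale P n c x \<in> I n"
      "x \<in> I n \<Longrightarrow> \<sigma> permutes {1..n} \<Longrightarrow> oact P n \<sigma> x \<in> I n"
      "x \<in> oper P m \<Longrightarrow> y \<in> oper P n \<Longrightarrow> 1 \<le> i \<Longrightarrow> i \<le> m \<Longrightarrow> x \<in> I m \<or> y \<in> I n
        \<Longrightarrow> ocomp P m n i x y \<in> I (m + n - 1)"
    if "operad_ideal P I" for I m n i x y c \<sigma>
    using that unfolding operad_ideal_def by blast+
  show ?thesis
    unfolding operad_ideal_def
  proof (intro conjI allI ballI impI)
    fix m n i x y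
    assume "x \<in> oper P m" "y \<in> oper P n"
      "1 \<le> i \<and> i \<le> m \<and> (x \<in> generated_ideal P k U m \<or> y \<in> generated_ideal P k U n)"
    then show "ocomp P m n i x y \<in> generated_ideal P k U (m + n - 1)"
      unfolding 3 using D(5) by metis
  qed (use 2 in \<open>simp_all add: 3 D del: One_nat_def\<close>)
qed

lemma operad_quadratic_operad:
  assumes "U \<subseteq> oper free_operad 3"
  shows "operad (quadratic_operad U)"
proof -
  interpret operad_with_ideal free_operad "generated_ideal free_operad 3 U"
    by (intro operad_with_ideal.intro operad_with_ideal_axioms.intro free_operad
        operad.operad_ideal_generated[OF free_operad assms])
  show ?thesis unfolding quadratic_operad_def by (rule quotient_operad)
qed

section \<open>The basis of the arity 3 part and the Koszul dual\<close>

datatype mu_gen = Mu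

datatype nu_gen = Nu

instance mu_gen :: finite
proof
  have "(UNIV :: mu_gen set) = {Mu}" by (auto intro: mu_gen.exhaust)
  then show "finite (UNIV :: mu_gen set)" by (metis finite.emptyI finite_insert)
qed

instance nu_gen :: finite
proof
  have "(UNIV :: nu_gen set) = {Nu}" by (auto intro: nu_gen.exhaust)
  then show "finite (UNIV :: nu_gen set)" by (metis finite.emptyI finite_insert)
qed

abbreviation swap :: "nat \<Rightarrow> nat \<Rightarrow> nat \<Rightarrow> nat" where
  "swap \<equiv> Transposition.transpose"

definition corolla :: "'g \<Rightarrow> 'g btree" where
  "corolla g = Node g (Leaf 1) (Leaf 2)"

definition corolla' :: "'g \<Rightarrow> 'g btree" where
  "corolla' g = relabel (swap 1 2) (corolla g)"

text \<open>\<open>basis3 Mu\<close> lists \<open>e\<^sub>1,\<dots>,e\<^bsub>12\<^esub>\<close> and \<open>basis3 Nu\<close> lists \<open>f\<^sub>1,\<dots>,f\<^bsub>12\<^esub>\<close>.  The element \<open>1 \<otimes> (a \<otimes> b)\<close> of the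
  induced module is \<open>a \<circ>\<^sub>1 b\<close>, because the transposition of 1 and 2 acts on \<open>b\<close> only.\<close>

definition basis3_start :: "'g \<Rightarrow> 'g btree list" where
  "basis3_start g =
    (let e1 = graft 2 1 (corolla g) (corolla g);
         e3 = graft 2 1 (corolla' g) (corolla g)
     in [e1, relabel (swap 1 2) e1, e3, relabel (swap 1 2) e3])"

definition basis3 :: "'g \<Rightarrow> 'g btree list" where
  "basis3 g = basis3_start g @ map (relabel (swap 1 3)) (basis3_start g)
     @ map (relabel (swap 2 3)) (basis3_start g)"

lemma basis3_explicit:
  "basis3 g = (let c = (\<lambda>i j k. Node g (Node g (Leaf i) (Leaf j)) (Leaf k));
                   d = (\<lambda>i j k. Node g (Leaf i) (Node g (Leaf j) (Leaf k)))
     in [c 1 2 3, c 2 1 3, d 3 1 2, d 3 2 1, c 3 2 1, c 2 3 1, d 1 3 2, d 1 2 3,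
         c 1 3 2, c 3 1 2, d 2 1 3, d 2 3 1])"
  by (simp add: basis3_def basis3_start_def Let_def corolla_def corolla'_def relabel_def graft_def
      shift_input_def Transposition.transpose_def)

definition from_coords :: "'g \<Rightarrow> 'k::field list \<Rightarrow> 'g btree \<Rightarrow> 'k" where
  "from_coords g cs = (\<Sum>i<12. fscale (cs ! i) (single (basis3 g ! i)))"

text \<open>The signs come from \<open>\<langle>\<nu>,\<mu>\<rangle> = 1\<close>, \<open>\<langle>\<nu>',\<mu>'\<rangle> = -1\<close> and \<open>\<langle>\<sigma> f, \<sigma> e\<rangle> = sgn \<sigma> \<langle>f, e\<rangle>\<close>.\<close>

definition pairing_diag :: "'k::field list" where
  "pairing_diag = [1, -1, -1, 1, -1, 1, 1, -1, -1, 1, 1, -1]"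

text \<open>The coordinate of a vector with respect to a tree is its value at that tree.\<close>

definition pairing :: "(nu_gen btree \<Rightarrow> 'k::field) \<Rightarrow> (mu_gen btree \<Rightarrow> 'k) \<Rightarrow> 'k" where
  "pairing f u = (\<Sum>i<12. pairing_diag ! i * f (basis3 Nu ! i) * u (basis3 Mu ! i))"

definition annihilator :: "(mu_gen btree \<Rightarrow> 'k::field) set \<Rightarrow> (nu_gen btree \<Rightarrow> 'k) set" where
  "annihilator U = {f \<in> oper free_operad 3. \<forall>u\<in>U. pairing f u = 0}"

text \<open>\<open>\<P>(V,U)\<^sup>!\<close>\<close>

definition koszul_dual ::
    "(mu_gen btree \<Rightarrow> 'k::field) set \<Rightarrow> ('k, (nu_gen btree \<Rightarrow> 'k) set) operad" where
  "koszul_dual U = quadratic_operad (annihilator U)"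

section \<open>Representations of the symmetric group on three letters\<close>

text \<open>An \<open>S\<^sub>3\<close>-module is realised on a linear subspace of a space of functions.\<close>

record ('k, 'b) S3_module =
  car :: "('b \<Rightarrow> 'k) set"
  mact :: "(nat \<Rightarrow> nat) \<Rightarrow> ('b \<Rightarrow> 'k) \<Rightarrow> ('b \<Rightarrow> 'k)"

definition S3_isomorphic :: "('k::field, 'b) S3_module \<Rightarrow> ('k, 'c) S3_module \<Rightarrow> bool" where
  "S3_isomorphic M N \<longleftrightarrow>
     (\<exists>\<phi>. bij_betw \<phi> (car M) (car N)
        \<and> (\<forall>x\<in>car M. \<forall>y\<in>car M. \<phi> (x + y) = \<phi> x + \<phi> y)
        \<and> (\<forall>c. \<forall>x\<in>car M. \<phi> (fscale c x) = fscale c (\<phi> x))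
        \<and> (\<forall>\<sigma>. \<forall>x\<in>car M. \<sigma> permutes {1..3} \<longrightarrow> \<phi> (mact M \<sigma> x) = mact N \<sigma> (\<phi> x)))"

definition M_plus :: "('k::field, unit) S3_module" where
  "M_plus = \<lparr> car = UNIV, mact = (\<lambda>\<sigma> x. x) \<rparr>"

definition M_minus :: "('k::field, unit) S3_module" where
  "M_minus = \<lparr> car = UNIV, mact = (\<lambda>\<sigma> x. fscale (of_int (sign \<sigma>)) x) \<rparr>"

text \<open>The two-dimensional irreducible module: vectors with coordinate sum zero in the permutation
  module \<open>k\<^sup>3\<close>.\<close>

definition M_two :: "('k::field, nat) S3_module" where
  "M_two = \<lparr> car = {x. (\<forall>i. i \<notin> {1..3} \<longrightarrow> x i = 0) \<and> (\<Sum>i=1..3. x i) = 0},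
             mact = (\<lambda>\<sigma> x i. x (inv \<sigma> i)) \<rparr>"

definition dsum :: "('k::field, 'b) S3_module \<Rightarrow> ('k, 'c) S3_module \<Rightarrow> ('k, 'b + 'c) S3_module"
    (infixr \<open>\<oplus>\<^sub>S\<close> 65) where
  "M \<oplus>\<^sub>S N = \<lparr> car = {x. x \<circ> Inl \<in> car M \<and> x \<circ> Inr \<in> car N},
              mact = (\<lambda>\<sigma> x. case_sum (mact M \<sigma> (x \<circ> Inl)) (mact N \<sigma> (x \<circ> Inr))) \<rparr>"

definition S3_submodule :: "('g::finite btree \<Rightarrow> 'k::field) set \<Rightarrow> bool" where
  "S3_submodule U \<longleftrightarrow> U \<subseteq> oper free_operad 3 \<and> fs.subspace U
     \<and> (\<forall>\<sigma>. \<forall>x\<in>U. \<sigma> permutes {1..3} \<longrightarrow> oact free_operad 3 \<sigma> x \<in> U)"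

definition as_S3_module :: "('g::finite btree \<Rightarrow> 'k::field) set \<Rightarrow> ('k, 'g btree) S3_module" where
  "as_S3_module U = \<lparr> car = U, mact = oact free_operad 3 \<rparr>"

section \<open>The point of the Grassmannian\<close>

text \<open>\<open>u_pm\<close> is \<open>u\<^sub>+\<close> for \<open>s = 1\<close> and \<open>u\<^sub>-\<close> for \<open>s = -1\<close>.\<close>

definition u_pm :: "'k::field \<Rightarrow> 'k \<Rightarrow> 'k \<Rightarrow> mu_gen btree \<Rightarrow> 'k" where
  "u_pm s x1 x2 = from_coords Mu
     [x1, s * x1, x2, s * x2, s * x1, x1, s * x2, x2, s * x1, x1, s * x2, x2]"

definition u21 :: "'k::field ^ 4 \<Rightarrow> mu_gen btree \<Rightarrow> 'k" where
  "u21 x = from_coords Mu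
     [x$1, - x$1, x$2, - x$2, x$3, x$3 - x$1, x$4, x$4 - x$2, x$1 - x$3, - x$3, x$2 - x$4, - x$4]"

definition u22 :: "'k::field ^ 4 \<Rightarrow> mu_gen btree \<Rightarrow> 'k" where
  "u22 x = from_coords Mu
     [x$1 - x$3, - x$3, x$2 - x$4, - x$4, x$3 - x$1, x$3, x$4 - x$2, x$4, x$1, - x$1, x$2, - x$2]"

text \<open>Points of the projective space with homogeneous coordinates \<open>p\<^sub>i\<^sub>j\<close> are represented by the set of
  all their coordinate vectors.  We keep \<open>p\<^sub>i\<^sub>j\<close> for all pairs of indices; the coordinates with
  \<open>i < j\<close> determine the others.\<close>

definition plucker :: "'k::field ^ 4 \<Rightarrow> 'k ^ 4 \<Rightarrow> 4 \<times> 4 \<Rightarrow> 'k" where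
  "plucker x y = (\<lambda>(i, j). x$i * y$j - x$j * y$i)"

definition proj_point :: "('b \<Rightarrow> 'k::field) \<Rightarrow> ('b \<Rightarrow> 'k) set" where
  "proj_point v = {fscale c v | c. c \<noteq> 0}"

definition G24 :: "(4 \<times> 4 \<Rightarrow> 'k::field) set set" where
  "G24 = {proj_point (plucker x y) | x y. vec.dim {x, y} = 2}"

definition p_point :: "(mu_gen btree \<Rightarrow> 'k::field) set \<Rightarrow> (4 \<times> 4 \<Rightarrow> 'k) set" where
  "p_point U = (THE p. \<exists>s x y. s \<in> {1, -1} \<and> vec.dim {x, y} = 2
      \<and> U = fs.span {u_pm s 1 0, u_pm s 0 1, u21 x, u22 x, u21 y, u22 y}
      \<and> p = proj_point (plucker x y))"

definition Y1 :: "(4 \<times> 4 \<Rightarrow> 'k::field) set set" where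
  "Y1 = {P \<in> G24. \<forall>p\<in>P. p (1, 3) = p (2, 4)}"

definition Y2 :: "(4 \<times> 4 \<Rightarrow> 'k::field) set set" where
  "Y2 = {P \<in> G24. \<forall>p\<in>P. p (1, 4) = p (1, 2) + p (2, 3)}"

end

theory Submission
  imports Defs
begin

text \<open>An isomorphism \<open>\<P> \<rightarrow> \<P>\<^sup>!\<close> is determined by the image \<open>a\<nu> + b\<nu>'\<close> of \<open>\<mu>\<close>, where \<open>a\<^sup>2 \<noteq> b\<^sup>2\<close>; the
  substitution \<open>\<mu> \<mapsto> a\<nu> + b\<nu>'\<close> must carry \<open>U\<close> into \<open>U\<^sup>\<bottom>\<close>.  Composed with the pairing, it gives a
  bilinear form on \<open>\<F>(3)\<close> that pairs \<open>M\<^sub>+\<close> with \<open>M\<^sub>-\<close>, and that on the \<open>M\<^sub>2\<close>-isotypic part amounts to a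
  bilinear form \<open>a\<^sup>2 (p\<^sub>2\<^sub>4 - p\<^sub>1\<^sub>3) + b\<^sup>2 (p\<^sub>1\<^sub>2 + p\<^sub>2\<^sub>3 - p\<^sub>1\<^sub>4) + ab S\<close> on \<open>k\<^sup>4\<close>
  with \<open>S\<close> symmetric.  So an isomorphism makes the plane \<open>p(U)\<close> isotropic.  If \<open>ab = 0\<close>, this is one of
  the two equations.  Otherwise \<open>S\<close>, a product of two linear forms, vanishes on the plane, which forces
  the sum of the two alternating forms to vanish on it, and \<open>a\<^sup>2 \<noteq> b\<^sup>2\<close> makes both of them vanish.
  Conversely, both alternating forms are nondegenerate, so that an isotropic plane is its own orthogonal
  complement, and \<open>\<mu> \<mapsto> \<nu>\<close> or \<open>\<mu> \<mapsto> \<nu>'\<close> carries \<open>U\<close> onto \<open>U\<^sup>\<bottom>\<close>.\<close>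

section \<open>Isomorphisms of operads and of quadratic operads\<close>

text \<open>The conditions of \<open>operad_isomorphic\<close> on a named family, so that inverses
  and the transport of ideals and quotients can be stated.\<close>

definition operad_iso :: "(nat \<Rightarrow> 'a \<Rightarrow> 'b) \<Rightarrow> ('k::field, 'a) operad \<Rightarrow> ('k, 'b) operad \<Rightarrow> bool" where
  "operad_iso \<phi> P Q \<longleftrightarrow> (\<forall>n. bij_betw (\<phi> n) (oper P n) (oper Q n))
        \<and> (\<forall>n. \<forall>x\<in>oper P n. \<forall>y\<in>oper P n. \<phi> n (oadd P n x y) = oadd Q n (\<phi> n x) (\<phi> n y))
        \<and> (\<forall>n c. \<forall>x\<in>oper P n. \<phi> n (oscale P n c x) = oscale Q n c (\<phi> n x))
        \<and> \<phi> 1 (ounit P) = ounit Q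
        \<and> (\<forall>m n i. \<forall>x\<in>oper P m. \<forall>y\<in>oper P n. 1 \<le> i \<and> i \<le> m \<longrightarrow>
             \<phi> (m + n - 1) (ocomp P m n i x y) = ocomp Q m n i (\<phi> m x) (\<phi> n y))
        \<and> (\<forall>n \<sigma>. \<forall>x\<in>oper P n. \<sigma> permutes {1..n} \<longrightarrow>
             \<phi> n (oact P n \<sigma> x) = oact Q n \<sigma> (\<phi> n x))"

lemma operad_isomorphic_iff: "operad_isomorphic P Q \<longleftrightarrow> (\<exists>\<phi>. operad_iso \<phi> P Q)"
  unfolding operad_isomorphic_def operad_iso_def ..

lemma operad_isoI:
  assumes "\<And>n. bij_betw (\<phi> n) (oper P n) (oper Q n)"
    and "\<And>n x y. x \<in> oper P n \<Longrightarrow> y \<in> oper P n \<Longrightarrow> \<phi> n (oadd P n x y) = oadd Q n (\<phi> n x) (\<phi> n y)"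
    and "\<And>n c x. x \<in> oper P n \<Longrightarrow> \<phi> n (oscale P n c x) = oscale Q n c (\<phi> n x)"
    and "\<phi> 1 (ounit P) = ounit Q"
    and "\<And>m n i x y. x \<in> oper P m \<Longrightarrow> y \<in> oper P n \<Longrightarrow> 1 \<le> i \<Longrightarrow> i \<le> m \<Longrightarrow>
             \<phi> (m + n - 1) (ocomp P m n i x y) = ocomp Q m n i (\<phi> m x) (\<phi> n y)"
    and "\<And>n \<sigma> x. x \<in> oper P n \<Longrightarrow> \<sigma> permutes {1..n} \<Longrightarrow> \<phi> n (oact P n \<sigma> x) = oact Q n \<sigma> (\<phi> n x)"
  shows "operad_iso \<phi> P Q"
  unfolding operad_iso_def by (intro conjI allI ballI impI; (elim conjE)?; rule assms; assumption)

lemma operad_isoD: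
  assumes "operad_iso \<phi> P Q"
  shows "bij_betw (\<phi> n) (oper P n) (oper Q n)"
    and "x \<in> oper P n \<Longrightarrow> y \<in> oper P n \<Longrightarrow> \<phi> n (oadd P n x y) = oadd Q n (\<phi> n x) (\<phi> n y)"
    and "x \<in> oper P n \<Longrightarrow> \<phi> n (oscale P n c x) = oscale Q n c (\<phi> n x)"
    and "\<phi> 1 (ounit P) = ounit Q"
    and "x \<in> oper P m \<Longrightarrow> y \<in> oper P n \<Longrightarrow> 1 \<le> i \<Longrightarrow> i \<le> m \<Longrightarrow>
             \<phi> (m + n - 1) (ocomp P m n i x y) = ocomp Q m n i (\<phi> m x) (\<phi> n y)"
    and "x \<in> oper P n \<Longrightarrow> \<sigma> permutes {1..n} \<Longrightarrow> \<phi> n (oact P n \<sigma> x) = oact Q n \<sigma> (\<phi> n x)"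
    and "x \<in> oper P n \<Longrightarrow> \<phi> n x \<in> oper Q n"
proof -
  note d = assms[unfolded operad_iso_def]
  show 1: "bij_betw (\<phi> n) (oper P n) (oper Q n)" using d by simp
  show "x \<in> oper P n \<Longrightarrow> \<phi> n x \<in> oper Q n" using bij_betwE[OF 1] by simp
qed (use assms in \<open>simp_all add: operad_iso_def del: One_nat_def\<close>)

lemma (in operad) idempotent_zero:
  assumes "x \<in> oper P n" "oadd P n x x = x"
  shows "x = ozero P n"
  using assms add_assoc[OF scale_closed[OF assms(1)] assms(1) assms(1), of "-1"] add_inverse[OF assms(1)] add_zero[OF assms(1)]
  by simp

text \<open>Zero is not among the data that an isomorphism is required to respect. By additivity the
  image of zero is idempotent, and an idempotent of an additive group is zero.\<close>

lemma operad_iso_zero: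
  assumes "operad_iso \<phi> P Q" "operad P" "operad Q"
  shows "\<phi> n (ozero P n) = ozero Q n"
proof (rule operad.idempotent_zero[OF assms(3)])
  have z: "ozero P n \<in> oper P n" by (rule operad.zero_closed[OF assms(2)])
  show "\<phi> n (ozero P n) \<in> oper Q n" by (rule operad_isoD(7)[OF assms(1) z])
  show "oadd Q n (\<phi> n (ozero P n)) (\<phi> n (ozero P n)) = \<phi> n (ozero P n)"
    using operad_isoD(2)[OF assms(1) z z] operad.add_zero[OF assms(2) z] by simp
qed

lemma operad_iso_inverse:
  assumes i: "operad_iso \<phi> P Q" and P: "operad P"
  shows "operad_iso (\<lambda>n. inv_into (oper P n) (\<phi> n)) Q P"
proof -
  interpret operad P by (rule P)
  note d = operad_isoD[OF i]
  have inv: "inv_into (oper P n) (\<phi> n) (\<phi> n x) = x" if "x \<in> oper P n" for n x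
    by (rule bij_betw_inv_into_left[OF d(1) that])
  have E: "\<exists>x\<in>oper P n. y = \<phi> n x" if "y \<in> oper Q n" for n y
    using that d(1)[of n] by (auto simp: bij_betw_def)
  show ?thesis
  proof (rule operad_isoI)
    fix m n k c x y \<sigma>
    show "bij_betw (inv_into (oper P n) (\<phi> n)) (oper Q n) (oper P n)"
      by (rule bij_betw_inv_into[OF d(1)])
    show "inv_into (oper P 1) (\<phi> 1) (ounit Q) = ounit P"
      using inv[OF unit_closed] d(4) by simp
    assume y: "y \<in> oper Q n"
    then obtain b where b: "b \<in> oper P n" "y = \<phi> n b" using E by blast
    show "inv_into (oper P n) (\<phi> n) (oscale Q n c y) = oscale P n c (inv_into (oper P n) (\<phi> n) y)"
      using b by (simp add: d(3)[symmetric] inv scale_closed)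
    show "inv_into (oper P n) (\<phi> n) (oact Q n \<sigma> y) = oact P n \<sigma> (inv_into (oper P n) (\<phi> n) y)"
      if "\<sigma> permutes {1..n}"
      using b that by (simp add: d(6)[symmetric] inv act_closed del: One_nat_def)
    show "inv_into (oper P n) (\<phi> n) (oadd Q n x y)
      = oadd P n (inv_into (oper P n) (\<phi> n) x) (inv_into (oper P n) (\<phi> n) y)" if x: "x \<in> oper Q n"
    proof -
      obtain a where "a \<in> oper P n" "x = \<phi> n a" using E x by blast
      then show ?thesis using b by (simp add: d(2)[symmetric] inv add_closed)
    qed
    show "inv_into (oper P (m + n - 1)) (\<phi> (m + n - 1)) (ocomp Q m n k x y)
      = ocomp P m n k (inv_into (oper P m) (\<phi> m) x) (inv_into (oper P n) (\<phi> n) y)"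
      if x: "x \<in> oper Q m" and k: "1 \<le> k" "k \<le> m"
    proof -
      obtain a where "a \<in> oper P m" "x = \<phi> m a" using E x by blast
      then show ?thesis using b k by (simp only: d(5)[symmetric] inv comp_closed)
    qed
  qed
qed

text \<open>Ideals pull back along \<phi>: the preimage of an ideal of \<open>Q\<close> containing
  the image of \<open>U\<close> is an ideal of \<open>P\<close> containing \<open>U\<close>, hence
  one of those intersected in \<open>generated_ideal\<close>.\<close>

lemma operad_iso_generated_ideal_subset:
  assumes i: "operad_iso \<phi> P Q" and P: "operad P" and Q: "operad Q" and U: "U \<subseteq> oper P k"
  shows "\<phi> n ` generated_ideal P k U n \<subseteq> generated_ideal Q k (\<phi> k ` U) n"
proof -
  interpret operad P by (rule P)
  note d = operad_isoD[OF i]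
  have "\<phi> n x \<in> J n"
    if x: "x \<in> generated_ideal P k U n" and J: "operad_ideal Q J" and UJ: "\<phi> k ` U \<subseteq> J k" for x J
  proof -
    interpret J: operad_with_ideal Q J
      by (intro operad_with_ideal.intro operad_with_ideal_axioms.intro Q J)
    define I where "I n = {x \<in> oper P n. \<phi> n x \<in> J n}" for n
    have "operad_ideal P I"
      unfolding operad_ideal_def
    proof (intro conjI allI ballI impI)
      show "I n \<subseteq> oper P n" for n by (auto simp: I_def)
      show "ozero P n \<in> I n" for n
        by (simp add: I_def zero_closed operad_iso_zero[OF i P Q] J.I_zero)
      show "oadd P n x y \<in> I n" if "x \<in> I n" "y \<in> I n" for n x y
        using that by (simp add: I_def add_closed d J.I_add)
      show "oscale P n c x \<in> I n" if "x \<in> I n" for n c x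
        using that by (simp add: I_def scale_closed d J.I_scale)
      show "oact P n \<sigma> x \<in> I n" if "x \<in> I n" "\<sigma> permutes {1..n}" for n \<sigma> x
        using that by (simp add: I_def act_closed d J.I_act del: One_nat_def)
      show "ocomp P m n i x y \<in> I (m + n - 1)"
        if x: "x \<in> oper P m" and y: "y \<in> oper P n" and h: "1 \<le> i \<and> i \<le> m \<and> (x \<in> I m \<or> y \<in> I n)" for m n i x y
      proof -
        have "\<phi> m x \<in> J m \<or> \<phi> n y \<in> J n" using h by (auto simp: I_def)
        then have "ocomp Q m n i (\<phi> m x) (\<phi> n y) \<in> J (m + n - 1)"
          using J.I_comp1 J.I_comp2 h d(7)[OF x] d(7)[OF y] by blast
        then show ?thesis using h comp_closed[OF x y] d(5)[OF x y] by (simp add: I_def)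
      qed
    qed
    moreover have "U \<subseteq> I k" using U UJ by (auto simp: I_def)
    ultimately have "x \<in> I n" using x unfolding generated_ideal_def by blast
    then show ?thesis by (simp add: I_def)
  qed
  then show ?thesis unfolding generated_ideal_def[of Q] by blast
qed

lemma (in operad) generated_ideal_subset_oper:
  "U \<subseteq> oper P k \<Longrightarrow> generated_ideal P k U n \<subseteq> oper P n"
  using operad_ideal_generated[of U k] unfolding operad_ideal_def by blast

text \<open>The second inclusion is the first one applied to the inverse isomorphism.\<close>

lemma operad_iso_generated_ideal:
  assumes i: "operad_iso \<phi> P Q" and P: "operad P" and Q: "operad Q" and U: "U \<subseteq> oper P k"
  shows "\<phi> n ` generated_ideal P k U n = generated_ideal Q k (\<phi> k ` U) n"
proof
  show "\<phi> n ` generated_ideal P k U n \<subseteq> generated_ideal Q k (\<phi> k ` U) n"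
    by (rule operad_iso_generated_ideal_subset[OF assms])
  let ?\<psi> = "\<lambda>n. inv_into (oper P n) (\<phi> n)"
  note d = operad_isoD[OF i]
  have U': "\<phi> k ` U \<subseteq> oper Q k" using U d(7) by blast
  have "?\<psi> k ` \<phi> k ` U = U"
    using bij_betw_inv_into_left[OF d(1)[of k]] U by (force simp: image_image)
  then have sub: "?\<psi> n ` generated_ideal Q k (\<phi> k ` U) n \<subseteq> generated_ideal P k U n"
    using operad_iso_generated_ideal_subset[OF operad_iso_inverse[OF i P] Q P U', of n] by simp
  show "generated_ideal Q k (\<phi> k ` U) n \<subseteq> \<phi> n ` generated_ideal P k U n"
  proof
    fix y assume y: "y \<in> generated_ideal Q k (\<phi> k ` U) n"
    then have "y \<in> oper Q n" using operad.generated_ideal_subset_oper[OF Q U'] by blast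
    then have "y = \<phi> n (?\<psi> n y)" by (rule bij_betw_inv_into_right[OF d(1), symmetric])
    then show "y \<in> \<phi> n ` generated_ideal P k U n" using sub y by blast
  qed
qed

lemma operad_iso_quotient:
  assumes i: "operad_iso \<phi> P Q" and P: "operad_with_ideal P I" and Q: "operad_with_ideal Q J"
    and IJ: "\<And>n. \<phi> n ` I n = J n"
  shows "operad_iso (\<lambda>n X. \<phi> n ` X) (quotient_operad P I) (quotient_operad Q J)"
proof -
  interpret P: operad_with_ideal P I by (rule P)
  interpret Q: operad_with_ideal Q J by (rule Q)
  note d = operad_isoD[OF i]
  \<comment> \<open>Additivity carries the coset of \<open>x\<close> modulo \<open>I\<close> onto
    the coset of its image modulo \<open>J\<close>. With this, each clause reduces to
    representatives.\<close>
  have c: "\<phi> n ` coset P I n x = coset Q J n (\<phi> n x)" if "x \<in> oper P n" for n x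
    unfolding coset_def IJ[symmetric] image_image
    by (rule image_cong[OF refl]) (rule d(2)[OF that P.I_oper])
  have sub: "coset P I n x \<subseteq> oper P n" if "x \<in> oper P n" for n x
    using that P.I_oper P.add_closed by (auto simp: coset_def)
  have E: "\<exists>x\<in>oper P n. X = coset P I n x" if "X \<in> oper (quotient_operad P I) n" for n X
    using that by (auto simp: P.qrest)
  show ?thesis
  proof (rule operad_isoI)
    fix m n k c' X Y \<sigma>
    have "inj_on ((`) (\<phi> n)) (oper (quotient_operad P I) n)"
    proof (rule inj_onI)
      fix X Y assume "X \<in> oper (quotient_operad P I) n" "Y \<in> oper (quotient_operad P I) n"
        and "\<phi> n ` X = \<phi> n ` Y"
      then show "X = Y"
        using E[of X n] E[of Y n] sub inj_on_image_eq_iff[of "\<phi> n" "oper P n" X Y] d(1)[of n]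
        by (auto simp: bij_betw_def)
    qed
    moreover have "(`) (\<phi> n) ` oper (quotient_operad P I) n = oper (quotient_operad Q J) n"
      unfolding P.qrest Q.qrest bij_betw_imp_surj_on[OF d(1), symmetric] image_image
      by (rule image_cong[OF refl]) (rule c)
    ultimately show "bij_betw ((`) (\<phi> n)) (oper (quotient_operad P I) n) (oper (quotient_operad Q J) n)"
      by (simp add: bij_betw_def)
    show "\<phi> 1 ` ounit (quotient_operad P I) = ounit (quotient_operad Q J)"
      unfolding P.qrest Q.qrest c[OF P.unit_closed] d(4) ..
    assume Y: "Y \<in> oper (quotient_operad P I) n"
    then obtain b where b: "b \<in> oper P n" "Y = coset P I n b" using E by blast
    show "\<phi> n ` oscale (quotient_operad P I) n c' Y = oscale (quotient_operad Q J) n c' (\<phi> n ` Y)"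
      using b by (simp add: P.qscale Q.qscale c d P.scale_closed)
    show "\<phi> n ` oact (quotient_operad P I) n \<sigma> Y = oact (quotient_operad Q J) n \<sigma> (\<phi> n ` Y)"
      if "\<sigma> permutes {1..n}"
      using b that by (simp add: P.qact Q.qact c d P.act_closed del: One_nat_def)
    show "\<phi> n ` oadd (quotient_operad P I) n X Y = oadd (quotient_operad Q J) n (\<phi> n ` X) (\<phi> n ` Y)"
      if X: "X \<in> oper (quotient_operad P I) n"
    proof -
      obtain a where "a \<in> oper P n" "X = coset P I n a" using E X by blast
      then show ?thesis using b by (simp add: P.qadd Q.qadd c d P.add_closed)
    qed
    show "\<phi> (m + n - 1) ` ocomp (quotient_operad P I) m n k X Y
      = ocomp (quotient_operad Q J) m n k (\<phi> m ` X) (\<phi> n ` Y)"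
      if X: "X \<in> oper (quotient_operad P I) m" and k: "1 \<le> k" "k \<le> m"
    proof -
      obtain a where "a \<in> oper P m" "X = coset P I m a" using E X by blast
      then show ?thesis using b k by (simp only: P.qcomp Q.qcomp c d P.comp_closed)
    qed
  qed
qed

lemma operad_with_ideal_generated:
  "operad P \<Longrightarrow> U \<subseteq> oper P k \<Longrightarrow> operad_with_ideal P (generated_ideal P k U)"
  by (intro operad_with_ideal.intro operad_with_ideal_axioms.intro operad.operad_ideal_generated)

text \<open>An isomorphism of free operads that matches the relations also matches the ideals they
  generate, so it descends. The sufficiency half of the theorem rests on this.\<close>

lemma quadratic_operad_isomorphic:
  fixes U :: "('g::finite btree \<Rightarrow> 'k::field) set" and W :: "('h::finite btree \<Rightarrow> 'k) set"
  assumes i: "operad_iso \<phi> (free_operad :: ('k, 'g btree \<Rightarrow> 'k) operad) (free_operad :: ('k, 'h btree \<Rightarrow> 'k) operad)"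
    and U: "U \<subseteq> oper free_operad 3" and W: "\<phi> 3 ` U = W"
  shows "operad_isomorphic (quadratic_operad U) (quadratic_operad W)"
proof -
  have W': "W \<subseteq> oper free_operad 3" using U W operad_isoD(7)[OF i] by blast
  have "operad_iso (\<lambda>n X. \<phi> n ` X) (quadratic_operad U) (quadratic_operad W)"
    unfolding quadratic_operad_def
  proof (rule operad_iso_quotient[OF i])
    show "operad_with_ideal free_operad (generated_ideal free_operad 3 U)"
      by (rule operad_with_ideal_generated[OF free_operad U])
    show "operad_with_ideal free_operad (generated_ideal free_operad 3 W)"
      by (rule operad_with_ideal_generated[OF free_operad W'])
    show "\<phi> n ` generated_ideal free_operad 3 U n = generated_ideal free_operad 3 W n" for n
      unfolding W[symmetric] by (rule operad_iso_generated_ideal[OF i free_operad free_operad U])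
  qed
  then show ?thesis unfolding operad_isomorphic_iff by blast
qed

section \<open>Trees with few leaves\<close>

text \<open>The tree maps inducing \<open>\<mu> \<mapsto> \<nu>\<close> (\<open>m\<close> false) and \<open>\<mu> \<mapsto> \<nu>'\<close> (\<open>m\<close> true).\<close>

primrec retree :: "bool \<Rightarrow> 'h \<Rightarrow> 'g btree \<Rightarrow> 'h btree" where
  "retree m h (Leaf j) = Leaf j"
| "retree m h (Node g l r) =
    (if m then Node h (retree m h r) (retree m h l) else Node h (retree m h l) (retree m h r))"

lemma leaves_retree: "leaves (retree m h t) = (if m then rev (leaves t) else leaves t)"
  by (induction t) auto

lemma retree_trees_iff: "retree m h t \<in> trees n \<longleftrightarrow> t \<in> trees n"
  by (auto simp: trees_def leaves_retree)

lemma retree_plug: "retree m h (plug f t) = plug (\<lambda>j. retree m h (f j)) (retree m h t)"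
  by (induction t) auto

lemma retree_relabel: "retree m h (relabel \<sigma> t) = relabel \<sigma> (retree m h t)"
  by (simp add: relabel_def retree_plug)

lemma retree_graft: "retree m h (graft n i s t) = graft n i (retree m h s) (retree m h t)"
  by (simp add: graft_def retree_plug retree_relabel if_distrib[of "retree m h"] cong: if_cong)

text \<open>With a single generator the decoration forgotten by \<open>retree\<close> carries no
  information, and mirroring twice is the identity.\<close>

lemma retree_retree: "UNIV = {g :: 'g} \<Longrightarrow> retree m g (retree m h t) = (t :: 'g btree)"
  by (induction t) auto

lemma UNIV_mu_gen: "UNIV = {Mu}" and UNIV_nu_gen: "UNIV = {Nu}"
  by (auto intro: mu_gen.exhaust nu_gen.exhaust)

text \<open>Precomposition with \<open>retree m g\<close> sends the basis vector of a tree to that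
  of its image under \<open>retree m h\<close>, the two maps being mutually inverse. On basis
  vectors, compatibility with the operad structure is that of \<open>retree\<close> with
  \<open>graft\<close> and \<open>relabel\<close>.\<close>

lemma operad_iso_retree:
  fixes g :: "'g::finite" and h :: "'h::finite"
  assumes g: "UNIV = {g}" and h: "UNIV = {h}"
  shows "operad_iso (\<lambda>n f t. f (retree m g t))
    (free_operad :: ('k::field, 'g btree \<Rightarrow> 'k) operad) (free_operad :: ('k, 'h btree \<Rightarrow> 'k) operad)"
proof (rule operad_isoI)
  let ?\<phi> = "\<lambda>(f :: 'g btree \<Rightarrow> 'k) t. f (retree m g (t :: 'h btree))"
  have lin: "flinear ?\<phi>" by (rule linI) (auto simp: fscale_def)
  have sg: "?\<phi> (single t) = single (retree m h t)" for t
    using retree_retree[OF g, of m h] retree_retree[OF h, of m g] by (auto simp: single_def fun_eq_iff)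
  have part: "?\<phi> f \<in> free_part n" if "f \<in> free_part n" for f n
    using that by (auto simp: retree_trees_iff)
  fix n k i c x y \<sigma>
  show "bij_betw ?\<phi> (oper (free_operad :: ('k, 'g btree \<Rightarrow> 'k) operad) n) (oper (free_operad :: ('k, 'h btree \<Rightarrow> 'k) operad) n)"
    unfolding fF
  proof (rule bij_betw_byWitness[where f' = "\<lambda>f t. f (retree m h t)"])
    show "(\<lambda>f t. f (retree m h t)) ` free_part n \<subseteq> free_part n"
      by (auto simp: retree_trees_iff)
  qed (use part in \<open>auto simp: retree_retree[OF g] retree_retree[OF h]\<close>)
  show "?\<phi> (oadd free_operad n x y) = oadd free_operad n (?\<phi> x) (?\<phi> y)"
    and "?\<phi> (oscale free_operad n c x) = oscale free_operad n c (?\<phi> x)"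
    unfolding fF by (rule linD[OF lin])+
  show "?\<phi> (ounit free_operad) = ounit free_operad"
    unfolding fF using sg by simp
  assume x: "x \<in> oper free_operad n"
  show "?\<phi> (free_act n \<sigma> x) = free_act n \<sigma> (?\<phi> x)"
    by (rule F_eqI[OF lin_compose[OF lin lin_A] lin_compose[OF lin_A lin] x[unfolded fF]])
      (simp only: sg A_single retree_trees_iff retree_relabel)
  assume y: "y \<in> oper free_operad k" and i: "1 \<le> i" "i \<le> n"
  show "?\<phi> (free_comp n k i x y) = free_comp n k i (?\<phi> x) (?\<phi> y)"
  proof (rule F_eqI[OF lin_compose[OF lin lin_C1] lin_compose[OF lin_C1 lin] x[unfolded fF]])
    fix s :: "'g btree" assume s: "s \<in> trees n"
    show "?\<phi> (free_comp n k i (single s) y) = free_comp n k i (?\<phi> (single s)) (?\<phi> y)"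
      by (rule F_eqI[OF lin_compose[OF lin lin_C2] lin_compose[OF lin_C2 lin] y[unfolded fF]])
        (simp only: sg C_single s retree_trees_iff retree_graft)
  qed
qed

section \<open>Binary trees with at most three leaves\<close>

lemma length_leaves_pos: "0 < length (leaves t)"
  by (induction t) auto

lemma length_leaves_1:
  assumes "length (leaves t) = 1"
  shows "\<exists>i. t = Leaf i"
proof (cases t)
  case (Node g l r)
  then show ?thesis using assms length_leaves_pos[of l] length_leaves_pos[of r] by simp
qed simp

lemma length_leaves_2: "length (leaves t) = 2 \<Longrightarrow> \<exists>g i j. t = Node g (Leaf i) (Leaf j)"
proof (cases t)
  case (Node g l r)
  assume "length (leaves t) = 2"
  then have "length (leaves l) + length (leaves r) = 2" using Node by simp
  then have "length (leaves l) = 1" "length (leaves r) = 1"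
    using length_leaves_pos[of l] length_leaves_pos[of r] by linarith+
  then show ?thesis using Node length_leaves_1 by blast
qed auto

lemma length_leaves_3:
  assumes "length (leaves t) = 3"
  shows "(\<exists>g h i j k. t = Node g (Node h (Leaf i) (Leaf j)) (Leaf k))
    \<or> (\<exists>g h i j k. t = Node g (Leaf i) (Node h (Leaf j) (Leaf k)))"
proof (cases t)
  case (Node g l r)
  then have "length (leaves l) + length (leaves r) = 3" using assms by simp
  then consider "length (leaves l) = 2" "length (leaves r) = 1" | "length (leaves l) = 1" "length (leaves r) = 2"
    using length_leaves_pos[of l] length_leaves_pos[of r] by linarith
  then show ?thesis
  proof cases
    case 1
    then show ?thesis using Node length_leaves_2[of l] length_leaves_1[of r] by auto
  next
    case 2
    then show ?thesis using Node length_leaves_1[of l] length_leaves_2[of r] by auto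
  qed
qed (use assms in auto)

lemma trees_length: "t \<in> trees n \<Longrightarrow> length (leaves t) = n"
  using distinct_card by (force simp: trees_def)

lemma trees_0: "trees 0 = {}"
  using trees_length[of _ 0] length_leaves_pos by fastforce

lemma trees_1: "trees 1 = {Leaf 1}"
proof (intro equalityI subsetI)
  fix t :: "'a btree" assume t: "t \<in> trees 1"
  then obtain i where "t = Leaf i" using length_leaves_1[OF trees_length[OF t]] by blast
  then show "t \<in> {Leaf 1}" using t by (auto simp: trees_def)
qed (auto simp: trees_def)

abbreviation "left_comb g i j k \<equiv> Node g (Node g (Leaf i) (Leaf j)) (Leaf k)"
abbreviation "right_comb g i j k \<equiv> Node g (Leaf i) (Node g (Leaf j) (Leaf k))"

lemma trees_2:
  assumes "UNIV = {g :: 'g}"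
  shows "trees 2 = {corolla g, corolla' g}"
proof (intro equalityI subsetI)
  fix t :: "'g btree" assume t: "t \<in> trees 2"
  then obtain i j where ij: "t = Node g (Leaf i) (Leaf j)"
    using length_leaves_2[OF trees_length[OF t]] assms by blast
  then have "i \<noteq> j" "{i, j} = {1..2}" using t by (auto simp: trees_def)
  then have "i = 1 \<and> j = 2 \<or> i = 2 \<and> j = 1"
  proof -
    have "i \<in> {1..2}" "j \<in> {1..2}" using \<open>{i, j} = {1..2}\<close> by blast+
    then have "i = 1 \<or> i = 2" "j = 1 \<or> j = 2" by auto
    then show ?thesis using \<open>i \<noteq> j\<close> by auto
  qed
  then show "t \<in> {corolla g, corolla' g}"
    using ij by (auto simp: corolla_def corolla'_def relabel_def)
qed (auto simp: trees_def corolla_def corolla'_def relabel_def)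

lemma atLeastAtMost_1_3: "{1..3} = {1, 2, 3 :: nat}"
  by auto

lemma permutation_3_cases:
  assumes "distinct [i, j, k]" "{i, j, k} = {1..3 :: nat}"
  obtains "[i, j, k] = [1, 2, 3]" | "[i, j, k] = [2, 1, 3]" | "[i, j, k] = [3, 1, 2]"
    | "[i, j, k] = [3, 2, 1]" | "[i, j, k] = [2, 3, 1]" | "[i, j, k] = [1, 3, 2]"
proof -
  have "i \<in> {1, 2, 3}" "j \<in> {1, 2, 3}" "k \<in> {1, 2, 3}"
    using assms(2) unfolding atLeastAtMost_1_3 by blast+
  then show ?thesis using assms(1) that by auto
qed

lemma trees_3_cases:
  assumes "UNIV = {g :: 'g}" "t \<in> trees 3"
  obtains (left) i j k where "t = left_comb g i j k" "distinct [i, j, k]" "{i, j, k} = {1..3}"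
    | (right) i j k where "t = right_comb g i j k" "distinct [i, j, k]" "{i, j, k} = {1..3}"
proof -
  have g: "g' = g" for g' using assms(1) by blast
  show thesis
    using length_leaves_3[OF trees_length[OF assms(2)]]
  proof (elim disjE exE)
    fix a b i j k assume t: "t = Node a (Node b (Leaf i) (Leaf j)) (Leaf k)"
    show thesis using assms(2) by (intro left[of i j k]) (auto simp: t trees_def g[of a] g[of b])
  next
    fix a b i j k assume t: "t = Node a (Leaf i) (Node b (Leaf j) (Leaf k))"
    show thesis using assms(2) by (intro right[of i j k]) (auto simp: t trees_def g[of a] g[of b])
  qed
qed

text \<open>The two shapes of trees, each with six labellings, account for the twelve listed
  trees.\<close>

lemma trees_3:
  assumes "UNIV = {g :: 'g}"
  shows "trees 3 = set (basis3 g)"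
proof (intro equalityI subsetI)
  fix t :: "'g btree" assume "t \<in> trees 3"
  from assms this show "t \<in> set (basis3 g)"
  proof (cases rule: trees_3_cases)
    case (left i j k)
    from left(2,3) show ?thesis by (cases rule: permutation_3_cases) (simp_all add: left(1) basis3_explicit Let_def)
  next
    case (right i j k)
    from right(2,3) show ?thesis by (cases rule: permutation_3_cases) (simp_all add: right(1) basis3_explicit Let_def)
  qed
qed (auto simp: basis3_explicit Let_def trees_def)

section \<open>The substitution in arity 3\<close>

lemma distinct_basis3: "distinct (basis3 g)"
  by (simp add: basis3_explicit Let_def)

lemma length_basis3: "length (basis3 g) = 12"
  by (simp add: basis3_explicit Let_def)

lemma sum_fun_apply: "(\<Sum>i\<in>A. F i) x = (\<Sum>i\<in>A. F i x)"
  for F :: "'i \<Rightarrow> 'b \<Rightarrow> 'k::comm_monoid_add"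
  by (induction A rule: infinite_finite_induct) auto

lemma from_coords_nth:
  assumes "i < 12"
  shows "from_coords g cs (basis3 g ! i) = (cs ! i :: 'k::field)"
proof -
  have "from_coords g cs (basis3 g ! i) = (\<Sum>j<12. (if i = j then cs ! j else 0))"
    unfolding from_coords_def sum_fun_apply
    using assms by (intro sum.cong) (auto simp: fscale_def single_def nth_eq_iff_index_eq[OF distinct_basis3] length_basis3)
  then show ?thesis using assms by simp
qed

text \<open>Evaluation rules at explicit trees; identities of coordinate vectors are then checked by
  rewriting at twelve trees.\<close>

lemma from_coords_tree:
  "from_coords g cs (left_comb g 1 2 3) = cs ! 0" "from_coords g cs (left_comb g 2 1 3) = cs ! 1"
  "from_coords g cs (right_comb g 3 1 2) = cs ! 2" "from_coords g cs (right_comb g 3 2 1) = cs ! 3"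
  "from_coords g cs (left_comb g 3 2 1) = cs ! 4" "from_coords g cs (left_comb g 2 3 1) = cs ! 5"
  "from_coords g cs (right_comb g 1 3 2) = cs ! 6" "from_coords g cs (right_comb g 1 2 3) = cs ! 7"
  "from_coords g cs (left_comb g 1 3 2) = cs ! 8" "from_coords g cs (left_comb g 3 1 2) = cs ! 9"
  "from_coords g cs (right_comb g 2 1 3) = cs ! 10" "from_coords g cs (right_comb g 2 3 1) = cs ! 11"
  using from_coords_nth[of 0 g cs] from_coords_nth[of 1 g cs] from_coords_nth[of 2 g cs]
    from_coords_nth[of 3 g cs] from_coords_nth[of 4 g cs] from_coords_nth[of 5 g cs]
    from_coords_nth[of 6 g cs] from_coords_nth[of 7 g cs] from_coords_nth[of 8 g cs]
    from_coords_nth[of 9 g cs] from_coords_nth[of 10 g cs] from_coords_nth[of 11 g cs]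
  by (simp_all add: basis3_explicit Let_def)

lemma from_coords_closed:
  fixes g :: "'g::finite"
  assumes "UNIV = {g}"
  shows "from_coords g cs \<in> free_part 3"
  unfolding F_span from_coords_def
proof (intro fs.span_sum fs.span_scale fs.span_base imageI)
  fix i :: nat assume "i \<in> {..<12}"
  then show "basis3 g ! i \<in> trees 3" unfolding trees_3[OF assms] by (intro nth_mem) (simp add: length_basis3)
qed

lemma pairing_explicit: "pairing f u =
    f (left_comb Nu 1 2 3) * u (left_comb Mu 1 2 3) - f (left_comb Nu 2 1 3) * u (left_comb Mu 2 1 3)
  - f (right_comb Nu 3 1 2) * u (right_comb Mu 3 1 2) + f (right_comb Nu 3 2 1) * u (right_comb Mu 3 2 1)
  - f (left_comb Nu 3 2 1) * u (left_comb Mu 3 2 1) + f (left_comb Nu 2 3 1) * u (left_comb Mu 2 3 1)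
  + f (right_comb Nu 1 3 2) * u (right_comb Mu 1 3 2) - f (right_comb Nu 1 2 3) * u (right_comb Mu 1 2 3)
  - f (left_comb Nu 1 3 2) * u (left_comb Mu 1 3 2) + f (left_comb Nu 3 1 2) * u (left_comb Mu 3 1 2)
  + f (right_comb Nu 2 1 3) * u (right_comb Mu 2 1 3) - f (right_comb Nu 2 3 1) * u (right_comb Mu 2 3 1)"
  unfolding pairing_def pairing_diag_def basis3_explicit Let_def
  by (simp add: eval_nat_numeral)

lemma free_part_3_eqI:
  fixes f f' :: "mu_gen btree \<Rightarrow> 'k::field"
  assumes "f \<in> free_part 3" "f' \<in> free_part 3"
    and "f (left_comb Mu 1 2 3) = f' (left_comb Mu 1 2 3)" "f (left_comb Mu 2 1 3) = f' (left_comb Mu 2 1 3)"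
      "f (right_comb Mu 3 1 2) = f' (right_comb Mu 3 1 2)" "f (right_comb Mu 3 2 1) = f' (right_comb Mu 3 2 1)"
      "f (left_comb Mu 3 2 1) = f' (left_comb Mu 3 2 1)" "f (left_comb Mu 2 3 1) = f' (left_comb Mu 2 3 1)"
      "f (right_comb Mu 1 3 2) = f' (right_comb Mu 1 3 2)" "f (right_comb Mu 1 2 3) = f' (right_comb Mu 1 2 3)"
      "f (left_comb Mu 1 3 2) = f' (left_comb Mu 1 3 2)" "f (left_comb Mu 3 1 2) = f' (left_comb Mu 3 1 2)"
      "f (right_comb Mu 2 1 3) = f' (right_comb Mu 2 1 3)" "f (right_comb Mu 2 3 1) = f' (right_comb Mu 2 3 1)"
  shows "f = f'"
proof
  fix t
  show "f t = f' t"
  proof (cases "t \<in> trees 3")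
    case True
    then have "t \<in> set (basis3 Mu)" by (simp only: trees_3[OF UNIV_mu_gen])
    then show ?thesis using assms(3-) unfolding basis3_explicit Let_def by (auto simp del: One_nat_def)
  next
    case False
    then have "f t = 0" "f' t = 0" using assms(1,2) by blast+
    then show ?thesis by simp
  qed
qed

text \<open>\<open>subst3 a b\<close> is the map \<open>\<F>(3) \<rightarrow> \<F>(3)\<^sup>\<or>\<close> induced by \<open>\<mu> \<mapsto> a\<nu> + b\<nu>'\<close>; the prime exchanges the two
  subtrees of a vertex.\<close>

fun subst3 :: "'k::field \<Rightarrow> 'k \<Rightarrow> (mu_gen btree \<Rightarrow> 'k) \<Rightarrow> nu_gen btree \<Rightarrow> 'k" where
  "subst3 a b f (Node g (Node h (Leaf i) (Leaf j)) (Leaf k)) =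
     a\<^sup>2 * f (left_comb Mu i j k) + a * b * f (left_comb Mu j i k)
     + a * b * f (right_comb Mu k i j) + b\<^sup>2 * f (right_comb Mu k j i)"
| "subst3 a b f (Node g (Leaf i) (Node h (Leaf j) (Leaf k))) =
     a\<^sup>2 * f (right_comb Mu i j k) + a * b * f (right_comb Mu i k j)
     + a * b * f (left_comb Mu j k i) + b\<^sup>2 * f (left_comb Mu k j i)"
| "subst3 a b f _ = 0"

text \<open>Up to the factor 3, the pairing of \<open>subst3 a b (u21 x)\<close> with
  \<open>u22 y\<close>. The first two lines are alternating in \<open>x\<close> and
  \<open>y\<close>, the third is symmetric. For \<open>b = 0\<close> its vanishing is the equation
  of \<open>Y1\<close>, for \<open>a = 0\<close> that of \<open>Y2\<close>.\<close>

definition lform :: "'k::field \<Rightarrow> 'k \<Rightarrow> 'k ^ 4 \<Rightarrow> 'k ^ 4 \<Rightarrow> 'k" where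
  "lform a b x y =
     a\<^sup>2 * (plucker x y (2, 4) - plucker x y (1, 3))
     + b\<^sup>2 * (plucker x y (1, 2) + plucker x y (2, 3) - plucker x y (1, 4))
     + a * b * (x$2 * y$2 - x$1 * y$1 + (x$1 - x$2) * (y$3 + y$4) + (x$3 + x$4) * (y$1 - y$2))"

section \<open>The substitution paired with isotypic vectors\<close>

lemmas u_defs = u_pm_def u21_def u22_def from_coords_tree

lemma subst3_add: "subst3 a b (f + f') = subst3 a b f + subst3 a b f'"
proof
  fix t show "subst3 a b (f + f') t = (subst3 a b f + subst3 a b f') t"
    by (cases "(a, b, f, t)" rule: subst3.cases) (simp_all add: algebra_simps)
qed

lemma pairing_add: "pairing (f + f') u = pairing f u + pairing f' u" "pairing f (u + u') = pairing f u + pairing f u'"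
  by (simp_all add: pairing_def distrib_left distrib_right sum.distrib)

text \<open>The substitution is equivariant and the pairing is twisted by the sign, so the trivial
  module can pair only with the sign module: both factors \<open>1 - s * t\<close> and
  \<open>t - s\<close> vanish when \<open>s\<close> and \<open>t\<close> are the same sign.\<close>

lemma pairing_u_pm_u_pm: "pairing (subst3 a b (u_pm t \<gamma> \<delta>)) (u_pm s \<alpha> \<beta>) =
    3 * ((1 - s * t) * (a\<^sup>2 * (\<gamma> * \<alpha> - \<delta> * \<beta>) + a * b * (\<delta> * \<alpha> - \<gamma> * \<beta>))
      + (t - s) * (b\<^sup>2 * (\<delta> * \<alpha> - \<gamma> * \<beta>) + a * b * (\<gamma> * \<alpha> - \<delta> * \<beta>)))"
  unfolding pairing_explicit subst3.simps u_defs
  by (simp add: algebra_simps del: One_nat_def)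

text \<open>An instance of Schur's lemma: a one-dimensional module is not isomorphic to the
  two-dimensional irreducible one, also after a sign twist.\<close>

lemma pairing_u_pm_u2:
  assumes "s * s = 1"
  shows "pairing (subst3 a b (u_pm s \<gamma> \<delta>)) (u21 x) = 0"
    "pairing (subst3 a b (u_pm s \<gamma> \<delta>)) (u22 x) = 0"
    "pairing (subst3 a b (u21 x)) (u_pm s \<gamma> \<delta>) = 0"
    "pairing (subst3 a b (u22 x)) (u_pm s \<gamma> \<delta>) = 0"
  unfolding pairing_explicit subst3.simps u_defs
  using assms by (simp_all add: algebra_simps del: One_nat_def)

text \<open>A form on the two-dimensional module that is invariant up to sign is a multiple of the
  determinant. Hence equal basis vectors pair to zero and the two mixed pairings are opposite; only
  the multiple depends on \<open>x\<close> and \<open>y\<close>.\<close>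

lemma pairing_u2_u2:
  "pairing (subst3 a b (u21 x)) (u21 y) = 0" "pairing (subst3 a b (u22 x)) (u22 y) = 0"
  "pairing (subst3 a b (u21 x)) (u22 y) = 3 * lform a b x y"
  "pairing (subst3 a b (u22 x)) (u21 y) = - 3 * lform a b x y"
  unfolding pairing_explicit subst3.simps u_defs lform_def plucker_def prod.case
  by (simp_all add: algebra_simps del: One_nat_def)

text \<open>The left vector has the general isotypic form of an element of arity 3, the right one
  that of an element of \<open>U\<close>. The parameters \<alpha> and \<beta> drop out, as equal
  signs do not pair.\<close>

lemma pairing_subst3:
  assumes "s \<in> {1, -1}"
  shows "pairing (subst3 a b (u_pm s \<alpha> \<beta> + u_pm (-s) \<gamma> \<delta> + u21 z + u22 w)) (u_pm s \<alpha>' \<beta>' + u21 z' + u22 w')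
    = 6 * (a\<^sup>2 * \<gamma> - s * b\<^sup>2 * \<delta> + a * b * (\<delta> - s * \<gamma>)) * \<alpha>'
    + 6 * (s * b\<^sup>2 * \<gamma> - a\<^sup>2 * \<delta> + a * b * (s * \<delta> - \<gamma>)) * \<beta>'
    + 3 * (lform a b z w' - lform a b w z')"
proof -
  have "s * s = 1" "- s * - s = 1" using assms by auto
  then show ?thesis
    using assms
    by (auto simp: subst3_add pairing_add pairing_u_pm_u_pm pairing_u_pm_u2 pairing_u2_u2 algebra_simps)
qed

lemma u_closed: "u_pm s \<alpha> \<beta> \<in> free_part 3" "u21 x \<in> free_part 3" "u22 x \<in> free_part 3"
  unfolding u_pm_def u21_def u22_def by (rule from_coords_closed[OF UNIV_mu_gen])+

text \<open>At these two parameter pairs the substitution merely permutes trees, which identifies it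
  with the arity 3 part of the isomorphism in \<open>operad_iso_retree\<close>.\<close>

lemma subst3_retree:
  assumes f: "f \<in> free_part 3"
  shows "subst3 1 0 f = (\<lambda>t. f (retree False Mu t))" "subst3 0 1 f = (\<lambda>t. f (retree True Mu t))"
proof -
  have "subst3 1 0 f t = f (retree False Mu t) \<and> subst3 0 1 f t = f (retree True Mu t)" for t
  proof (cases "t \<in> trees 3")
    case True
    from UNIV_nu_gen this show ?thesis by (cases rule: trees_3_cases) simp_all
  next
    case False
    then have "f (retree m Mu t) = 0" for m
      using f retree_trees_iff[of m Mu t 3] by blast
    moreover have "subst3 a b f t = 0" for a b
    proof -
      \<comment> \<open>\<open>subst3\<close> reads \<open>f\<close> only at trees with as many
        leaves as \<open>t\<close> and the same set of labels; if \<open>t\<close> is outside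
        \<open>trees 3\<close>, so are they.\<close>
      have "f t' = 0" if "set (leaves t') = set (leaves t)" "length (leaves t') = length (leaves t)" for t'
        using f False that distinct_card[of "leaves t'"] card_distinct[of "leaves t"]
        by (auto simp: trees_def)
      then show ?thesis by (cases "(a, b, f, t)" rule: subst3.cases) (auto simp: insert_commute)
    qed
    ultimately show ?thesis by simp
  qed
  then show "subst3 1 0 f = (\<lambda>t. f (retree False Mu t))" "subst3 0 1 f = (\<lambda>t. f (retree True Mu t))"
    by auto
qed

lemma vec4_exists: "\<exists>x :: 'k ^ 4. x$1 = a \<and> x$2 = b \<and> x$3 = c \<and> x$4 = d"
  by (rule exI[of _ "\<chi> i. if i = 1 then a else if i = 2 then b else if i = 3 then c else d"]) simp

section \<open>Planes in four-space\<close>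

text \<open>Solves the six equations for the coordinates at the trees of one shape. Here
  \<open>v1\<close>, \<open>v4\<close>, \<open>v6\<close> belong to the even labellings and
  \<open>v2\<close>, \<open>v3\<close>, \<open>v5\<close> to the odd ones. Inverting 3 splits off
  the two-dimensional part, inverting 2 separates the two signs.\<close>

lemma decompose_scalars:
  fixes v1 v2 v3 v4 v5 v6 s :: "'k::field"
  assumes "s * s = 1" "(2 :: 'k) \<noteq> 0" "(3 :: 'k) \<noteq> 0"
  obtains \<alpha> \<gamma> z1 z3 w1 w3 where
    "v1 = \<alpha> + \<gamma> + z1 + (w1 - w3)" "v2 = s * \<alpha> - s * \<gamma> - z1 - w3"
    "v3 = s * \<alpha> - s * \<gamma> + z3 + (w3 - w1)" "v4 = \<alpha> + \<gamma> + (z3 - z1) + w3"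
    "v5 = s * \<alpha> - s * \<gamma> + (z1 - z3) + w1" "v6 = \<alpha> + \<gamma> - z3 - w1"
proof -
  have third: "\<exists>y. 3 * y = v" for v :: 'k using assms(3) by (intro exI[of _ "v / 3"]) simp
  \<comment> \<open>Summing over even or over odd labellings cancels all \<open>z\<close> and
    \<open>w\<close>, so \<open>p\<close> is \<alpha> + \<gamma> and \<open>m\<close> is
    \<open>s * (\<alpha> - \<gamma>)\<close>.\<close>
  obtain p where p: "3 * p = v1 + v4 + v6" using third by blast
  obtain m where m: "3 * m = v2 + v3 + v5" using third by blast
  obtain z1 where z1: "3 * z1 = 3 * (p + m) - (2 * v2 + 2 * v4 + v5 + v6)" using third by blast
  obtain z3 where z3: "z3 = 2 * z1 + v2 + v4 - p - m" by blast
  obtain w3 where w3: "w3 = m - z1 - v2" by blast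
  obtain w1 where w1: "w1 = v1 + v2 - p - m + 2 * w3" by blast
  note d = p m z1 z3 w3 w1
  obtain h :: 'k where h: "2 * h = 1" using right_inverse[OF assms(2)] by blast
  have \<alpha>\<gamma>: "h * (p + s * m) + h * (p - s * m) = p" "s * (h * (p + s * m)) - s * (h * (p - s * m)) = m"
    using h assms(1) by algebra+
  show ?thesis
  proof (rule that[of "h * (p + s * m)" "h * (p - s * m)" z1 w1 w3 z3]; unfold \<alpha>\<gamma>)
    show "v1 = p + z1 + (w1 - w3)" using d by algebra
    show "v2 = m - z1 - w3" using d by algebra
    show "v3 = m + z3 + (w3 - w1)" using d by algebra
    show "v4 = p + (z3 - z1) + w3" using d by algebra
    show "v5 = m + (z1 - z3) + w1" using d by algebra
    show "v6 = p - z3 - w1" using d by algebra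
  qed
qed

text \<open>The isotypic decomposition of the arity 3 part: two trivial, two sign and four
  two-dimensional summands. It supplies the component outside \<open>U\<close> in the computation of
  the annihilator.\<close>

lemma decompose:
  fixes f :: "mu_gen btree \<Rightarrow> 'k::field"
  assumes f: "f \<in> free_part 3" and s: "s \<in> {1, -1}" and char: "(2 :: 'k) \<noteq> 0" "(3 :: 'k) \<noteq> 0"
  obtains \<alpha> \<beta> \<gamma> \<delta> z w where "f = u_pm s \<alpha> \<beta> + u_pm (-s) \<gamma> \<delta> + u21 z + u22 w"
proof -
  have s': "s * s = 1" using s by auto
  \<comment> \<open>The system decouples: left combs involve only the coordinates of
    \<open>z\<close> and \<open>w\<close> with odd index, right combs only those with even index,
    both with the same matrix.\<close>
  obtain \<alpha> \<gamma> z1 z3 w1 w3 where odd: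
    "f (left_comb Mu 1 2 3) = \<alpha> + \<gamma> + z1 + (w1 - w3)" "f (left_comb Mu 2 1 3) = s * \<alpha> - s * \<gamma> - z1 - w3"
    "f (left_comb Mu 3 2 1) = s * \<alpha> - s * \<gamma> + z3 + (w3 - w1)" "f (left_comb Mu 2 3 1) = \<alpha> + \<gamma> + (z3 - z1) + w3"
    "f (left_comb Mu 1 3 2) = s * \<alpha> - s * \<gamma> + (z1 - z3) + w1" "f (left_comb Mu 3 1 2) = \<alpha> + \<gamma> - z3 - w1"
    by (rule decompose_scalars[OF s' char])
  obtain \<beta> \<delta> z2 z4 w2 w4 where even:
    "f (right_comb Mu 3 1 2) = \<beta> + \<delta> + z2 + (w2 - w4)" "f (right_comb Mu 3 2 1) = s * \<beta> - s * \<delta> - z2 - w4"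
    "f (right_comb Mu 1 3 2) = s * \<beta> - s * \<delta> + z4 + (w4 - w2)" "f (right_comb Mu 1 2 3) = \<beta> + \<delta> + (z4 - z2) + w4"
    "f (right_comb Mu 2 1 3) = s * \<beta> - s * \<delta> + (z2 - z4) + w2" "f (right_comb Mu 2 3 1) = \<beta> + \<delta> - z4 - w2"
    by (rule decompose_scalars[OF s' char])
  obtain z :: "'k ^ 4" where z: "z$1 = z1" "z$2 = z2" "z$3 = z3" "z$4 = z4" using vec4_exists by metis
  obtain w :: "'k ^ 4" where w: "w$1 = w1" "w$2 = w2" "w$3 = w3" "w$4 = w4" using vec4_exists by metis
  have "f = u_pm s \<alpha> \<beta> + u_pm (-s) \<gamma> \<delta> + u21 z + u22 w"
  proof (rule free_part_3_eqI[OF f])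
    show "u_pm s \<alpha> \<beta> + u_pm (-s) \<gamma> \<delta> + u21 z + u22 w \<in> free_part 3"
      by (intro fs.subspace_add[OF subF] u_closed)
  qed (unfold plus_fun_apply u_defs odd even, simp_all add: z w del: One_nat_def)
  then show ?thesis by (rule that)
qed

section \<open>Pluecker coordinates of a plane\<close>

lemma span_pair: "z \<in> vec.span {x, y} \<longleftrightarrow> (\<exists>p q. z = p *s x + q *s y)"
  by (simp add: vec.span_breakdown_eq vec.span_singleton image_iff diff_eq_eq add.commute)

lemma plucker_eq_0_imp:
  assumes "plucker x y = 0"
  obtains c d where "c *s x + d *s y = 0" "c \<noteq> 0 \<or> d \<noteq> 0"
proof (cases "x = 0")
  case True
  then show ?thesis using that[of 1 0] by simp
next
  case False
  then obtain i where i: "x $ i \<noteq> 0" by (auto simp: vec_eq_iff)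
  have "x$i * y$j = x$j * y$i" for j using fun_cong[OF assms, of "(i, j)"] by (simp add: plucker_def)
  \<comment> \<open>The minors involving a nonzero coordinate of \<open>x\<close> already give the
    dependence.\<close>
  then have "y$i *s x + (- x$i) *s y = 0" by (simp add: vec_eq_iff mult.commute)
  then show ?thesis using that i by fastforce
qed

lemma plucker_combination:
  "plucker (p *s x + q *s y) (p' *s x + q' *s y) = fscale (p * q' - p' * q) (plucker x y)"
  by (auto simp: plucker_def fscale_def fun_eq_iff algebra_simps)

lemma dim_2_iff: "vec.dim {x, y} = 2 \<longleftrightarrow> plucker x y \<noteq> 0"
proof
  assume 2: "vec.dim {x, y} = 2"
  show "plucker x y \<noteq> 0"
  proof
    assume "plucker x y = 0"
    then obtain c d where cd: "c *s x + d *s y = 0" "c \<noteq> 0 \<or> d \<noteq> 0" by (rule plucker_eq_0_imp)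
    have "\<exists>v. {x, y} \<subseteq> vec.span {v}"
    proof (cases "d = 0")
      case True
      then show ?thesis using cd by (intro exI[of _ y]) (auto simp: vec.span_base vec.span_zero)
    next
      case False
      have "y = (- c / d) *s x"
        using cd(1) False by (simp add: vec_eq_iff field_simps eq_neg_iff_add_eq_0 add.commute)
      then have "y \<in> vec.span {x}" by (metis vec.span_base vec.span_scale singletonI)
      then show ?thesis by (intro exI[of _ x]) (auto simp: vec.span_base)
    qed
    then obtain v where "{x, y} \<subseteq> vec.span {v}" by blast
    then have "vec.dim {x, y} \<le> card {v}" by (rule vec.dim_le_card) simp
    then show False using 2 by simp
  qed
next
  assume n: "plucker x y \<noteq> 0"
  have ne: "x \<noteq> y" using n by (auto simp: plucker_def fun_eq_iff)
  moreover have "vec.independent {x, y}"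
  proof -
    have "x \<notin> vec.span {y}" "y \<noteq> 0"
      using n by (auto simp: vec.span_singleton plucker_def fun_eq_iff)
    then show ?thesis using ne by (simp add: vec.independent_insert)
  qed
  ultimately show "vec.dim {x, y} = 2" by (simp add: vec.dim_eq_card_independent)
qed

lemma proj_point_fscale:
  assumes "c \<noteq> 0"
  shows "proj_point (fscale c v) = proj_point v"
proof (intro equalityI subsetI)
  fix p assume "p \<in> proj_point (fscale c v)"
  then obtain d where "d \<noteq> 0" "p = fscale (d * c) v" by (auto simp: proj_point_def)
  then show "p \<in> proj_point v" using assms unfolding proj_point_def by (metis (mono_tags, lifting) mem_Collect_eq mult_eq_0_iff)
next
  fix p assume "p \<in> proj_point v"
  then obtain d where "d \<noteq> 0" "p = fscale d v" by (auto simp: proj_point_def)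
  then have "p = fscale (d / c) (fscale c v)" "d / c \<noteq> 0" using assms by simp_all
  then show "p \<in> proj_point (fscale c v)" unfolding proj_point_def by blast
qed

text \<open>A change of basis multiplies all Pluecker coordinates by its determinant, which is
  nonzero because the new pair is independent.\<close>

lemma plucker_span:
  assumes "x' \<in> vec.span {x, y}" "y' \<in> vec.span {x, y}" "vec.dim {x', y'} = 2"
  shows "proj_point (plucker x' y') = proj_point (plucker x y)"
proof -
  obtain p q p' q' where "x' = p *s x + q *s y" "y' = p' *s x + q' *s y" using assms(1,2) span_pair by metis
  then have e: "plucker x' y' = fscale (p * q' - p' * q) (plucker x y)" by (simp add: plucker_combination)
  then have "p * q' - p' * q \<noteq> 0" using assms(3) by (auto simp: dim_2_iff fscale_def fun_eq_iff)
  then show ?thesis unfolding e by (rule proj_point_fscale)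
qed

lemma lform_isotropic_maximal:
  fixes x y z :: "'k::field ^ 4"
  assumes ab: "(a, b) \<in> {(1, 0), (0, 1)}" and xy: "plucker x y \<noteq> 0"
    and 0: "lform a b x y = 0" "lform a b z x = 0" "lform a b z y = 0"
  shows "z \<in> vec.span {x, y}"
proof -
  \<comment> \<open>The alternating trilinear \<open>D\<close> lists the coordinates of \<open>x \<and> y \<and> z\<close>; contracting with the
    nondegenerate alternating form \<open>lform a b\<close> shows that they vanish.\<close>
  define D where "D i j k = plucker x y (i, j) * z$k - plucker z y (i, j) * x$k - plucker x z (i, j) * y$k" for i j k
  have swap: "D j i k = - D i j k" "D i k j = - D i j k" for i j k
    by (simp_all add: D_def plucker_def algebra_simps)
  have diag: "D i i k = 0" "D i k k = 0" "D i k i = 0" for i k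
    by (simp_all add: D_def plucker_def algebra_simps)
  have perm: "D i j k = 0 \<and> D i k j = 0 \<and> D j i k = 0 \<and> D j k i = 0 \<and> D k i j = 0 \<and> D k j i = 0"
    if "D i j k = 0" for i j k
    using that swap by (metis neg_equal_0_iff_equal)
  have "D 1 2 3 = 0 \<and> D 1 2 4 = 0 \<and> D 1 3 4 = 0 \<and> D 2 3 4 = 0"
    using ab 0 unfolding D_def lform_def plucker_def prod.case
    by (elim insertE emptyE; clarsimp; intro conjI; algebra)
  note perms = this[THEN conjunct1, THEN perm] this[THEN conjunct2, THEN conjunct1, THEN perm]
    this[THEN conjunct2, THEN conjunct2, THEN conjunct1, THEN perm]
    this[THEN conjunct2, THEN conjunct2, THEN conjunct2, THEN perm]
  have "D i j k = 0" for i j k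
    \<comment> \<open>\<open>D\<close> is alternating, so its vanishing at the four increasing
      triples gives it for all triples.\<close>
    using exhaust_4[of i] exhaust_4[of j] exhaust_4[of k] by (elim disjE; hypsubst) (simp_all only: perms diag)
  then have m: "plucker x y (i, j) * z$k = plucker z y (i, j) * x$k + plucker x z (i, j) * y$k" for i j k
    by (simp add: D_def algebra_simps)
  obtain i j where ij: "plucker x y (i, j) \<noteq> 0" using xy by (auto simp: fun_eq_iff)
  \<comment> \<open>Cramer's rule with respect to a nonzero minor of \<open>x\<close> and
    \<open>y\<close>.\<close>
  have "z = (plucker z y (i, j) / plucker x y (i, j)) *s x + (plucker x z (i, j) / plucker x y (i, j)) *s y"
    using m[of i j] ij by (simp add: vec_eq_iff field_simps)
  then show ?thesis using span_pair by blast
qed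

section \<open>The standard form of \<open>U\<close> and its annihilator\<close>

lemma u_linear:
  "u_pm s \<alpha> \<beta> = fscale \<alpha> (u_pm s 1 0) + fscale \<beta> (u_pm s 0 1)"
  "u_pm s (\<alpha> + \<alpha>') (\<beta> + \<beta>') = u_pm s \<alpha> \<beta> + u_pm s \<alpha>' \<beta>'"
  "u_pm s (c * \<alpha>) (c * \<beta>) = fscale c (u_pm s \<alpha> \<beta>)"
  "u21 (x + y) = u21 x + u21 y" "u21 (c *s x) = fscale c (u21 x)"
  "u22 (x + y) = u22 x + u22 y" "u22 (c *s x) = fscale c (u22 x)"
  by (rule free_part_3_eqI; (intro u_closed fs.subspace_add[OF subF] fs.subspace_scale[OF subF])?;
      (unfold plus_fun_apply fscale_def u_defs)?; simp add: algebra_simps del: One_nat_def)+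

lemma u_zero: "u_pm s 0 0 = 0" "u21 0 = 0" "u22 0 = 0"
  using u_linear(3)[of s 0 0 0] u_linear(5)[of 0 0] u_linear(7)[of 0 0] by simp_all

abbreviation standard_module :: "'k::field \<Rightarrow> 'k ^ 4 \<Rightarrow> 'k ^ 4 \<Rightarrow> (mu_gen btree \<Rightarrow> 'k) set" where
  "standard_module s x y \<equiv> fs.span {u_pm s 1 0, u_pm s 0 1, u21 x, u22 x, u21 y, u22 y}"

text \<open>By linearity of \<open>u21\<close> and \<open>u22\<close>, the two-dimensional part is
  given by two independent vectors of the plane; in particular the module depends on
  \<open>x\<close> and \<open>y\<close> only through their span.\<close>

lemma standard_module_eq:
  "standard_module s x y =
    {u_pm s \<alpha> \<beta> + u21 z + u22 w | \<alpha> \<beta> z w. z \<in> vec.span {x, y} \<and> w \<in> vec.span {x, y}}" (is "_ = ?R")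
proof
  show "standard_module s x y \<subseteq> ?R"
  proof (rule fs.span_minimal)
    have x: "x \<in> vec.span {x, y}" and y: "y \<in> vec.span {x, y}" by (simp_all add: vec.span_base)
    note 0 = vec.span_zero[of "{x, y}"]
    have R: "u_pm s \<alpha> \<beta> + u21 z + u22 w \<in> ?R" if "z \<in> vec.span {x, y}" "w \<in> vec.span {x, y}" for \<alpha> \<beta> z w
      using that by blast
    show "{u_pm s 1 0, u_pm s 0 1, u21 x, u22 x, u21 y, u22 y} \<subseteq> ?R"
      using R[OF 0 0, of 1 0] R[OF 0 0, of 0 1] R[OF x 0, of 0 0] R[OF 0 x, of 0 0]
        R[OF y 0, of 0 0] R[OF 0 y, of 0 0] by (simp add: u_zero)
    show "fs.subspace ?R"
      unfolding fs.subspace_def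
    proof (intro conjI ballI allI)
      show "0 \<in> ?R" using R[OF 0 0, of 0 0] by (simp add: u_zero)
      fix u assume "u \<in> ?R"
      then obtain \<alpha> \<beta> z w where u: "u = u_pm s \<alpha> \<beta> + u21 z + u22 w"
        and zw: "z \<in> vec.span {x, y}" "w \<in> vec.span {x, y}" by blast
      show "fscale c u \<in> ?R" for c
        using R[OF zw[THEN vec.span_scale], of "c * \<alpha>" "c * \<beta>" c c]
        by (simp add: u u_linear(3,5,7) fs.scale_right_distrib)
      fix v assume "v \<in> ?R"
      then obtain \<alpha>' \<beta>' z' w' where v: "v = u_pm s \<alpha>' \<beta>' + u21 z' + u22 w'"
        and zw': "z' \<in> vec.span {x, y}" "w' \<in> vec.span {x, y}" by blast
      show "u + v \<in> ?R"
        using R[OF zw(1)[THEN vec.span_add, OF zw'(1)] zw(2)[THEN vec.span_add, OF zw'(2)], of "\<alpha> + \<alpha>'" "\<beta> + \<beta>'"]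
        by (simp add: u v u_linear(2,4,6) ac_simps)
    qed
  qed
next
  have pm: "u_pm s \<alpha> \<beta> \<in> standard_module s x y" for \<alpha> \<beta>
    unfolding u_linear(1)[of s \<alpha> \<beta>] by (intro fs.span_add fs.span_scale fs.span_base) auto
  have "u21 z \<in> standard_module s x y \<and> u22 z \<in> standard_module s x y" if "z \<in> vec.span {x, y}" for z
  proof -
    obtain p q where z: "z = p *s x + q *s y" using \<open>z \<in> vec.span {x, y}\<close> span_pair by blast
    show ?thesis unfolding z u_linear(4-7) by (intro conjI fs.span_add fs.span_scale fs.span_base) auto
  qed
  then show "?R \<subseteq> standard_module s x y" using pm by (auto intro!: fs.span_add)
qed

lemma lform_linear:
  "lform a b (p *s x + q *s y) z = p * lform a b x z + q * lform a b y z"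
  "lform a b z (p *s x + q *s y) = p * lform a b z x + q * lform a b z y"
  unfolding lform_def plucker_def by (simp_all add: algebra_simps)

lemma lform_alternating:
  assumes "(a, b) \<in> {(1, 0), (0, 1)}"
  shows "lform a b x x = 0" "lform a b y x = - lform a b x y"
  using assms by (auto simp: lform_def plucker_def algebra_simps)

text \<open>If \<open>ab \<noteq> 0\<close>, the symmetric part of \<open>lform\<close> is \<open>f g\<close> for the linear forms below.  If it
  vanishes on the plane, then so does \<open>f \<and> g\<close>, which is \<open>-2\<close> times the sum of the alternating forms.\<close>

lemma isotropic_imp_plucker:
  fixes x y :: "'k::field ^ 4"
  assumes "(2 :: 'k) \<noteq> 0" and ab: "a\<^sup>2 \<noteq> b\<^sup>2"
    and 0: "lform a b x x = 0" "lform a b x y = 0" "lform a b y x = 0" "lform a b y y = 0"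
  shows "plucker x y (1, 3) = plucker x y (2, 4) \<or> plucker x y (1, 4) = plucker x y (1, 2) + plucker x y (2, 3)"
proof (cases "a = 0 \<or> b = 0")
  case True
  then show ?thesis using ab 0(2) by (auto simp: lform_def)
next
  case False
  define f where "f v = v$1 - v$2" for v :: "'k ^ 4"
  define g where "g v = 2 * v$3 + 2 * v$4 - v$1 - v$2" for v :: "'k ^ 4"
  let ?A = "plucker x y (2, 4) - plucker x y (1, 3)"
  let ?B = "plucker x y (1, 2) + plucker x y (2, 3) - plucker x y (1, 4)"
  have "a * b * (f x * g x) = lform a b x x" "a * b * (f y * g y) = lform a b y y"
      "a * b * (f x * g y + f y * g x) = lform a b x y + lform a b y x"
    unfolding f_def g_def lform_def plucker_def by (simp_all add: algebra_simps)
  then have fg: "f x * g x = 0" "f y * g y = 0" "f x * g y + f y * g x = 0" using 0 False by auto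
  \<comment> \<open>If \<open>f x\<close> is nonzero, the first relation gives
    \<open>g x = 0\<close>, and then the third one gives the claim.\<close>
  have "f x * g y = 0" by (cases "f x = 0") (use fg in auto)
  moreover have "f y * g x = 0" using fg(3) \<open>f x * g y = 0\<close> by simp
  moreover have "f x * g y - f y * g x = - 2 * (?A + ?B)"
    unfolding f_def g_def plucker_def by (simp add: algebra_simps)
  ultimately have "2 * (?A + ?B) = 0" by algebra
  then have AB: "?A + ?B = 0" using assms(1) by (simp only: mult_eq_0_iff simp_thms)
  \<comment> \<open>Antisymmetrizing removes the symmetric part of the form. Together with
    \<open>?A + ?B = 0\<close> this leaves a linear system of determinant
    \<open>b\<^sup>2 - a\<^sup>2\<close>, up to sign.\<close>
  have "2 * (a\<^sup>2 * ?A + b\<^sup>2 * ?B) = lform a b x y - lform a b y x"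
    unfolding lform_def plucker_def by (simp add: algebra_simps)
  then have "a\<^sup>2 * ?A + b\<^sup>2 * ?B = 0" using assms(1) 0 by (simp only: mult_eq_0_iff simp_thms diff_self)
  then have "(a\<^sup>2 - b\<^sup>2) * ?A = 0" using AB by algebra
  then show ?thesis using ab by simp
qed

text \<open>The preimage of the annihilator under a pure substitution is \<open>U\<close> itself.
  Isotropy of the plane gives one inclusion. For the other, testing against the generators of
  \<open>U\<close> removes the component of opposite sign and puts \<open>z\<close> and
  \<open>w\<close> in the orthogonal complement of the plane, which is the plane.\<close>

lemma annihilator_standard_module:
  fixes x y :: "'k::field ^ 4"
  assumes char: "(2 :: 'k) \<noteq> 0" "(3 :: 'k) \<noteq> 0" and s: "s \<in> {1, -1}" and xy: "vec.dim {x, y} = 2"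
    and ab: "(a, b) \<in> {(1, 0), (0, 1)}" and 0: "lform a b x y = 0"
    and f: "f \<in> free_part 3"
  shows "(\<forall>u \<in> standard_module s x y. pairing (subst3 a b f) u = 0) \<longleftrightarrow> f \<in> standard_module s x y"
proof
  note alt = lform_alternating(1)[OF ab]
  have six: "(6 :: 'k) \<noteq> 0"
    using char by (metis mult_eq_0_iff numeral_times_numeral num_double mult_2)
  show "\<forall>u \<in> standard_module s x y. pairing (subst3 a b f) u = 0" if f_in: "f \<in> standard_module s x y"
  proof
    fix u assume "u \<in> standard_module s x y"
    then obtain \<alpha>' \<beta>' z' w' where u: "u = u_pm s \<alpha>' \<beta>' + u21 z' + u22 w'"
      and zw': "z' \<in> vec.span {x, y}" "w' \<in> vec.span {x, y}" unfolding standard_module_eq by blast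
    obtain \<alpha> \<beta> z w where f': "f = u_pm s \<alpha> \<beta> + u21 z + u22 w"
      and zw: "z \<in> vec.span {x, y}" "w \<in> vec.span {x, y}" using f_in unfolding standard_module_eq by blast
    have iso: "lform a b v v' = 0" if vv': "v \<in> vec.span {x, y}" "v' \<in> vec.span {x, y}" for v v'
    proof -
      obtain p q p' q' where "v = p *s x + q *s y" "v' = p' *s x + q' *s y" using vv' span_pair by metis
      moreover have "lform a b y x = 0" using lform_alternating(2)[OF ab, of y x] 0 by simp
      ultimately show ?thesis by (simp add: lform_linear alt 0)
    qed
    show "pairing (subst3 a b f) u = 0"
      using pairing_subst3[OF s, of a b \<alpha> \<beta> 0 0 z w \<alpha>' \<beta>' z' w'] iso zw zw'
      by (simp add: u f' u_zero)
  qed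
  assume ann: "\<forall>u \<in> standard_module s x y. pairing (subst3 a b f) u = 0"
  obtain \<alpha> \<beta> \<gamma> \<delta> z w where f': "f = u_pm s \<alpha> \<beta> + u_pm (-s) \<gamma> \<delta> + u21 z + u22 w"
    by (rule decompose[OF f s char])
  have *: "6 * (a\<^sup>2 * \<gamma> - s * b\<^sup>2 * \<delta> + a * b * (\<delta> - s * \<gamma>)) * \<alpha>'
    + 6 * (s * b\<^sup>2 * \<gamma> - a\<^sup>2 * \<delta> + a * b * (s * \<delta> - \<gamma>)) * \<beta>'
    + 3 * (lform a b z w' - lform a b w z') = 0"
    if "z' \<in> vec.span {x, y}" "w' \<in> vec.span {x, y}" for \<alpha>' \<beta>' z' w'
  proof -
    have "u_pm s \<alpha>' \<beta>' + u21 z' + u22 w' \<in> standard_module s x y"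
      using that unfolding standard_module_eq by blast
    then have "pairing (subst3 a b f) (u_pm s \<alpha>' \<beta>' + u21 z' + u22 w') = 0" using ann by blast
    then show ?thesis unfolding f' by (simp only: pairing_subst3[OF s])
  qed
  have lz: "lform a b v 0 = 0" for v by (simp add: lform_def plucker_def)
  have x: "x \<in> vec.span {x, y}" and y: "y \<in> vec.span {x, y}" by (simp_all add: vec.span_base)
  note zero = vec.span_zero[of "{x, y}"]
  \<comment> \<open>The test vectors are \<open>u22\<close> and \<open>u21\<close> of
    \<open>x\<close> and of \<open>y\<close>; each isolates one value of the form.\<close>
  have "lform a b z x = 0" "lform a b z y = 0" "lform a b w x = 0" "lform a b w y = 0"
    using *[OF zero x, of 0 0] *[OF zero y, of 0 0] *[OF x zero, of 0 0] *[OF y zero, of 0 0] char by (simp_all add: lz)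
  then have "z \<in> vec.span {x, y}" "w \<in> vec.span {x, y}"
    using lform_isotropic_maximal[OF ab] xy 0 unfolding dim_2_iff by blast+
  \<comment> \<open>Testing against the two generators \<open>u_pm s 1 0\<close> and
    \<open>u_pm s 0 1\<close> gives, up to sign, 6\<gamma> = 0 and 6\<delta> = 0.\<close>
  moreover have "\<gamma> = 0 \<and> \<delta> = 0"
    using *[OF zero zero, of 1 0] *[OF zero zero, of 0 1] six ab s by (auto simp: lz)
  ultimately show "f \<in> standard_module s x y"
    unfolding f' standard_module_eq by (auto simp: u_zero)
qed

text \<open>The definite description in \<open>p_point\<close> is justified because the plane can be
  recovered from the module: it consists of all \<open>v\<close> with \<open>u21 v\<close> in
  it.\<close>

lemma p_point_standard_module:
  fixes x y :: "'k::field ^ 4"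
  assumes char: "(2 :: 'k) \<noteq> 0" "(3 :: 'k) \<noteq> 0" and s: "s \<in> {1, -1}" and xy: "vec.dim {x, y} = 2"
  shows "p_point (standard_module s x y) = proj_point (plucker x y)"
  unfolding p_point_def
proof (rule the_equality)
  show "\<exists>s' x' y'. s' \<in> {1, -1} \<and> vec.dim {x', y'} = 2 \<and> standard_module s x y = standard_module s' x' y'
      \<and> proj_point (plucker x y) = proj_point (plucker x' y')" using s xy by blast
  fix p assume "\<exists>s' x' y'. s' \<in> {1, -1} \<and> vec.dim {x', y'} = 2 \<and> standard_module s x y = standard_module s' x' y'
      \<and> p = proj_point (plucker x' y')"
  then obtain s' x' y' where s': "s' \<in> {1, -1}" "vec.dim {x', y'} = 2"
    and e: "standard_module s x y = standard_module s' x' y'" and p: "p = proj_point (plucker x' y')" by blast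
  have "v \<in> vec.span {x, y}" if uv: "u21 v \<in> standard_module s x y" for v
  proof -
    obtain \<alpha> \<beta> z w where v: "u21 v = u_pm s \<alpha> \<beta> + u21 z + u22 w"
      and zw: "z \<in> vec.span {x, y}" "w \<in> vec.span {x, y}" using uv unfolding standard_module_eq by blast
    have ev: "u21 v t = u_pm s \<alpha> \<beta> t + u21 z t + u22 w t" for t by (simp add: v)
    note ev1 = ev[of "left_comb Mu 1 2 3"] ev[of "left_comb Mu 2 1 3"] ev[of "left_comb Mu 3 2 1"]
      ev[of "left_comb Mu 2 3 1"] ev[of "left_comb Mu 1 3 2"] ev[of "left_comb Mu 3 1 2"]
    note ev2 = ev[of "right_comb Mu 3 1 2"] ev[of "right_comb Mu 3 2 1"] ev[of "right_comb Mu 1 3 2"]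
      ev[of "right_comb Mu 1 2 3"] ev[of "right_comb Mu 2 1 3"] ev[of "right_comb Mu 2 3 1"]
    \<comment> \<open>Eliminating the \<open>u_pm\<close> part costs one factor 3, eliminating the
      \<open>u22\<close> part another; \<open>algebra\<close> cannot divide by them.\<close>
    have A: "3 * (3 * (v$1 - z$1)) = 0 \<and> 3 * (3 * (v$3 - z$3)) = 0"
      using ev1[unfolded u_defs, simplified] by algebra
    have B: "3 * (3 * (v$2 - z$2)) = 0 \<and> 3 * (3 * (v$4 - z$4)) = 0"
      using ev2[unfolded u_defs, simplified] by algebra
    have "v$1 = z$1 \<and> v$2 = z$2 \<and> v$3 = z$3 \<and> v$4 = z$4"
      using A B char(2) by (simp only: mult_eq_0_iff simp_thms right_minus_eq)
    then have "v = z" by (simp add: vec_eq_iff forall_4)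
    then show ?thesis using zw by simp
  qed
  moreover have "u21 x' \<in> standard_module s x y" "u21 y' \<in> standard_module s x y"
    unfolding e by (simp_all add: fs.span_base)
  ultimately show "p = proj_point (plucker x y)" unfolding p by (intro plucker_span s')
qed

text \<open>The equations are homogeneous, so one coordinate vector of the point decides them for
  all.\<close>

lemma proj_point_Y:
  fixes x y :: "'k::field ^ 4"
  assumes "vec.dim {x, y} = 2"
  shows "proj_point (plucker x y) \<in> Y1 \<longleftrightarrow> plucker x y (1, 3) = plucker x y (2, 4)"
    "proj_point (plucker x y) \<in> Y2 \<longleftrightarrow> plucker x y (1, 4) = plucker x y (1, 2) + plucker x y (2, 3)"
proof -
  have G: "proj_point (plucker x y) \<in> G24" unfolding G24_def using assms by blast
  have P: "plucker x y \<in> proj_point (plucker x y)" unfolding proj_point_def by (auto intro!: exI[of _ 1])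
  show "proj_point (plucker x y) \<in> Y1 \<longleftrightarrow> plucker x y (1, 3) = plucker x y (2, 4)"
    using G P unfolding Y1_def by (auto simp: proj_point_def fscale_def)
  show "proj_point (plucker x y) \<in> Y2 \<longleftrightarrow> plucker x y (1, 4) = plucker x y (1, 2) + plucker x y (2, 3)"
    using G P unfolding Y2_def by (auto simp: proj_point_def fscale_def distrib_left)
qed

section \<open>The structure of the module of relations\<close>

lemma relabel_id: "relabel id t = t"
  by (simp add: relabel_def plug_Leaf)

lemma relabel_inv:
  assumes "\<sigma> permutes A"
  shows "relabel (inv \<sigma>) (relabel \<sigma> t) = t" "relabel \<sigma> (relabel (inv \<sigma>) t) = t"
  by (simp_all add: relabel_relabel permutes_inv_o[OF assms] relabel_id)

lemma free_act_apply:
  fixes f :: "'g::finite btree \<Rightarrow> 'k::field"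
  assumes "\<sigma> permutes {1..n}" "f \<in> free_part n"
  shows "free_act n \<sigma> f t = f (relabel (inv \<sigma>) t)"
proof -
  have "flinear (\<lambda>f t. f (relabel (inv \<sigma>) t))" by (rule linI) (auto simp: fscale_def)
  moreover have "(single (relabel \<sigma> s) :: 'g btree \<Rightarrow> 'k) = (\<lambda>t. single s (relabel (inv \<sigma>) t))" for s
    unfolding single_def using relabel_inv[OF assms(1)] by (metis (full_types))
  ultimately have "free_act n \<sigma> f = (\<lambda>t. f (relabel (inv \<sigma>) t))"
    by (intro F_eqI[OF lin_A _ assms(2), of "\<lambda>f t. f (relabel (inv \<sigma>) t)"]) (simp_all only: A_single)
  then show ?thesis by simp
qed

lemma swap_permutes_3: "swap 1 2 permutes {1..3}" "swap 1 3 permutes {1..3}" "swap 2 3 permutes {1..3}"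
  by (simp_all add: permutes_swap_id)

lemma free_act_swap:
  assumes "f \<in> free_part 3"
  shows "free_act 3 (swap 1 2) f t = f (relabel (swap 1 2) t)"
    "free_act 3 (swap 1 3) f t = f (relabel (swap 1 3) t)"
    "free_act 3 (swap 2 3) f t = f (relabel (swap 2 3) t)"
  using free_act_apply[OF swap_permutes_3(1) assms] free_act_apply[OF swap_permutes_3(2) assms]
    free_act_apply[OF swap_permutes_3(3) assms] by simp_all

lemma relabel_combs:
  "relabel \<sigma> (left_comb g i j k) = left_comb g (\<sigma> i) (\<sigma> j) (\<sigma> k)"
  "relabel \<sigma> (right_comb g i j k) = right_comb g (\<sigma> i) (\<sigma> j) (\<sigma> k)"
  by (simp_all add: relabel_def)

lemma swap_values:
  "swap 1 2 1 = 2" "swap 1 2 2 = 1" "swap 1 2 3 = 3"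
  "swap 1 3 1 = 3" "swap 1 3 2 = 2" "swap 1 3 3 = 1"
  "swap 2 3 1 = 1" "swap 2 3 2 = 3" "swap 2 3 3 = 2"
  by (simp_all add: Transposition.transpose_def)

text \<open>Transpositions generate the symmetric group, which permutes the six left combs
  transitively and likewise the six right combs. So one value for each shape determines
  \<open>f\<close>.\<close>

lemma u_pm_eigen:
  assumes f: "f \<in> free_part 3"
    and "free_act 3 (swap 1 2) f = fscale s f" "free_act 3 (swap 1 3) f = fscale s f" "free_act 3 (swap 2 3) f = fscale s f"
    and s: "s * s = 1"
  shows "f = u_pm s (f (left_comb Mu 1 2 3)) (f (right_comb Mu 3 1 2))"
proof -
  have 12: "f (relabel (swap 1 2) t) = s * f t" and 13: "f (relabel (swap 1 3) t) = s * f t"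
    and 23: "f (relabel (swap 2 3) t) = s * f t" for t
    using fun_cong[OF assms(2), of t] fun_cong[OF assms(3), of t] fun_cong[OF assms(4), of t]
    by (simp_all add: free_act_swap[OF f] fscale_def del: One_nat_def)
  note vals = 12[of "left_comb Mu 1 2 3"] 12[of "right_comb Mu 3 1 2"]
    13[of "left_comb Mu 1 2 3"] 13[of "left_comb Mu 2 1 3"] 13[of "right_comb Mu 3 1 2"] 13[of "right_comb Mu 3 2 1"]
    23[of "left_comb Mu 1 2 3"] 23[of "left_comb Mu 2 1 3"] 23[of "right_comb Mu 3 1 2"] 23[of "right_comb Mu 3 2 1"]
  have ss: "s * (s * c) = c" for c using s by (simp add: mult.assoc[symmetric])
  show ?thesis
    by (rule free_part_3_eqI[OF f u_closed(1)]; unfold u_defs vals[unfolded relabel_combs swap_values])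
      (simp_all add: ss)
qed

text \<open>The assumptions are relations satisfied by the vector \<open>(1, -1, 0)\<close> of
  \<open>M_two\<close>. They leave four free values among the twelve, and these are the coordinates
  of \<open>x\<close>. The vector \<open>u22 x\<close> then corresponds to
  \<open>(1, 0, -1)\<close>.\<close>

lemma u2_eigen:
  fixes f :: "mu_gen btree \<Rightarrow> 'k::field"
  assumes f: "f \<in> free_part 3"
    and "free_act 3 (swap 1 2) f = fscale (-1) f" "free_act 3 (swap 1 3) f + free_act 3 (swap 2 3) f = f"
  obtains x where "f = u21 x" "free_act 3 (swap 2 3) f = u22 x"
proof -
  have 12: "f (relabel (swap 1 2) t) = - f t"
    and 13: "f (relabel (swap 1 3) t) + f (relabel (swap 2 3) t) = f t" for t
    using fun_cong[OF assms(2), of t] fun_cong[OF assms(3), of t]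
    by (simp_all add: free_act_swap[OF f] fscale_def del: One_nat_def)
  note vals = 12[of "left_comb Mu 1 2 3"] 12[of "right_comb Mu 3 1 2"] 12[of "left_comb Mu 3 2 1"] 12[of "right_comb Mu 1 3 2"]
    13[of "left_comb Mu 1 2 3"] 13[of "right_comb Mu 3 1 2"] 13[of "left_comb Mu 2 1 3"] 13[of "right_comb Mu 3 2 1"]
  have act: "free_act 3 (swap 2 3) f \<in> free_part 3" by (rule A_closed[OF swap_permutes_3(3)])
  obtain x :: "'k ^ 4" where x: "x$1 = f (left_comb Mu 1 2 3)" "x$2 = f (right_comb Mu 3 1 2)"
    "x$3 = f (left_comb Mu 3 2 1)" "x$4 = f (right_comb Mu 1 3 2)" using vec4_exists by metis
  note v = vals[unfolded relabel_combs swap_values, folded x]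
  have "f (left_comb Mu 2 1 3) = - x$1" "f (right_comb Mu 3 2 1) = - x$2"
    "f (left_comb Mu 3 1 2) = - x$3" "f (right_comb Mu 2 3 1) = - x$4"
    "f (left_comb Mu 1 3 2) = x$1 - x$3" "f (right_comb Mu 2 1 3) = x$2 - x$4"
    "f (left_comb Mu 2 3 1) = x$3 - x$1" "f (right_comb Mu 1 2 3) = x$4 - x$2"
    using v by algebra+
  note w = this x[symmetric]
  show ?thesis
  proof (rule that)
    show "f = u21 x"
      by (rule free_part_3_eqI[OF f u_closed(2)]; unfold u_defs w) simp_all
    show "free_act 3 (swap 2 3) f = u22 x"
      by (rule free_part_3_eqI[OF act u_closed(3)]; unfold u_defs free_act_swap[OF f] relabel_combs swap_values w) simp_all
  qed
qed

text \<open>Generators of the model module are pulled back to \<open>U\<close>. The relations they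
  satisfy identify them as vectors \<open>u_pm\<close> and \<open>u21\<close>; expanding an
  arbitrary element of the model in the generators and their images shows that they span.\<close>

lemma S3_isomorphic_standard_module:
  fixes U :: "(mu_gen btree \<Rightarrow> 'k::field) set" and M :: "('k, unit) S3_module"
  assumes U: "S3_submodule U"
    and iso: "S3_isomorphic (as_S3_module U) ((M \<oplus>\<^sub>S M) \<oplus>\<^sub>S (M_two \<oplus>\<^sub>S M_two))"
    and M: "car M = UNIV" "\<And>x. mact M (swap 1 2) x = fscale s x" "\<And>x. mact M (swap 1 3) x = fscale s x"
      "\<And>x. mact M (swap 2 3) x = fscale s x"
    and s: "s * s = 1"
  obtains x y where "vec.dim {x, y} = 2" "U = standard_module s x y"
proof -
  define N where "N = (M \<oplus>\<^sub>S M) \<oplus>\<^sub>S (M_two \<oplus>\<^sub>S (M_two :: ('k, nat) S3_module))"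
  have UF: "U \<subseteq> free_part 3" and sub: "fs.subspace U"
    and Uact: "\<And>\<sigma> u. u \<in> U \<Longrightarrow> \<sigma> permutes {1..3} \<Longrightarrow> free_act 3 \<sigma> u \<in> U"
    using U unfolding S3_submodule_def fF by blast+
  note Uadd = fs.subspace_add[OF sub] and Uscale = fs.subspace_scale[OF sub]
  obtain \<phi> where bij: "bij_betw \<phi> U (car N)"
    and add: "\<And>u v. u \<in> U \<Longrightarrow> v \<in> U \<Longrightarrow> \<phi> (u + v) = \<phi> u + \<phi> v"
    and scale: "\<And>c u. u \<in> U \<Longrightarrow> \<phi> (fscale c u) = fscale c (\<phi> u)"
    and act: "\<And>\<sigma> u. u \<in> U \<Longrightarrow> \<sigma> permutes {1..3} \<Longrightarrow> \<phi> (free_act 3 \<sigma> u) = mact N \<sigma> (\<phi> u)"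
    using iso unfolding S3_isomorphic_def N_def as_S3_module_def by auto
  have inj: "u = v" if "u \<in> U" "v \<in> U" "\<phi> u = \<phi> v" for u v
    using that bij by (auto simp: bij_betw_def inj_on_def)
  have carN: "n \<in> car N \<longleftrightarrow> n \<circ> Inr \<circ> Inl \<in> car M_two \<and> n \<circ> Inr \<circ> Inr \<in> car M_two" for n
    by (simp add: N_def dsum_def M)
  have sum3: "(\<Sum>i = 1..3. n i) = n 1 + n 2 + n 3" for n :: "nat \<Rightarrow> 'k"
    by (simp add: eval_nat_numeral)
  have "single (Inl i) \<in> car N" for i
    unfolding carN by (auto simp: M_two_def single_def)
  then obtain v1 v2 where v: "v1 \<in> U" "\<phi> v1 = single (Inl (Inl ()))" "v2 \<in> U" "\<phi> v2 = single (Inl (Inr ()))"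
    using bij unfolding bij_betw_def by (metis imageE)
  \<comment> \<open>\<open>w I i\<close> is the difference of the first and the \<open>i\<close>-th
    unit vectors in the copy \<open>I\<close> of \<open>M_two\<close>; \<open>i = 2\<close> and
    \<open>i = 3\<close> give a basis of that copy.\<close>
  define w :: "(nat \<Rightarrow> nat + nat) \<Rightarrow> nat \<Rightarrow> (unit + unit) + nat + nat \<Rightarrow> 'k"
    where "w I i = single (Inr (I 1)) - single (Inr (I i))" for I i
  have w_apply: "w I i (Inl j) = 0"
    "w Inl i (Inr (Inl k)) = (if k = 1 then 1 else 0) - (if k = i then 1 else 0)" "w Inl i (Inr (Inr k)) = 0"
    "w Inr i (Inr (Inr k)) = (if k = 1 then 1 else 0) - (if k = i then 1 else 0)" "w Inr i (Inr (Inl k)) = 0" for I i j k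
    by (auto simp: w_def single_def)
  have "w Inl 2 \<in> car N" "w Inr 2 \<in> car N"
    unfolding carN by (auto simp: M_two_def single_def w_def sum3 simp del: One_nat_def)
  then obtain a1 a2 where a: "a1 \<in> U" "\<phi> a1 = w Inl 2" "a2 \<in> U" "\<phi> a2 = w Inr 2"
    using bij unfolding bij_betw_def by (metis imageE)
  have mactN: "mact N \<sigma> n (Inl (Inl ())) = mact M \<sigma> (n \<circ> Inl \<circ> Inl) ()"
    "mact N \<sigma> n (Inl (Inr ())) = mact M \<sigma> (n \<circ> Inl \<circ> Inr) ()"
    "mact N \<sigma> n (Inr (Inl i)) = n (Inr (Inl (inv \<sigma> i)))"
    "mact N \<sigma> n (Inr (Inr i)) = n (Inr (Inr (inv \<sigma> i)))" for \<sigma> n i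
    by (simp_all add: N_def dsum_def M_two_def comp_assoc)
  have N_ext: "n = n'" if "n (Inl (Inl ())) = n' (Inl (Inl ()))" "n (Inl (Inr ())) = n' (Inl (Inr ()))"
    "\<And>i. n (Inr (Inl i)) = n' (Inr (Inl i))" "\<And>i. n (Inr (Inr i)) = n' (Inr (Inr i))"
    for n n' :: "(unit + unit) + nat + nat \<Rightarrow> 'k"
  proof
    fix j show "n j = n' j"
      using that by (cases j) (metis (full_types) sum.exhaust old.unit.exhaust)+
  qed
  have v_act: "free_act 3 \<sigma> v = fscale s v"
    if "\<sigma> \<in> {swap 1 2, swap 1 3, swap 2 3}" "v \<in> {v1, v2}" for \<sigma> v
  proof (rule inj)
    have \<sigma>: "\<sigma> permutes {1..3}" using that swap_permutes_3 by blast
    have vU: "v \<in> U" using that v by blast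
    show "free_act 3 \<sigma> v \<in> U" "fscale s v \<in> U" using vU \<sigma> by (simp_all add: Uact Uscale)
    have M': "mact M \<sigma> n = fscale s n" for n using that M by blast
    show "\<phi> (free_act 3 \<sigma> v) = \<phi> (fscale s v)"
      unfolding act[OF vU \<sigma>] scale[OF vU]
      using that(2) v by (intro N_ext) (auto simp: mactN M' fscale_def single_def)
  qed
  have v_eq: "\<exists>p q. v = u_pm s p q" if "v \<in> {v1, v2}" for v
    using u_pm_eigen[of v s] v_act[OF _ that] that v(1,3) UF s by blast
  then obtain p q p' q' where v_eq: "v1 = u_pm s p q" "v2 = u_pm s p' q'" by (metis insertI1 insertI2)
  \<comment> \<open>The relations needed for \<open>u2_eigen\<close> hold for \<open>w I 2\<close>
    in the model and return to \<open>U\<close> by injectivity of \<phi>.\<close>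
  have a_act: "free_act 3 (swap 1 2) a = fscale (-1) a" "free_act 3 (swap 1 3) a + free_act 3 (swap 2 3) a = a"
      "\<phi> (free_act 3 (swap 2 3) a) = w I 3"
    if "a \<in> U" "\<phi> a = w I 2" "I \<in> {Inl, Inr}" for a I
  proof -
    note acts = Uact[OF that(1) swap_permutes_3(1)] Uact[OF that(1) swap_permutes_3(2)] Uact[OF that(1) swap_permutes_3(3)]
    note \<phi>acts = act[OF that(1) swap_permutes_3(1)] act[OF that(1) swap_permutes_3(2)] act[OF that(1) swap_permutes_3(3)]
    have 0: "fscale s 0 = 0" for s :: 'k by (simp add: fscale_def fun_eq_iff)
    have z: "w I i \<circ> Inl \<circ> J = 0" for I i and J :: "unit \<Rightarrow> unit + unit" by (simp add: w_def single_def fun_eq_iff)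
    have I: "I = Inl \<or> I = Inr" using that by blast
    show "free_act 3 (swap 1 2) a = fscale (-1) a"
    proof (rule inj)
      show "\<phi> (free_act 3 (swap 1 2) a) = \<phi> (fscale (-1) a)"
        unfolding \<phi>acts scale[OF that(1)] that(2)
        using I by (intro N_ext) (auto simp: mactN M z 0 w_apply Transposition.transpose_def fscale_def simp del: One_nat_def split: if_splits)
    qed (simp_all only: acts(1) Uscale that(1))
    show "free_act 3 (swap 1 3) a + free_act 3 (swap 2 3) a = a"
    proof (rule inj)
      show "\<phi> (free_act 3 (swap 1 3) a + free_act 3 (swap 2 3) a) = \<phi> a"
        unfolding add[OF acts(2,3)] \<phi>acts that(2)
        using I by (intro N_ext) (auto simp: mactN M z 0 w_apply Transposition.transpose_def fscale_def simp del: One_nat_def split: if_splits)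
    qed (use that acts in \<open>simp_all add: Uadd\<close>)
    show "\<phi> (free_act 3 (swap 2 3) a) = w I 3"
      unfolding \<phi>acts that(2)
      using I by (intro N_ext) (auto simp: mactN M z 0 w_apply Transposition.transpose_def fscale_def simp del: One_nat_def split: if_splits)
  qed
  obtain x where x: "a1 = u21 x" "free_act 3 (swap 2 3) a1 = u22 x"
    using u2_eigen[of a1] a_act[OF a(1,2)] a(1) UF by blast
  obtain y where y: "a2 = u21 y" "free_act 3 (swap 2 3) a2 = u22 y"
    using u2_eigen[of a2] a_act[OF a(3,4)] a(3) UF by blast
  have b: "u22 x \<in> U" "\<phi> (u22 x) = w Inl 3" "u22 y \<in> U" "\<phi> (u22 y) = w Inr 3"
    unfolding x(2)[symmetric] y(2)[symmetric]
    using Uact[OF a(1) swap_permutes_3(3)] Uact[OF a(3) swap_permutes_3(3)] a_act(3)[OF a(1,2)] a_act(3)[OF a(3,4)]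
    by simp_all
  have \<phi>0: "\<phi> 0 = 0" using scale[OF v(1), of 0] by (simp add: fscale_def zero_fun_def)
  have indep_v: "c = 0 \<and> d = 0" if "fscale c v1 + fscale d v2 = 0" for c d
  proof -
    have "fscale c (\<phi> v1) + fscale d (\<phi> v2) = 0" using that \<phi>0 by (metis add scale Uscale v(1,3))
    then have "(fscale c (\<phi> v1) + fscale d (\<phi> v2)) j = 0" for j by simp
    from this[of "Inl (Inl ())"] this[of "Inl (Inr ())"] show ?thesis by (simp add: v fscale_def single_def)
  qed
  have indep_a: "c = 0 \<and> d = 0" if "fscale c a1 + fscale d a2 = 0" for c d
  proof -
    have "fscale c (\<phi> a1) + fscale d (\<phi> a2) = 0" using that \<phi>0 by (metis add scale Uscale a(1,3))
    then have "(fscale c (\<phi> a1) + fscale d (\<phi> a2)) j = 0" for j by simp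
    from this[of "Inr (Inl 1)"] this[of "Inr (Inr 1)"] show ?thesis by (simp add: a w_def fscale_def single_def)
  qed
  have "plucker x y \<noteq> 0"
  proof
    assume "plucker x y = 0"
    then obtain c d where cd: "c *s x + d *s y = 0" "c \<noteq> 0 \<or> d \<noteq> 0" by (rule plucker_eq_0_imp)
    have "fscale c a1 + fscale d a2 = u21 (c *s x + d *s y)" by (simp only: x y u_linear)
    then show False using indep_a cd by (simp add: u_zero)
  qed
  then have dim: "vec.dim {x, y} = 2" by (simp add: dim_2_iff)
  \<comment> \<open>The determinant of \<open>v1\<close> and \<open>v2\<close> in the space of all
    \<open>u_pm s\<close>; once it is nonzero, Cramer's rule recovers the standard
    generators.\<close>
  define e where "e = p * q' - p' * q"
  have comb: "fscale c v1 + fscale d v2 = u_pm s (c * p + d * p') (c * q + d * q')" for c d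
    by (simp only: v_eq u_linear(2,3))
  have "e \<noteq> 0"
  proof
    assume e: "e = 0"
    \<comment> \<open>These combinations have the coordinates \<open>(e, 0)\<close> and
      \<open>(0, -e)\<close>.\<close>
    have "fscale q' v1 + fscale (-q) v2 = 0" "fscale p' v1 + fscale (-p) v2 = 0"
      unfolding comb using e by (simp_all add: e_def algebra_simps u_zero)
    then have "p = 0" "q = 0" using indep_v[of q' "-q"] indep_v[of p' "-p"] by auto
    then have "fscale 1 v1 + fscale 0 v2 = 0" by (simp add: v_eq u_zero)
    then show False using indep_v[of 1 0] by simp
  qed
  have pm: "u_pm s 1 0 = fscale (q' / e) v1 + fscale (- q / e) v2" "u_pm s 0 1 = fscale (- p' / e) v1 + fscale (p / e) v2"
  proof -
    have coeffs: "q' / e * p + - q / e * p' = 1" "q' / e * q + - q / e * q' = 0"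
      "- p' / e * p + p / e * p' = 0" "- p' / e * q + p / e * q' = 1"
      using \<open>e \<noteq> 0\<close> by (simp_all add: e_def divide_simps)
    then show "u_pm s 1 0 = fscale (q' / e) v1 + fscale (- q / e) v2" "u_pm s 0 1 = fscale (- p' / e) v1 + fscale (p / e) v2"
      by (simp_all only: comb coeffs)
  qed
  have "standard_module s x y \<subseteq> U"
    by (rule fs.span_minimal[OF _ sub])
      (unfold pm insert_subset, intro conjI empty_subsetI Uadd Uscale v(1,3) b(1,3) a(1,3)[unfolded x y])
  moreover have "u \<in> standard_module s x y" if u: "u \<in> U" for u
  proof -
    define n where "n = \<phi> u"
    have n: "n \<in> car N" using bij u by (auto simp: n_def bij_betw_def)
    \<comment> \<open>A vector with coordinate sum zero is
      \<open>-n2 (e1 - e2) - n3 (e1 - e3)\<close> in terms of its second and third coordinates;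
      hence the minus signs.\<close>
    define u' where "u' = fscale (n (Inl (Inl ()))) v1 + fscale (n (Inl (Inr ()))) v2
      + fscale (- n (Inr (Inl 2))) (u21 x) + fscale (- n (Inr (Inl 3))) (u22 x)
      + fscale (- n (Inr (Inr 2))) (u21 y) + fscale (- n (Inr (Inr 3))) (u22 y)"
    note closed = Uadd Uscale v(1,3) b(1,3) a(1,3)[unfolded x y]
    have "\<phi> u' = fscale (n (Inl (Inl ()))) (\<phi> v1) + fscale (n (Inl (Inr ()))) (\<phi> v2)
      + fscale (- n (Inr (Inl 2))) (\<phi> (u21 x)) + fscale (- n (Inr (Inl 3))) (\<phi> (u22 x))
      + fscale (- n (Inr (Inr 2))) (\<phi> (u21 y)) + fscale (- n (Inr (Inr 3))) (\<phi> (u22 y))" (is "_ = ?comb")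
      unfolding u'_def by (simp only: add scale closed)
    also have "\<dots> = n"
    proof -
      have M2: "n (Inr (J 1)) = - n (Inr (J 2)) - n (Inr (J 3)) \<and> (i \<noteq> 1 \<longrightarrow> i \<noteq> 2 \<longrightarrow> i \<noteq> 3 \<longrightarrow> n (Inr (J i)) = 0)"
        if "J = Inl \<or> J = Inr" for J i
      proof -
        have "n \<circ> Inr \<circ> J \<in> car M_two" using n that unfolding carN by blast
        then have "n (Inr (J 1)) + n (Inr (J 2)) + n (Inr (J 3)) = 0" "i \<notin> {1..3} \<longrightarrow> n (Inr (J i)) = 0"
          unfolding M_two_def by (simp_all add: sum3[of "n \<circ> Inr \<circ> J", unfolded comp_def] comp_def del: One_nat_def)
        moreover have "i \<in> {1..3} \<longleftrightarrow> i = 1 \<or> i = 2 \<or> i = 3" by auto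
        moreover have "b = - c - d" if "b + c + d = 0" for b c d :: 'k using that by algebra
        ultimately show ?thesis by blast
      qed
      show ?thesis
      proof (rule N_ext)
        fix i
        show "?comb (Inr (Inl i)) = n (Inr (Inl i))"
          using M2[of Inl i] by (cases "i = 1"; cases "i = 2"; cases "i = 3")
            (simp_all add: v a[unfolded x y] b fscale_def single_def w_def del: One_nat_def)
        show "?comb (Inr (Inr i)) = n (Inr (Inr i))"
          using M2[of Inr i] by (cases "i = 1"; cases "i = 2"; cases "i = 3")
            (simp_all add: v a[unfolded x y] b fscale_def single_def w_def del: One_nat_def)
      qed (simp_all add: v a[unfolded x y] b fscale_def single_def w_def)
    qed
    finally have "\<phi> u' = \<phi> u" by (simp add: n_def)
    moreover have "u' \<in> U" unfolding u'_def by (intro closed)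
    ultimately have "u = u'" using inj[OF u] by simp
    have "v1 \<in> standard_module s x y" "v2 \<in> standard_module s x y"
      unfolding v_eq u_linear(1)[of s p q] u_linear(1)[of s p' q']
      by (intro fs.span_add fs.span_scale fs.span_base; simp)+
    then show ?thesis unfolding \<open>u = u'\<close> u'_def by (intro fs.span_add fs.span_scale) (auto intro: fs.span_base)
  qed
  ultimately show ?thesis using that[OF dim] by blast
qed

section \<open>Isomorphisms in low arities\<close>

lemma free_part_0:
  fixes f :: "'g::finite btree \<Rightarrow> 'k::field"
  assumes "f \<in> free_part 0"
  shows "f = 0"
  using assms by (auto simp: trees_0 fun_eq_iff)

lemma free_part_1:
  fixes f :: "'g::finite btree \<Rightarrow> 'k::field"
  assumes "f \<in> free_part 1"
  shows "f = fscale (f (Leaf 1)) (single (Leaf 1))"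
  using F_expand[OF assms] by (simp add: trees_1 del: One_nat_def)

lemma comp_zero: "free_comp m n i 0 y = 0" "free_comp m n i x 0 = 0"
  by (simp_all add: C_eq fscale_def fun_eq_iff sum_fun_apply)

text \<open>This ideal bounds the one generated by \<open>U\<close> in arities 2 and 3.\<close>

lemma relations_ideal:
  fixes U :: "('g::finite btree \<Rightarrow> 'k::field) set"
  assumes "S3_submodule U"
  shows "operad_ideal (free_operad :: ('k, 'g btree \<Rightarrow> 'k) operad)
    (\<lambda>n. if n < 3 then {0} else if n = 3 then U else free_part n)" (is "operad_ideal ?F ?J")
proof -
  interpret operad ?F by (rule free_operad)
  have U: "U \<subseteq> free_part 3" "fs.subspace U" "\<And>\<sigma> x. x \<in> U \<Longrightarrow> \<sigma> permutes {1..3} \<Longrightarrow> free_act 3 \<sigma> x \<in> U"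
    using assms unfolding S3_submodule_def fF by auto
  have 0: "0 \<in> ?J n" for n using fs.subspace_0[OF U(2)] by auto
  have scale: "fscale c x \<in> ?J n" if "x \<in> ?J n" for c x n
    using that fs.subspace_scale[OF U(2)] fs.subspace_scale[OF subF[of n]] by (simp del: mem_Collect_eq split: if_splits)
  show ?thesis
    unfolding operad_ideal_def fF
  proof (intro conjI allI ballI impI)
    fix n x y \<sigma> assume x: "x \<in> ?J n"
    show "x + y \<in> ?J n" if "y \<in> ?J n"
      using x that fs.subspace_add[OF U(2)] fs.subspace_add[OF subF[of n]] by (simp del: mem_Collect_eq split: if_splits)
    show "free_act n \<sigma> x \<in> ?J n" if \<sigma>: "\<sigma> permutes {1..n}"
    proof -
      have "free_act n \<sigma> 0 = 0" by (simp add: A_eq fscale_def fun_eq_iff sum_fun_apply)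
      then show ?thesis using x U(3)[of x \<sigma>] A_closed[OF \<sigma>, of x] \<sigma> by (simp del: mem_Collect_eq One_nat_def split: if_splits)
    qed
  next
    fix m n i and x y :: "'g btree \<Rightarrow> 'k"
    assume x: "x \<in> free_part m" and y: "y \<in> free_part n" and h: "1 \<le> i \<and> i \<le> m \<and> (x \<in> ?J m \<or> y \<in> ?J n)"
    have i: "1 \<le> i" "i \<le> m" using h by auto
    \<comment> \<open>Above arity 3 the candidate is everything. Otherwise an arity 0 factor
      vanishes, an arity 1 factor is a multiple of the unit, and in the remaining case a binary
      factor in the ideal is zero.\<close>
    consider "m + n - 1 > 3" | "n = 0" | "n = 1" | "m = 1" | "m = 2 \<and> n = 2"
      using i by linarith
    then show "free_comp m n i x y \<in> ?J (m + n - 1)"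
    proof cases
      case 1
      then show ?thesis using C_closed[OF i, of n x y] by simp
    next
      case 2
      then have "y = 0" using y free_part_0 by blast
      then have "free_comp m n i x y = 0" by (simp only: comp_zero)
      then show ?thesis using 0[of "m + n - 1"] by (simp only:)
    next
      case 3
      define c where "c = y (Leaf 1)"
      have yc: "y = fscale c (single (Leaf 1))" using free_part_1 y 3 unfolding c_def by blast
      have "free_comp m n i x y = fscale c x"
        using comp_scale_right[of x m "ounit ?F" 1 i c] unit_right[of x m i] x i 3 unit_closed
        by (simp only: yc fF)
      moreover have "fscale c x \<in> ?J m"
      proof (cases "x \<in> ?J m")
        case False
        then have "y = 0" using h 3 by simp
        then have "c = 0" by (simp add: c_def)
        then show ?thesis using 0[of m] by simp
      qed (rule scale)
      ultimately show ?thesis by (simp only: 3 add_diff_cancel_right')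
    next
      case 4
      define c where "c = x (Leaf 1)"
      have xc: "x = fscale c (single (Leaf 1))" using free_part_1 x 4 unfolding c_def by blast
      have "i = 1" using i 4 by simp
      have "free_comp m n i x y = fscale c y"
        using comp_scale_left[of "ounit ?F" 1 y n 1 c] unit_left[of y n] y 4 unit_closed
        by (simp only: xc fF \<open>i = 1\<close>)
      moreover have "fscale c y \<in> ?J n"
      proof (cases "y \<in> ?J n")
        case False
        then have "x = 0" using h 4 by simp
        then have "c = 0" by (simp add: c_def)
        then show ?thesis using 0[of n] by simp
      qed (rule scale)
      ultimately show ?thesis by (simp only: 4 add_diff_cancel_left')
    next
      case 5
      then have "x = 0 \<or> y = 0" using h by simp
      then have "free_comp m n i x y = 0" by (elim disjE) (simp_all only: comp_zero)
      then show ?thesis using 0[of "m + n - 1"] by (simp only:)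
    qed
  qed (use 0 scale U in \<open>auto split: if_splits\<close>)
qed

text \<open>With no relations in arity 2 and exactly \<open>U\<close> in arity 3, an isomorphism of
  quotients has a well-defined effect on the generator and on the relations.\<close>

lemma generated_ideal_low:
  fixes U :: "('g::finite btree \<Rightarrow> 'k::field) set"
  assumes "S3_submodule U"
  shows "generated_ideal free_operad 3 U 2 \<subseteq> {0}" "generated_ideal free_operad 3 U 3 = U"
proof -
  let ?J = "\<lambda>n. if n < 3 then {0} else if n = 3 then U else free_part n"
  have "generated_ideal free_operad 3 U n \<subseteq> ?J n" for n
    unfolding generated_ideal_def using relations_ideal[OF assms] by (intro Inter_lower) (auto intro!: exI[of _ ?J])
  from this[of 2] this[of 3]
  show "generated_ideal free_operad 3 U 2 \<subseteq> {0}" "generated_ideal free_operad 3 U 3 = U"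
    by (auto simp: generated_ideal_def)
qed

section \<open>The substitution attached to an isomorphism\<close>

lemma subst3_scale: "subst3 a b (fscale c f) = fscale c (subst3 a b f)"
proof
  fix t show "subst3 a b (fscale c f) t = fscale c (subst3 a b f) t"
    by (cases "(a, b, f, t)" rule: subst3.cases) (simp_all add: fscale_def algebra_simps)
qed

lemma subst3_single:
  fixes a b :: "'k::field"
  shows
  "subst3 a b (single (left_comb Mu i j k)) =
    fscale (a\<^sup>2) (single (left_comb Nu i j k)) + fscale (a * b) (single (left_comb Nu j i k))
    + fscale (a * b) (single (right_comb Nu k i j)) + fscale (b\<^sup>2) (single (right_comb Nu k j i))"
  "subst3 a b (single (right_comb Mu i j k)) =
    fscale (a\<^sup>2) (single (right_comb Nu i j k)) + fscale (a * b) (single (right_comb Nu i k j))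
    + fscale (a * b) (single (left_comb Nu j k i)) + fscale (b\<^sup>2) (single (left_comb Nu k j i))"
proof -
  have nu: "g = h \<longleftrightarrow> True" for g h :: nu_gen by (cases g; cases h) simp
  show "subst3 a b (single (left_comb Mu i j k)) =
    fscale (a\<^sup>2) (single (left_comb Nu i j k)) + fscale (a * b) (single (left_comb Nu j i k))
    + fscale (a * b) (single (right_comb Nu k i j)) + fscale (b\<^sup>2) (single (right_comb Nu k j i))" (is "?l = ?r")
  proof
    fix t show "?l t = ?r t"
      by (cases "(a, b, single (left_comb Mu i j k) :: mu_gen btree \<Rightarrow> 'k, t)" rule: subst3.cases) (auto simp: single_def fscale_def nu)
  qed
  show "subst3 a b (single (right_comb Mu i j k)) =
    fscale (a\<^sup>2) (single (right_comb Nu i j k)) + fscale (a * b) (single (right_comb Nu i k j))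
    + fscale (a * b) (single (left_comb Nu j k i)) + fscale (b\<^sup>2) (single (left_comb Nu k j i))" (is "?l = ?r")
  proof
    fix t show "?l t = ?r t"
      by (cases "(a, b, single (right_comb Mu i j k) :: mu_gen btree \<Rightarrow> 'k, t)" rule: subst3.cases) (auto simp: single_def fscale_def nu)
  qed
qed

lemma grafts_of_corollas:
  "graft 2 1 (corolla g) (corolla g) = left_comb g 1 2 3" "graft 2 1 (corolla g) (corolla' g) = left_comb g 2 1 3"
  "graft 2 1 (corolla' g) (corolla g) = right_comb g 3 1 2" "graft 2 1 (corolla' g) (corolla' g) = right_comb g 3 2 1"
  "graft 2 2 (corolla g) (corolla g) = right_comb g 1 2 3" "graft 2 2 (corolla g) (corolla' g) = right_comb g 1 3 2"
  "graft 2 2 (corolla' g) (corolla g) = left_comb g 2 3 1" "graft 2 2 (corolla' g) (corolla' g) = left_comb g 3 2 1"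
  by (simp_all add: corolla_def corolla'_def relabel_def graft_def shift_input_def)

lemma corolla_trees: "corolla g \<in> trees 2" "corolla' g \<in> trees 2"
  by (auto simp: trees_def corolla_def corolla'_def relabel_def)

lemma comb_trees:
  assumes "distinct [i, j, k]" "{i, j, k} = {1..3}"
  shows "left_comb g i j k \<in> trees 3" "right_comb g i j k \<in> trees 3"
  using assms by (auto simp: trees_def)

lemma permutation_3_exists:
  assumes "distinct [i, j, k]" "{i, j, k} = {1..3 :: nat}"
  obtains \<sigma> where "\<sigma> permutes {1..3}" "\<sigma> 1 = i" "\<sigma> 2 = j" "\<sigma> 3 = k"
proof
  let ?\<sigma> = "id(1 := i, 2 := j, 3 := k)"
  have "bij_betw ?\<sigma> {1, 2, 3} {i, j, k}"
    using assms(1) by (auto simp: bij_betw_def inj_on_def)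
  then have "bij_betw ?\<sigma> {1..3} {1..3}" by (simp only: assms(2) atLeastAtMost_1_3[symmetric])
  then show "?\<sigma> permutes {1..3}" by (rule bij_imp_permutes) auto
qed simp_all

text \<open>Every tree of arity 3 arises from the generator by one composition and a relabelling.
  The same expression in \<open>m\<close>, an arbitrary binary element, is what
  \<open>subst3_single\<close> lists; so a morphism sending the generator to \<open>m\<close> acts
  in arity 3 by \<open>subst3\<close>.\<close>

lemma act_comp_binary:
  fixes g :: "'g::finite" and a b :: "'k::field"
  defines "m \<equiv> fscale a (single (corolla g)) + fscale b (single (corolla' g))"
  shows "free_act 3 \<sigma> (free_comp 2 2 1 m m) =
      fscale (a\<^sup>2) (single (left_comb g (\<sigma> 1) (\<sigma> 2) (\<sigma> 3))) + fscale (a * b) (single (left_comb g (\<sigma> 2) (\<sigma> 1) (\<sigma> 3)))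
      + fscale (a * b) (single (right_comb g (\<sigma> 3) (\<sigma> 1) (\<sigma> 2))) + fscale (b\<^sup>2) (single (right_comb g (\<sigma> 3) (\<sigma> 2) (\<sigma> 1)))"
    "free_act 3 \<sigma> (free_comp 2 2 2 m m) =
      fscale (a\<^sup>2) (single (right_comb g (\<sigma> 1) (\<sigma> 2) (\<sigma> 3))) + fscale (a * b) (single (right_comb g (\<sigma> 1) (\<sigma> 3) (\<sigma> 2)))
      + fscale (a * b) (single (left_comb g (\<sigma> 2) (\<sigma> 3) (\<sigma> 1))) + fscale (b\<^sup>2) (single (left_comb g (\<sigma> 3) (\<sigma> 2) (\<sigma> 1)))"
proof -
  have T: "left_comb g 1 2 3 \<in> trees 3" "left_comb g 2 1 3 \<in> trees 3" "left_comb g 2 3 1 \<in> trees 3" "left_comb g 3 2 1 \<in> trees 3"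
    "right_comb g 3 1 2 \<in> trees 3" "right_comb g 3 2 1 \<in> trees 3" "right_comb g 1 2 3 \<in> trees 3" "right_comb g 1 3 2 \<in> trees 3"
    by (auto intro!: comb_trees)
  note expand = m_def linD[OF lin_C1] linD[OF lin_C2] linD[OF lin_A] C_single[OF corolla_trees(1) corolla_trees(1)]
    C_single[OF corolla_trees(1) corolla_trees(2)] C_single[OF corolla_trees(2) corolla_trees(1)]
    C_single[OF corolla_trees(2) corolla_trees(2)] grafts_of_corollas A_single[OF T(1)] A_single[OF T(2)] A_single[OF T(3)]
    A_single[OF T(4)] A_single[OF T(5)] A_single[OF T(6)] A_single[OF T(7)] A_single[OF T(8)] relabel_combs
  show "free_act 3 \<sigma> (free_comp 2 2 1 m m) =
      fscale (a\<^sup>2) (single (left_comb g (\<sigma> 1) (\<sigma> 2) (\<sigma> 3))) + fscale (a * b) (single (left_comb g (\<sigma> 2) (\<sigma> 1) (\<sigma> 3)))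
      + fscale (a * b) (single (right_comb g (\<sigma> 3) (\<sigma> 1) (\<sigma> 2))) + fscale (b\<^sup>2) (single (right_comb g (\<sigma> 3) (\<sigma> 2) (\<sigma> 1)))"
    unfolding expand by (simp add: fscale_def fun_eq_iff power2_eq_square algebra_simps)
  show "free_act 3 \<sigma> (free_comp 2 2 2 m m) =
      fscale (a\<^sup>2) (single (right_comb g (\<sigma> 1) (\<sigma> 2) (\<sigma> 3))) + fscale (a * b) (single (right_comb g (\<sigma> 1) (\<sigma> 3) (\<sigma> 2)))
      + fscale (a * b) (single (left_comb g (\<sigma> 2) (\<sigma> 3) (\<sigma> 1))) + fscale (b\<^sup>2) (single (left_comb g (\<sigma> 3) (\<sigma> 2) (\<sigma> 1)))"
    unfolding expand by (simp add: fscale_def fun_eq_iff power2_eq_square algebra_simps)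
qed

text \<open>The necessity half: \<open>a\<close> and \<open>b\<close> are the coordinates of a
  representative \<open>m\<close> of the image of \<mu>. The isomorphism agrees with
  \<open>subst3 a b\<close> on classes of arity 3, so relations go to relations.\<close>

lemma isomorphism_imp_subst3:
  fixes U :: "(mu_gen btree \<Rightarrow> 'k::field) set" and W :: "(nu_gen btree \<Rightarrow> 'k) set"
  assumes U: "S3_submodule U" and W: "S3_submodule W"
    and "operad_isomorphic (quadratic_operad U) (quadratic_operad W)"
  obtains a b where "a\<^sup>2 \<noteq> b\<^sup>2" "\<And>u. u \<in> U \<Longrightarrow> subst3 a b u \<in> W"
proof -
  let ?F = "free_operad :: ('k, mu_gen btree \<Rightarrow> 'k) operad" and ?G = "free_operad :: ('k, nu_gen btree \<Rightarrow> 'k) operad"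
  define I where "I = generated_ideal ?F 3 U"
  define J where "J = generated_ideal ?G 3 W"
  have UF: "U \<subseteq> oper ?F 3" and WG: "W \<subseteq> oper ?G 3" using U W unfolding S3_submodule_def by auto
  interpret F: operad_with_ideal ?F I
    unfolding I_def by (rule operad_with_ideal_generated[OF free_operad UF])
  interpret G: operad_with_ideal ?G J
    unfolding J_def by (rule operad_with_ideal_generated[OF free_operad WG])
  let ?P = "quotient_operad ?F I" and ?Q = "quotient_operad ?G J"
  let ?c = "coset ?F I" and ?d = "coset ?G J"
  obtain \<phi> where iso: "operad_iso \<phi> ?P ?Q"
    using assms(3) unfolding operad_isomorphic_iff quadratic_operad_def I_def J_def by blast
  note D = operad_isoD[OF iso]
  have I: "I 2 \<subseteq> {0}" "I 3 = U" and J: "J 3 = W"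
    using generated_ideal_low[OF U] generated_ideal_low[OF W] by (simp_all add: I_def J_def)
  note quot = F.qadd F.qscale F.qact F.qcomp G.qadd G.qscale G.qact G.qcomp
  define mu :: "mu_gen btree \<Rightarrow> 'k" where "mu = single (corolla Mu)"
  have mu: "mu \<in> oper ?F 2"
    unfolding fF mu_def using corolla_trees(1) by (auto simp: single_def)
  have "\<phi> 2 (?c 2 mu) \<in> oper ?Q 2" by (intro D(7) F.qcoset mu)
  then obtain m where m: "m \<in> oper ?G 2" and \<phi>mu: "\<phi> 2 (?c 2 mu) = ?d 2 m"
    unfolding G.qrest by blast
  define a b where "a = m (corolla Nu)" and "b = m (corolla' Nu)"
  have ne: "corolla g \<noteq> corolla' g" for g :: 'g by (simp add: corolla_def corolla'_def relabel_def)
  have m_eq: "m = fscale a (single (corolla Nu)) + fscale b (single (corolla' Nu))"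
    using F_expand[OF m[unfolded fF]] unfolding trees_2[OF UNIV_nu_gen] a_def b_def by (simp add: ne)
  have mu_eq: "mu = fscale 1 (single (corolla Mu)) + fscale 0 (single (corolla' Mu))"
    by (simp add: mu_def)
  have c1: "1 \<le> (1 :: nat)" "(1 :: nat) \<le> 2" "1 \<le> (2 :: nat)" "(2 :: nat) \<le> 2" "2 + 2 - 1 = (3 :: nat)" by simp_all
  have \<phi>_act_comp: "\<phi> 3 (?c 3 (free_act 3 \<sigma> (free_comp 2 2 i mu mu))) = ?d 3 (free_act 3 \<sigma> (free_comp 2 2 i m m))"
    if \<sigma>: "\<sigma> permutes {1..3}" and i: "1 \<le> i" "i \<le> 2" for \<sigma> i
  proof -
    have cF: "free_comp 2 2 i mu mu \<in> oper ?F 3" using F.comp_closed[OF mu mu i] by (simp only: c1)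
    have cG: "free_comp 2 2 i m m \<in> oper ?G 3" using G.comp_closed[OF m m i] by (simp only: c1)
    have "\<phi> 3 (?c 3 (free_act 3 \<sigma> (free_comp 2 2 i mu mu))) = oact ?Q 3 \<sigma> (\<phi> 3 (?c 3 (free_comp 2 2 i mu mu)))"
      unfolding F.qact[OF cF \<sigma>, symmetric] by (rule D(6)[OF F.qcoset[OF cF] \<sigma>])
    also have "?c 3 (free_comp 2 2 i mu mu) = ocomp ?P 2 2 i (?c 2 mu) (?c 2 mu)"
      using F.qcomp[OF mu mu i] by (simp only: c1)
    also have "\<phi> 3 \<dots> = ocomp ?Q 2 2 i (?d 2 m) (?d 2 m)"
      using D(5)[OF F.qcoset[OF mu] F.qcoset[OF mu] i] by (simp only: c1 \<phi>mu)
    also have "\<dots> = ?d 3 (free_comp 2 2 i m m)" using G.qcomp[OF m m i] by (simp only: c1)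
    also have "oact ?Q 3 \<sigma> \<dots> = ?d 3 (free_act 3 \<sigma> (free_comp 2 2 i m m))" by (rule G.qact[OF cG \<sigma>])
    finally show ?thesis .
  qed
  \<comment> \<open>The elements on which the isomorphism is computed by the substitution. They form
    a subspace containing all trees, hence everything of arity 3.\<close>
  define S where "S = {f \<in> free_part 3. subst3 a b f \<in> free_part 3 \<and> \<phi> 3 (?c 3 f) = ?d 3 (subst3 a b f)}"
  have SI: "f \<in> S" if "f \<in> free_part 3" "subst3 a b f \<in> free_part 3" "\<phi> 3 (?c 3 f) = ?d 3 (subst3 a b f)" for f
    using that unfolding S_def by blast
  have "single t \<in> S" if t: "t \<in> trees 3" for t
  proof -
    have t': "single t \<in> free_part 3" using t by (auto simp: single_def)
    from UNIV_mu_gen t show ?thesis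
    proof (cases rule: trees_3_cases)
      case (left i j k)
      obtain \<sigma> where \<sigma>: "\<sigma> permutes {1..3}" "\<sigma> 1 = i" "\<sigma> 2 = j" "\<sigma> 3 = k"
        by (rule permutation_3_exists[OF left(2,3)])
      have 1: "free_act 3 \<sigma> (free_comp 2 2 1 mu mu) = single t"
        unfolding mu_eq act_comp_binary \<sigma> left(1) by simp
      have 2: "free_act 3 \<sigma> (free_comp 2 2 1 m m) = subst3 a b (single t)"
        unfolding m_eq act_comp_binary \<sigma> left(1) subst3_single ..
      show ?thesis
        using t' \<phi>_act_comp[OF \<sigma>(1) c1(1,2), unfolded 1 2] A_closed[OF \<sigma>(1), of "free_comp 2 2 1 m m", unfolded 2]
        by (intro SI)
    next
      case (right i j k)
      obtain \<sigma> where \<sigma>: "\<sigma> permutes {1..3}" "\<sigma> 1 = i" "\<sigma> 2 = j" "\<sigma> 3 = k"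
        by (rule permutation_3_exists[OF right(2,3)])
      have 1: "free_act 3 \<sigma> (free_comp 2 2 2 mu mu) = single t"
        unfolding mu_eq act_comp_binary \<sigma> right(1) by simp
      have 2: "free_act 3 \<sigma> (free_comp 2 2 2 m m) = subst3 a b (single t)"
        unfolding m_eq act_comp_binary \<sigma> right(1) subst3_single ..
      show ?thesis
        using t' \<phi>_act_comp[OF \<sigma>(1) c1(3,4), unfolded 1 2] A_closed[OF \<sigma>(1), of "free_comp 2 2 2 m m", unfolded 2]
        by (intro SI)
    qed
  qed
  moreover have \<phi>0: "\<phi> 3 (?c 3 0) = ?d 3 0"
    using operad_iso_zero[OF iso F.quotient_operad G.quotient_operad, of 3] by (simp add: F.qrest G.qrest fF)
  moreover have s0: "subst3 a b 0 = 0" using subst3_scale[of a b 0 0] by simp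
  moreover have "fs.subspace S"
    unfolding fs.subspace_def
  proof (intro conjI ballI allI)
    show "0 \<in> S" using \<phi>0 s0 by (simp add: S_def)
    fix f assume f: "f \<in> S"
    then have f': "f \<in> oper ?F 3" "subst3 a b f \<in> oper ?G 3" "\<phi> 3 (?c 3 f) = ?d 3 (subst3 a b f)"
      by (simp_all add: S_def fF)
    show "fscale c f \<in> S" for c
      using F.scale_closed[OF f'(1), of c] G.scale_closed[OF f'(2), of c] D(3)[OF F.qcoset[OF f'(1)], of c]
      unfolding f'(3) F.qscale[OF f'(1)] G.qscale[OF f'(2)] fF subst3_scale[symmetric] by (rule SI)
    fix f2 assume f2: "f2 \<in> S"
    then have f2': "f2 \<in> oper ?F 3" "subst3 a b f2 \<in> oper ?G 3" "\<phi> 3 (?c 3 f2) = ?d 3 (subst3 a b f2)"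
      by (simp_all add: S_def fF)
    show "f + f2 \<in> S"
      using F.add_closed[OF f'(1) f2'(1)] G.add_closed[OF f'(2) f2'(2)] D(2)[OF F.qcoset[OF f'(1)] F.qcoset[OF f2'(1)]]
      unfolding f'(3) f2'(3) F.qadd[OF f'(1) f2'(1)] G.qadd[OF f'(2) f2'(2)] fF subst3_add[symmetric] by (rule SI)
  qed
  ultimately have "free_part 3 \<subseteq> S" unfolding F_span by (intro fs.span_minimal) auto
  have "subst3 a b u \<in> W" if u: "u \<in> U" for u
  proof -
    have uF: "u \<in> oper ?F 3" using u UF by blast
    then have "u \<in> S" using \<open>free_part 3 \<subseteq> S\<close> unfolding fF by blast
    then have su: "subst3 a b u \<in> oper ?G 3" "\<phi> 3 (?c 3 u) = ?d 3 (subst3 a b u)" by (simp_all add: S_def fF)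
    \<comment> \<open>A relation has the class of zero, hence so does its substitution, which
      therefore lies in \<open>J 3\<close>, that is, in \<open>W\<close>.\<close>
    have "?c 3 (0 + u) = ?c 3 0"
      using F.coset_shift[OF F.zero_closed, of u 3] u unfolding fF I(2) by blast
    then have "?d 3 (subst3 a b u) = ?d 3 0" using su \<phi>0 by simp
    then have "subst3 a b u \<in> ?d 3 0" using G.coset_self[OF su(1)] by simp
    then show ?thesis by (auto simp: coset_def fF J)
  qed
  moreover have "a\<^sup>2 \<noteq> b\<^sup>2"
  proof
    assume "a\<^sup>2 = b\<^sup>2"
    \<comment> \<open>Here \<open>e\<close> is 1 or -1, and the transposition multiplies
      \<open>m\<close> by \<open>e\<close>. Injectivity of \<open>\<phi> 2\<close> transfers this to
      \<open>mu\<close>, although \<open>mu\<close> and its transpose are independent and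
      \<open>I 2\<close> contains only zero.\<close>
    then obtain e where e: "a = e * b" "e * e = 1" by (metis power2_eq_iff mult_1 mult_minus1 square_eq_1_iff)
    then have be: "b = e * a" by (simp add: mult.assoc[symmetric])
    have p: "swap 1 2 permutes {1..2 :: nat}" by (simp add: permutes_swap_id)
    have cc: "relabel (swap 1 2) (corolla g) = corolla' g" "relabel (swap 1 2) (corolla' g) = corolla g" for g :: 'h
      by (simp_all add: corolla_def corolla'_def relabel_def)
    have "free_act 2 (swap 1 2) m = fscale a (single (corolla' Nu)) + fscale b (single (corolla Nu))"
      unfolding m_eq by (simp only: linD[OF lin_A] A_single corolla_trees cc)
    also have "\<dots> = fscale e m"
      unfolding m_eq fs.scale_right_distrib fs.scale_scale e(1)[symmetric] be[symmetric] by (rule add.commute)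
    finally have em: "free_act 2 (swap 1 2) m = fscale e m" .
    have "\<phi> 2 (?c 2 (free_act 2 (swap 1 2) mu)) = ?d 2 (fscale e m)"
      using D(6)[OF F.qcoset[OF mu] p] unfolding \<phi>mu F.qact[OF mu p] G.qact[OF m p] em .
    also have "\<dots> = \<phi> 2 (?c 2 (fscale e mu))"
      using D(3)[OF F.qcoset[OF mu], of e] unfolding \<phi>mu F.qscale[OF mu] G.qscale[OF m] fF by simp
    finally have "\<phi> 2 (?c 2 (free_act 2 (swap 1 2) mu)) = \<phi> 2 (?c 2 (fscale e mu))" .
    moreover have "free_act 2 (swap 1 2) mu \<in> oper ?F 2" "fscale e mu \<in> oper ?F 2"
      using F.act_closed[OF p mu] F.scale_closed[OF mu, of e] unfolding fF by blast+
    ultimately have "?c 2 (free_act 2 (swap 1 2) mu) = ?c 2 (fscale e mu)" "free_act 2 (swap 1 2) mu \<in> ?c 2 (free_act 2 (swap 1 2) mu)"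
      using bij_betw_imp_inj_on[OF D(1)[of 2]] F.qcoset F.coset_self by (auto dest: inj_onD)
    then have "free_act 2 (swap 1 2) mu \<in> ?c 2 (fscale e mu)" by simp
    then have "free_act 2 (swap 1 2) mu = fscale e mu" using I(1) by (auto simp: coset_def fF)
    then have "single (corolla' Mu) = fscale e mu" by (simp only: mu_def A_single corolla_trees cc)
    from fun_cong[OF this, of "corolla' Mu"] show False by (simp add: mu_def single_def fscale_def ne[symmetric])
  qed
  ultimately show ?thesis using that by blast
qed

section \<open>Invariance of the annihilator and the isomorphism criterion\<close>

lemma pairing_swap:
  assumes f: "f \<in> free_part 3" and u: "u \<in> free_part 3" and \<sigma>: "\<sigma> \<in> {swap 1 2, swap 1 3, swap 2 3}"
  shows "pairing (free_act 3 \<sigma> f) u = - pairing f (free_act 3 \<sigma> u)"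
  using \<sigma>
  by (elim insertE emptyE; hypsubst)
    (simp_all only: pairing_explicit free_act_swap[OF f] free_act_swap[OF u] relabel_combs swap_values; simp)+

text \<open>A transposition moves across the pairing at the price of a sign, so it preserves the
  annihilator; general permutations follow by induction on a product of transpositions.\<close>

lemma annihilator_submodule:
  fixes U :: "(mu_gen btree \<Rightarrow> 'k::field) set"
  assumes U: "S3_submodule U"
  shows "S3_submodule (annihilator U)"
proof -
  have "pairing (fscale c f) u = c * pairing f u" for c f and u :: "mu_gen btree \<Rightarrow> 'k"
    by (simp add: pairing_def fscale_def sum_distrib_left mult_ac)
  moreover have "pairing 0 u = 0" for u :: "mu_gen btree \<Rightarrow> 'k" by (simp add: pairing_def)
  moreover have "fs.subspace (oper free_operad 3 :: (nu_gen btree \<Rightarrow> 'k) set)"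
    unfolding fF by (rule subF)
  ultimately have sub: "fs.subspace (annihilator U)"
    unfolding fs.subspace_def annihilator_def by (auto simp: pairing_add)
  have step: "free_act 3 (swap i j) f \<in> annihilator U"
    if ij: "i \<in> {1..3}" "j \<in> {1..3}" "i \<noteq> j" and f: "f \<in> annihilator U" for i j f
  proof -
    have p: "swap i j permutes {1..3}" using ij by (simp add: permutes_swap_id)
    have "i = 1 \<or> i = 2 \<or> i = 3" "j = 1 \<or> j = 2 \<or> j = 3" using ij by auto
    then have s: "swap i j \<in> {swap 1 2, swap 1 3, swap 2 3}"
      using ij(3) by (elim disjE; simp add: transpose_commute del: One_nat_def)
    have "pairing (free_act 3 (swap i j) f) u = 0" if "u \<in> U" for u
    proof -
      have "u \<in> free_part 3" "free_act 3 (swap i j) u \<in> U" using U that p unfolding S3_submodule_def fF by blast+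
      then show ?thesis using pairing_swap[OF _ _ s, of f u] f by (simp add: annihilator_def fF)
    qed
    then show ?thesis using A_closed[OF p, of f] unfolding annihilator_def fF by blast
  qed
  have "free_act 3 \<sigma> f \<in> annihilator U" if \<sigma>: "\<sigma> permutes {1..3}" and f: "f \<in> annihilator U" for \<sigma> f
    using \<sigma> finite_atLeastAtMost
  proof (induction \<sigma> rule: permutes_induct)
    case id
    show ?case using f operad.act_id[OF free_operad, of f 3] f unfolding annihilator_def by (simp only: mem_Collect_eq)
  next
    case (swap i j \<tau>)
    have e: "free_act 3 (swap i j \<circ> \<tau>) f = free_act 3 (swap i j) (free_act 3 \<tau> f)"
      using operad.act_comp[OF free_operad, of "swap i j" 3 \<tau> f] swap f
      by (simp add: annihilator_def permutes_swap_id)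
    show ?case unfolding e using swap by (intro step)
  qed
  then show ?thesis using sub unfolding S3_submodule_def by (auto simp: annihilator_def)
qed

lemma isomorphic_koszul_dual_iff:
  fixes x y :: "'k::field ^ 4"
  assumes char: "(2 :: 'k) \<noteq> 0" "(3 :: 'k) \<noteq> 0" and s: "s \<in> {1, -1}" and xy: "vec.dim {x, y} = 2"
    and sub: "S3_submodule (standard_module s x y)"
  shows "operad_isomorphic (quadratic_operad (standard_module s x y)) (koszul_dual (standard_module s x y))
    \<longleftrightarrow> plucker x y (1, 3) = plucker x y (2, 4) \<or> plucker x y (1, 4) = plucker x y (1, 2) + plucker x y (2, 3)"
proof
  let ?U = "standard_module s x y"
  assume "operad_isomorphic (quadratic_operad ?U) (koszul_dual ?U)"
  then obtain a b where ab: "a\<^sup>2 \<noteq> b\<^sup>2" and ann: "\<And>u. u \<in> ?U \<Longrightarrow> subst3 a b u \<in> annihilator ?U"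
    unfolding koszul_dual_def using isomorphism_imp_subst3[OF sub annihilator_submodule[OF sub]] by metis
  \<comment> \<open>The diagonal values are needed too, since the form is not alternating when
    \<open>a * b\<close> is nonzero.\<close>
  have "lform a b v w = 0" if "v \<in> {x, y}" "w \<in> {x, y}" for v w
  proof -
    have "u21 v \<in> ?U" "u22 w \<in> ?U" using that by (auto intro: fs.span_base)
    then have "pairing (subst3 a b (u21 v)) (u22 w) = 0" using ann unfolding annihilator_def by blast
    then show ?thesis using char(2) by (simp add: pairing_u2_u2)
  qed
  then show "plucker x y (1, 3) = plucker x y (2, 4) \<or> plucker x y (1, 4) = plucker x y (1, 2) + plucker x y (2, 3)"
    by (intro isotropic_imp_plucker[OF char(1) ab]) simp_all
next
  let ?U = "standard_module s x y"
  assume "plucker x y (1, 3) = plucker x y (2, 4) \<or> plucker x y (1, 4) = plucker x y (1, 2) + plucker x y (2, 3)"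
  \<comment> \<open>The first equation selects \<mu> \<mapsto> \<nu> and the second \<mu> \<mapsto>
    \<nu>', the substitutions given by permutations of trees.\<close>
  then obtain a b :: 'k and r where ab: "(a, b) \<in> {(1, 0), (0, 1)}" and l: "lform a b x y = 0"
    and r: "\<And>f. f \<in> free_part 3 \<Longrightarrow> subst3 a b f = (\<lambda>t. f (retree r Mu t))"
  proof
    assume "plucker x y (1, 3) = plucker x y (2, 4)"
    then show thesis by (intro that[of 1 0 False, OF _ _ subst3_retree(1)]) (simp_all add: lform_def)
  next
    assume "plucker x y (1, 4) = plucker x y (1, 2) + plucker x y (2, 3)"
    then show thesis by (intro that[of 0 1 True, OF _ _ subst3_retree(2)]) (simp_all add: lform_def)
  qed
  have UF: "?U \<subseteq> free_part 3" using sub unfolding S3_submodule_def fF by blast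
  let ?\<phi> = "\<lambda>(n :: nat) f t. f (retree r Mu (t :: nu_gen btree)) :: 'k"
  have iso: "operad_iso ?\<phi> (free_operad :: ('k, mu_gen btree \<Rightarrow> 'k) operad) (free_operad :: ('k, nu_gen btree \<Rightarrow> 'k) operad)"
    by (rule operad_iso_retree[OF UNIV_mu_gen UNIV_nu_gen])
  note ann = annihilator_standard_module[OF char s xy ab l]
  have "?\<phi> 3 ` ?U = annihilator ?U"
  proof (intro equalityI subsetI)
    fix g assume "g \<in> ?\<phi> 3 ` ?U"
    then obtain f where f: "f \<in> ?U" "g = ?\<phi> 3 f" by blast
    have fF3: "f \<in> free_part 3" using f(1) UF by blast
    have "g = subst3 a b f" unfolding f(2) r[OF fF3] ..
    then have "\<forall>u\<in>?U. pairing g u = 0" using ann[OF fF3] f(1) by simp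
    moreover have "g \<in> oper free_operad 3"
      unfolding f(2) by (rule operad_isoD(7)[OF iso]) (simp only: fF fF3)
    ultimately show "g \<in> annihilator ?U" unfolding annihilator_def by blast
  next
    fix g assume g: "g \<in> annihilator ?U"
    then have "g \<in> oper free_operad 3" by (simp add: annihilator_def)
    then obtain f where f: "f \<in> free_part 3" "g = ?\<phi> 3 f"
      using operad_isoD(1)[OF iso, of 3] unfolding bij_betw_def fF(1) by blast
    have "\<forall>u\<in>?U. pairing (subst3 a b f) u = 0"
      using g unfolding r[OF f(1)] f(2) annihilator_def by blast
    then have "f \<in> ?U" unfolding ann[OF f(1)] .
    then show "g \<in> ?\<phi> 3 ` ?U" unfolding f(2) by (rule imageI)
  qed
  then show "operad_isomorphic (quadratic_operad ?U) (koszul_dual ?U)"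
    unfolding koszul_dual_def using UF by (intro quadratic_operad_isomorphic[OF iso]) (simp_all only: fF)
qed

theorem theorem1:
  fixes U :: "(mu_gen btree \<Rightarrow> 'k::field) set"
  assumes "CHAR('k) \<noteq> 2" and "CHAR('k) \<noteq> 3"
    and "S3_submodule U"
    and "S3_isomorphic (as_S3_module U) ((M_plus \<oplus>\<^sub>S M_plus) \<oplus>\<^sub>S (M_two \<oplus>\<^sub>S M_two))
       \<or> S3_isomorphic (as_S3_module U) ((M_minus \<oplus>\<^sub>S M_minus) \<oplus>\<^sub>S (M_two \<oplus>\<^sub>S M_two))"
  shows "operad_isomorphic (quadratic_operad U) (koszul_dual U) \<longleftrightarrow> p_point U \<in> Y1 \<union> Y2"
proof -
  \<comment> \<open>A characteristic dividing \<open>n\<close> would be nonzero, different from 1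
    and at most \<open>n\<close>; the assumptions exclude 2 and 3.\<close>
  have "(of_nat n :: 'k) \<noteq> 0" if "n = 2 \<or> n = 3" for n
  proof
    assume "(of_nat n :: 'k) = 0"
    then have "CHAR('k) dvd n" by (simp add: of_nat_eq_0_iff_char_dvd)
    moreover from this have "CHAR('k) \<noteq> 0" using that by (metis dvd_0_left_iff zero_neq_numeral)
    ultimately have "CHAR('k) \<le> n" "CHAR('k) \<noteq> 0" using that dvd_imp_le[of "CHAR('k)" n] by auto
    moreover have "CHAR('k) \<noteq> 1" by simp
    ultimately show False using assms(1,2) that by linarith
  qed
  from this[of 2] this[of 3] have two: "(2 :: 'k) \<noteq> 0" and three: "(3 :: 'k) \<noteq> 0" by simp_all
  \<comment> \<open>The sign \<open>s\<close> is the scalar by which transpositions act on the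
    one-dimensional summands: 1 for \<open>M_plus\<close>, -1 for \<open>M_minus\<close>.\<close>
  have "\<exists>s x y. s \<in> {1, -1} \<and> vec.dim {x, y} = 2 \<and> U = standard_module s x y"
    using assms(4)
  proof
    assume iso: "S3_isomorphic (as_S3_module U) ((M_plus \<oplus>\<^sub>S M_plus) \<oplus>\<^sub>S (M_two \<oplus>\<^sub>S M_two))"
    show ?thesis
      by (rule S3_isomorphic_standard_module[OF assms(3) iso, of 1]) (auto simp: M_plus_def)
  next
    assume iso: "S3_isomorphic (as_S3_module U) ((M_minus \<oplus>\<^sub>S M_minus) \<oplus>\<^sub>S (M_two \<oplus>\<^sub>S M_two))"
    show ?thesis
      by (rule S3_isomorphic_standard_module[OF assms(3) iso, of "-1"]) (auto simp: M_minus_def sign_swap_id)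
  qed
  then obtain s x y where s: "s \<in> {1, -1}" and xy: "vec.dim {x, y} = 2" and U: "U = standard_module s x y" by blast
  show ?thesis
    using isomorphic_koszul_dual_iff[OF two three s xy assms(3)[unfolded U]] proj_point_Y[OF xy]
    unfolding U p_point_standard_module[OF two three s xy] by blast
qed

end
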